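(* Let $d_1,d_2\in\mathbb{N}$ and let $\Phi\in\mathrm{UEB}(d_1,d_2)$ be a unital entanglement breaking map from $M_{d_1}$ to $M_{d_2}$. The following conditions are equivalent: (i) $\Phi$ is a $C^*$-extreme point of $\mathrm{UEB}(d_1,d_2)$. (ii) There exist rank-one operators $V_1,\dots,V_{d_2}\in M_{d_1\times d_2}$ such that $\Phi=\sum_{i=1}^{d_2}\mathrm{Ad}_{V_i}$ and such that, for every $k<d_2$ and every $\{i_1,i_2,\dots,i_k\}\subset\{1,2,\dots,d_2\}$, the matrix $\sum_{j=1}^k V_{i_j}^*V_{i_j}$ is not invertible. (iii) $\text{EB-rank}(\Phi)=d_2$. (iv) $\text{Choi-rank}(\Phi)=d_2$. (v) There exist $n\le d_2$, (distinct) pure states $\phi_1,\dots,\phi_n:M_{d_1}\to\mathbb{C}$ and mutually orthogonal projections $P_1,\dots,P_n\in M_{d_2}$ with $\sum_{i=1}^nP_i=I$ such that $\Phi(X)=\sum_{i=1}^n\phi_i(X)P_i$ for all $X\in M_{d_1}$. (vi) There exist unit vectors $u_1,\dots,u_{d_2}\in\mathbb{C}^{d_1}$ and an orthonormal basis $\{v_1,\dots,v_{d_2}\}$ of $\mathbb{C}^{d_2}$ such that $\Phi(X)=\sum_{i=1}^{d_2}\langle u_i,Xu_i\rangle\,|v_i\rangle\langle v_i|$ for all $X\in M_{d_1}$. (vii) There exist pure states $\phi_1,\dots,\phi_{d_2}:M_{d_1}\to\mathbb{C}$ such that $\Phi\cong\oplus_{i=1}^{d_2}\phi_i$.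
   Context: $M_{d_1\times d_2}$ is the space of complex $d_1\times d_2$ matrices, $M_d=M_{d\times d}$, $I$ is the identity matrix. Inner products are linear in the second variable. For $x\in\mathbb{C}^{d_1}$, $y\in\mathbb{C}^{d_2}$, $|x\rangle\langle y|\in M_{d_1\times d_2}$ is the map $z\mapsto\langle y,z\rangle x$ from $\mathbb{C}^{d_2}$ to $\mathbb{C}^{d_1}$. For $V\in M_{d_1\times d_2}$, $\mathrm{Ad}_V:M_{d_1}\to M_{d_2}$ is $\mathrm{Ad}_V(X)=V^*XV$. A positive semidefinite matrix $X\in M_k\otimes M_{d}$ is separable if $X=\sum_{i=1}^nA_i\otimes B_i$ with $A_i\in M_k$, $B_i\in M_d$ positive semidefinite. A completely positive (CP) map $\Phi:M_{d_1}\to M_{d_2}$ is entanglement breaking (EB) if for every $k\ge1$ and every positive semidefinite $X\in M_k\otimes M_{d_1}$ the matrix $(\mathrm{id}_k\otimes\Phi)(X)$ is separable; equivalently, $\Phi$ is a finite sum of maps $\mathrm{Ad}_{V}$ with $V\in M_{d_1\times d_2}$ of rank one. $\mathrm{UEB}(d_1,d_2)$ is the set of all unital EB maps $M_{d_1}\to M_{d_2}$. The Choi-rank of a CP map $\Phi$ is the minimum number of operators $V_i$ required to write $\Phi=\sum_i\mathrm{Ad}_{V_i}$; equivalently, the rank of the Choi matrix $C_\Phi=\sum_{i,j}E_{ij}\otimes\Phi(E_{ij})$. The EB-rank of $\Phi\in\mathrm{UEB}(d_1,d_2)$ is the minimum number of rank-one operators $V_i$ required to write $\Phi=\sum_i\mathrm{Ad}_{V_i}$.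 Maps $\Phi,\Psi:M_{d_1}\to M_{d_2}$ are unitarily equivalent, written $\Phi\cong\Psi$, if $\Psi=\mathrm{Ad}_U\circ\Phi$ for some unitary $U\in M_{d_2}$. $\Phi\in\mathrm{UEB}(d_1,d_2)$ is a $C^*$-extreme point of $\mathrm{UEB}(d_1,d_2)$ if, whenever $\Phi=\sum_{i=1}^n\mathrm{Ad}_{T_i}\circ\Phi_i$ with $T_i\in M_{d_2}$ invertible, $\sum_{i=1}^nT_i^*T_i=I$ and $\Phi_i\in\mathrm{UEB}(d_1,d_2)$, then each $\Phi_i$ is unitarily equivalent to $\Phi$. A state on $M_d$ is a unital CP map $M_d\to\mathbb{C}$. A CP map $\Phi$ is pure if every CP map $\Psi$ such that $\Phi-\Psi$ is CP is of the form $\Psi=\lambda\Phi$ with $\lambda\ge0$; a state $\phi$ on $M_d$ is pure if and only if $\phi(X)=\langle u,Xu\rangle$ for some unit vector $u\in\mathbb{C}^d$. $\oplus_{i=1}^{d_2}\phi_i:M_{d_1}\to M_{d_2}$ is the map sending $X$ to the diagonal matrix with diagonal entries $\phi_1(X),\dots,\phi_{d_2}(X)$. *)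

theory Defs
  imports "Jordan_Normal_Form.DL_Rank" "Jordan_Normal_Form.Schur_Decomposition"
begin

text \<open>
  \<open>M\<^bsub>d\<^sub>1\<times>d\<^sub>2\<^esub>\<close> is \<^term>\<open>carrier_mat d1 d2 :: complex mat set\<close>.  A map \<open>M\<^bsub>d\<^sub>1\<^esub> \<rightarrow> M\<^bsub>d\<^sub>2\<^esub>\<close> is a
  HOL function on all complex matrices of which only the values on \<^term>\<open>carrier_mat d1 d1\<close> matter:
  every equation between maps below is required on that carrier only.
\<close>

definition mat_sum :: "nat \<Rightarrow> nat \<Rightarrow> ('i \<Rightarrow> complex mat) \<Rightarrow> 'i set \<Rightarrow> complex mat" where
  "mat_sum nr nc A J = mat nr nc (\<lambda>(r, c). \<Sum>i\<in>J. A i $$ (r, c))"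

text \<open>The library's \<open>\<bullet>c\<close> is conjugate linear in its second argument, hence the swap:
  \<open>cinner\<close> is linear in the second argument.\<close>

definition cinner :: "complex vec \<Rightarrow> complex vec \<Rightarrow> complex" where
  "cinner x y = y \<bullet>c x"

definition ketbra :: "complex vec \<Rightarrow> complex vec \<Rightarrow> complex mat" where
  "ketbra x y = mat (dim_vec x) (dim_vec y) (\<lambda>(i, j). x $ i * conjugate (y $ j))"

text \<open>The order on \<^typ>\<open>complex\<close> is the one of \<open>HOL-Library.Complex_Order\<close>: \<open>0 \<le> z\<close> says that
  \<open>z\<close> is real and nonnegative.  The quadratic form being real already makes the matrix Hermitian.\<close>

definition psd :: "nat \<Rightarrow> complex mat \<Rightarrow> bool" where
  "psd n A \<longleftrightarrow> A \<in> carrier_mat n n \<and> (\<forall>v\<in>carrier_vec n. 0 \<le> cinner v (A *\<^sub>v v))"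

definition unitary_mat :: "nat \<Rightarrow> complex mat \<Rightarrow> bool" where
  "unitary_mat n U \<longleftrightarrow>
     U \<in> carrier_mat n n \<and> mat_adjoint U * U = 1\<^sub>m n \<and> U * mat_adjoint U = 1\<^sub>m n"

definition projection_mat :: "nat \<Rightarrow> complex mat \<Rightarrow> bool" where
  "projection_mat n P \<longleftrightarrow> P \<in> carrier_mat n n \<and> mat_adjoint P = P \<and> P * P = P"

definition Ad :: "complex mat \<Rightarrow> complex mat \<Rightarrow> complex mat" where
  "Ad V X = mat_adjoint V * X * V"

text \<open>Elements of \<open>M\<^sub>k \<otimes> M\<^sub>d\<close> are \<open>kd \<times> kd\<close> matrices seen as \<open>k \<times> k\<close> blocks of size
  \<open>d \<times> d\<close>; \<open>kron\<close> is the Kronecker product with this convention.\<close>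

definition kron :: "complex mat \<Rightarrow> complex mat \<Rightarrow> complex mat" where
  "kron A B = mat (dim_row A * dim_row B) (dim_col A * dim_col B)
     (\<lambda>(i, j). A $$ (i div dim_row B, j div dim_col B) * B $$ (i mod dim_row B, j mod dim_col B))"

definition tensor_block :: "nat \<Rightarrow> complex mat \<Rightarrow> nat \<Rightarrow> nat \<Rightarrow> complex mat" where
  "tensor_block d X i j = mat d d (\<lambda>(a, b). X $$ (i * d + a, j * d + b))"

text \<open>\<open>id\<^sub>k \<otimes> \<Phi>\<close>: apply \<open>\<Phi>\<close> to each of the \<open>k \<times> k\<close> blocks
  (see \<open>ampliation_kron\<close> below).\<close>

definition ampliation ::
    "nat \<Rightarrow> nat \<Rightarrow> nat \<Rightarrow> (complex mat \<Rightarrow> complex mat) \<Rightarrow> complex mat \<Rightarrow> complex mat" where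
  "ampliation k d1 d2 \<Phi> X = mat (k * d2) (k * d2)
     (\<lambda>(r, c). \<Phi> (tensor_block d1 X (r div d2) (c div d2)) $$ (r mod d2, c mod d2))"

definition linear_mat_map :: "nat \<Rightarrow> nat \<Rightarrow> (complex mat \<Rightarrow> complex mat) \<Rightarrow> bool" where
  "linear_mat_map d1 d2 \<Phi> \<longleftrightarrow>
     (\<forall>X\<in>carrier_mat d1 d1. \<Phi> X \<in> carrier_mat d2 d2) \<and>
     (\<forall>X\<in>carrier_mat d1 d1. \<forall>Y\<in>carrier_mat d1 d1. \<Phi> (X + Y) = \<Phi> X + \<Phi> Y) \<and>
     (\<forall>c. \<forall>X\<in>carrier_mat d1 d1. \<Phi> (c \<cdot>\<^sub>m X) = c \<cdot>\<^sub>m \<Phi> X)"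

lemma ampliation_kron:
  assumes \<Phi>: "linear_mat_map d1 d2 \<Phi>"
    and A: "A \<in> carrier_mat k k" and B: "B \<in> carrier_mat d1 d1"
  shows "ampliation k d1 d2 \<Phi> (kron A B) = kron A (\<Phi> B)"
proof -
  have PB: "\<Phi> B \<in> carrier_mat d2 d2" and sm: "\<And>c. \<Phi> (c \<cdot>\<^sub>m B) = c \<cdot>\<^sub>m \<Phi> B"
    using \<Phi> B by (auto simp: linear_mat_map_def)
  have idx: "i * d1 + a < k * d1" if "i < k" "a < d1" for i a
  proof -
    have "i * d1 + a < Suc i * d1" using that by simp
    also have "\<dots> \<le> k * d1" using that by (intro mult_le_mono) auto
    finally show ?thesis .
  qed
  have blk: "tensor_block d1 (kron A B) i j = (A $$ (i, j)) \<cdot>\<^sub>m B" if "i < k" "j < k" for i j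
    using that A B idx by (intro eq_matI) (auto simp: tensor_block_def kron_def)
  show ?thesis
  proof (rule eq_matI)
    fix r c assume "r < dim_row (kron A (\<Phi> B))" "c < dim_col (kron A (\<Phi> B))"
    then have rc: "r < k * d2" "c < k * d2" using A PB by (auto simp: kron_def)
    then have d2: "0 < d2" by (cases d2) auto
    have q: "r div d2 < k" "c div d2 < k"
      using rc by (auto simp: less_mult_imp_div_less)
    have m: "r mod d2 < d2" "c mod d2 < d2" using d2 by auto
    have "ampliation k d1 d2 \<Phi> (kron A B) $$ (r, c)
        = (A $$ (r div d2, c div d2) \<cdot>\<^sub>m \<Phi> B) $$ (r mod d2, c mod d2)"
      using rc by (simp add: ampliation_def blk[OF q] sm)
    also have "\<dots> = kron A (\<Phi> B) $$ (r, c)"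
      using rc A PB m by (simp add: kron_def)
    finally show "ampliation k d1 d2 \<Phi> (kron A B) $$ (r, c) = kron A (\<Phi> B) $$ (r, c)" .
  qed (use A PB in \<open>auto simp: ampliation_def kron_def\<close>)
qed

definition completely_positive :: "nat \<Rightarrow> nat \<Rightarrow> (complex mat \<Rightarrow> complex mat) \<Rightarrow> bool" where
  "completely_positive d1 d2 \<Phi> \<longleftrightarrow> linear_mat_map d1 d2 \<Phi> \<and>
     (\<forall>k\<ge>1. \<forall>X. psd (k * d1) X \<longrightarrow> psd (k * d2) (ampliation k d1 d2 \<Phi> X))"

definition separable :: "nat \<Rightarrow> nat \<Rightarrow> complex mat \<Rightarrow> bool" where
  "separable k d X \<longleftrightarrow> psd (k * d) X \<and>
     (\<exists>n::nat. \<exists>A B. (\<forall>i<n. psd k (A i) \<and> psd d (B i)) \<and>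
        X = mat_sum (k * d) (k * d) (\<lambda>i. kron (A i) (B i)) {..<n})"

definition entanglement_breaking :: "nat \<Rightarrow> nat \<Rightarrow> (complex mat \<Rightarrow> complex mat) \<Rightarrow> bool" where
  "entanglement_breaking d1 d2 \<Phi> \<longleftrightarrow> completely_positive d1 d2 \<Phi> \<and>
     (\<forall>k\<ge>1. \<forall>X. psd (k * d1) X \<longrightarrow> separable k d2 (ampliation k d1 d2 \<Phi> X))"

definition UEB :: "nat \<Rightarrow> nat \<Rightarrow> (complex mat \<Rightarrow> complex mat) set" where
  "UEB d1 d2 = {\<Phi>. entanglement_breaking d1 d2 \<Phi> \<and> \<Phi> (1\<^sub>m d1) = 1\<^sub>m d2}"

definition unitarily_equivalent ::
    "nat \<Rightarrow> nat \<Rightarrow> (complex mat \<Rightarrow> complex mat) \<Rightarrow> (complex mat \<Rightarrow> complex mat) \<Rightarrow> bool" where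
  "unitarily_equivalent d1 d2 \<Phi> \<Psi> \<longleftrightarrow>
     (\<exists>U. unitary_mat d2 U \<and> (\<forall>X\<in>carrier_mat d1 d1. \<Psi> X = Ad U (\<Phi> X)))"

definition cstar_extreme_UEB :: "nat \<Rightarrow> nat \<Rightarrow> (complex mat \<Rightarrow> complex mat) \<Rightarrow> bool" where
  "cstar_extreme_UEB d1 d2 \<Phi> \<longleftrightarrow> \<Phi> \<in> UEB d1 d2 \<and>
     (\<forall>(n::nat) T \<Psi>.
        (\<forall>i<n. T i \<in> carrier_mat d2 d2 \<and> invertible_mat (T i) \<and> \<Psi> i \<in> UEB d1 d2) \<longrightarrow>
        mat_sum d2 d2 (\<lambda>i. mat_adjoint (T i) * T i) {..<n} = 1\<^sub>m d2 \<longrightarrow>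
        (\<forall>X\<in>carrier_mat d1 d1. \<Phi> X = mat_sum d2 d2 (\<lambda>i. Ad (T i) (\<Psi> i X)) {..<n}) \<longrightarrow>
        (\<forall>i<n. unitarily_equivalent d1 d2 (\<Psi> i) \<Phi>))"

definition is_Ad_sum ::
    "nat \<Rightarrow> nat \<Rightarrow> (complex mat \<Rightarrow> complex mat) \<Rightarrow> nat \<Rightarrow> (nat \<Rightarrow> complex mat) \<Rightarrow> bool" where
  "is_Ad_sum d1 d2 \<Phi> n V \<longleftrightarrow> (\<forall>i<n. V i \<in> carrier_mat d1 d2) \<and>
     (\<forall>X\<in>carrier_mat d1 d1. \<Phi> X = mat_sum d2 d2 (\<lambda>i. Ad (V i) X) {..<n})"

text \<open>The two minima below are over nonempty sets, and hence meaningful, when \<open>\<Phi>\<close> is CP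
  and when \<open>\<Phi>\<close> is EB, respectively.\<close>

definition choi_rank :: "nat \<Rightarrow> nat \<Rightarrow> (complex mat \<Rightarrow> complex mat) \<Rightarrow> nat" where
  "choi_rank d1 d2 \<Phi> = (LEAST n. \<exists>V. is_Ad_sum d1 d2 \<Phi> n V)"

definition eb_rank :: "nat \<Rightarrow> nat \<Rightarrow> (complex mat \<Rightarrow> complex mat) \<Rightarrow> nat" where
  "eb_rank d1 d2 \<Phi> =
     (LEAST n. \<exists>V. is_Ad_sum d1 d2 \<Phi> n V \<and> (\<forall>i<n. vec_space.rank d1 (V i) = 1))"

definition pure_cp :: "nat \<Rightarrow> nat \<Rightarrow> (complex mat \<Rightarrow> complex mat) \<Rightarrow> bool" where
  "pure_cp d1 d2 \<Phi> \<longleftrightarrow> completely_positive d1 d2 \<Phi> \<and>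
     (\<forall>\<Psi>. completely_positive d1 d2 \<Psi> \<and> completely_positive d1 d2 (\<lambda>X. \<Phi> X - \<Psi> X) \<longrightarrow>
        (\<exists>t::real. 0 \<le> t \<and> (\<forall>X\<in>carrier_mat d1 d1. \<Psi> X = complex_of_real t \<cdot>\<^sub>m \<Phi> X)))"

text \<open>A functional \<open>M\<^sub>d \<rightarrow> \<complex>\<close> is completely positive or pure when it is so as a map into \<open>M\<^sub>1\<close>.\<close>

definition as_M1_map :: "(complex mat \<Rightarrow> complex) \<Rightarrow> complex mat \<Rightarrow> complex mat" where
  "as_M1_map \<phi> X = mat 1 1 (\<lambda>_. \<phi> X)"

definition state :: "nat \<Rightarrow> (complex mat \<Rightarrow> complex) \<Rightarrow> bool" where
  "state d \<phi> \<longleftrightarrow> completely_positive d 1 (as_M1_map \<phi>) \<and> \<phi> (1\<^sub>m d) = 1"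

definition pure_state :: "nat \<Rightarrow> (complex mat \<Rightarrow> complex) \<Rightarrow> bool" where
  "pure_state d \<phi> \<longleftrightarrow> state d \<phi> \<and> pure_cp d 1 (as_M1_map \<phi>)"

definition direct_sum_functionals :: "nat \<Rightarrow> (nat \<Rightarrow> complex mat \<Rightarrow> complex) \<Rightarrow> complex mat \<Rightarrow> complex mat" where
  "direct_sum_functionals d \<phi> X = mat_diag d (\<lambda>i. \<phi> i X)"

definition orthonormal_basis :: "nat \<Rightarrow> (nat \<Rightarrow> complex vec) \<Rightarrow> bool" where
  "orthonormal_basis d v \<longleftrightarrow>
     (\<forall>i<d. v i \<in> carrier_vec d) \<and>
     (\<forall>i<d. \<forall>j<d. cinner (v i) (v j) = (if i = j then 1 else 0)) \<and>
     vectorspace.basis class_ring (module_vec TYPE(complex) d) (v ` {..<d})"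

end

theory Submission
  imports Defs
begin

text \<open>
  The entanglement breaking maps are exactly the maps of the form of Holevo,
  \<open>\<Phi>(X) = \<Sum>\<^sub>j \<langle>x\<^sub>j, X x\<^sub>j\<rangle> |y\<^sub>j\<rangle>\<langle>y\<^sub>j|\<close> with unit vectors \<open>x\<^sub>j\<close>; such a map is unital
  if \<open>\<Sum>\<^sub>j |y\<^sub>j\<rangle>\<langle>y\<^sub>j| = I\<close>.  Each condition of the theorem is shown to be equivalent to \<open>\<Phi>\<close>
  being diagonal: some orthonormal basis \<open>v\<^sub>k\<close> consists of joint eigenvectors,
  \<open>\<Phi>(X) v\<^sub>k = \<langle>u\<^sub>k, X u\<^sub>k\<rangle> v\<^sub>k\<close>, with unit vectors \<open>u\<^sub>k\<close>.  For the orthonormal basis and the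
  direct sum this is a reformulation, once pure states are known to be vector states.

  Two facts produce diagonal maps.  By \<open>resolution_contains_basis\<close> the vectors \<open>y\<^sub>j\<close> contain a
  basis.  By \<open>holevo_diagonalized\<close> an arbitrary basis \<open>z\<^sub>k\<close>, not necessarily orthogonal, is
  enough for diagonality if all \<open>x\<^sub>j\<close> whose \<open>y\<^sub>j\<close> is not orthogonal to \<open>z\<^sub>k\<close> give one and the
  same vector state, that of \<open>u\<^sub>k\<close>: eigenvectors with different eigenvalue functionals are
  orthogonal, and orthonormalizing within the classes of equal functionals keeps the
  eigenvectors.

  Extreme points: given a selected basis \<open>y\<^bsub>b k\<^esub>\<close>, half of its terms can be split off from
  \<open>\<Phi>\<close>.  They have the form \<open>Ad\<^bsub>T\<^esub> \<circ> \<Psi>\<close> with a diagonal \<open>\<Psi>\<close> and an invertible \<open>T\<close>, and the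
  rest is \<open>Ad\<^bsub>V\<^esub> \<circ> \<Xi>\<close> with an invertible \<open>V\<close>; so an extreme \<open>\<Phi>\<close> is unitarily
  equivalent to \<open>\<Psi>\<close> (\<open>cstar_extreme_imp_diagonalized\<close>).  Conversely, if \<open>\<Phi>\<close> is diagonal and
  a C*-convex combination of maps \<open>\<Psi>\<^sub>i\<close>, then testing with \<open>|a\<rangle>\<langle>a|\<close> for \<open>a\<close> orthogonal to
  \<open>u\<^sub>k\<close> shows that \<open>\<Psi>\<^sub>i\<close> and the basis \<open>T\<^sub>i v\<^sub>k\<close> satisfy the criterion with the same vectors
  \<open>u\<^sub>k\<close> (\<open>diagonalized_imp_cstar_extreme\<close>).

  Ranks: a diagonal map is the sum of the \<open>Ad\<close> of the \<open>d\<^sub>2\<close> operators \<open>|u\<^sub>k\<rangle>\<langle>v\<^sub>k|\<close>, and by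
  \<open>Ad_sum_length_ge\<close> no decomposition is shorter than the number of independent operators in
  another one.  If \<open>d\<^sub>2\<close> rank-one operators suffice, then \<open>\<Sum>\<^sub>k |y\<^sub>k\<rangle>\<langle>y\<^sub>k| = I\<close> has \<open>d\<^sub>2\<close>
  terms and the \<open>y\<^sub>k\<close> are an orthonormal basis.  If only the Choi rank is known to be \<open>d\<^sub>2\<close>,
  the criterion is applied to the dual basis of a selected basis: a violation would give
  \<open>d\<^sub>2 + 1\<close> independent operators (\<open>Ad_sum_dimension_diagonalized\<close>).
\<close>

section \<open>Positive semidefinite matrices and their triangular factorization\<close>

definition quad_form :: "nat \<Rightarrow> (nat \<Rightarrow> nat \<Rightarrow> complex) \<Rightarrow> (nat \<Rightarrow> complex) \<Rightarrow> complex" where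
  "quad_form n A v = (\<Sum>i<n. \<Sum>j<n. cnj (v i) * A i j * v j)"

lemma quad_form_two_point:
  assumes "i < n" "j < n" "i \<noteq> j"
  shows "quad_form n A (\<lambda>k. if k = i then s else if k = j then t else 0) =
    cnj s * A i i * s + cnj s * A i j * t + cnj t * A j i * s + cnj t * A j j * t"
proof -
  let ?v = "\<lambda>k. if k = i then s else if k = j then t else 0"
  have inner: "(\<Sum>l<n. c l * ?v l) = c i * s + c j * t" for c :: "nat \<Rightarrow> complex"
  proof -
    have "(\<Sum>l<n. c l * ?v l) = (\<Sum>l\<in>{i, j}. c l * ?v l)"
      by (rule sum.mono_neutral_right) (use assms in auto)
    then show ?thesis using assms by simp
  qed
  have "quad_form n A ?v = (\<Sum>k<n. \<Sum>l<n. (cnj (?v k) * A k l) * ?v l)"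
    by (simp add: quad_form_def)
  also have "\<dots> = (\<Sum>k<n. cnj (?v k) * (A k i * s + A k j * t))"
    by (simp only: inner) (simp add: algebra_simps)
  also have "\<dots> = (\<Sum>k\<in>{i, j}. cnj (?v k) * (A k i * s + A k j * t))"
    by (rule sum.mono_neutral_right) (use assms in auto)
  also have "\<dots> = cnj s * A i i * s + cnj s * A i j * t + cnj t * A j i * s + cnj t * A j j * t"
    using assms by (simp add: algebra_simps)
  finally show ?thesis .
qed

lemma quad_form_one_point:
  assumes "i < n"
  shows "quad_form n A (\<lambda>k. if k = i then 1 else 0) = A i i"
proof -
  have "quad_form n A (\<lambda>k. if k = i then 1 else 0) = (\<Sum>k<n. if k = i then A k i else 0)"
    unfolding quad_form_def using assms
    by (intro sum.cong refl) (auto simp: if_distrib cong: if_cong)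
  then show ?thesis using assms by simp
qed

context
  fixes n :: nat and A :: "nat \<Rightarrow> nat \<Rightarrow> complex"
  assumes pos: "\<And>v. 0 \<le> quad_form n A v"
begin

lemma posform_diag: "i < n \<Longrightarrow> 0 \<le> A i i"
  using pos quad_form_one_point by metis

lemma posform_hermitian:
  assumes i: "i < n" and j: "j < n"
  shows "A j i = cnj (A i j)"
proof (cases "i = j")
  case True
  with posform_diag[OF i] show ?thesis
    by (auto simp: less_eq_complex_def complex_eq_iff)
next
  case False
  have d: "Im (A i i) = 0" "Im (A j j) = 0"
    using posform_diag i j by (auto simp: less_eq_complex_def)
  have "Im (A i j) + Im (A j i) = 0"
    using pos[of "\<lambda>k. if k = i then 1 else if k = j then 1 else 0"] d
    unfolding quad_form_two_point[OF i j False] by (simp add: less_eq_complex_def)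
  moreover have "Re (A i j) - Re (A j i) = 0"
    using pos[of "\<lambda>k. if k = i then 1 else if k = j then \<i> else 0"] d
    unfolding quad_form_two_point[OF i j False] by (simp add: less_eq_complex_def)
  ultimately show ?thesis by (simp add: complex_eq_iff)
qed

text \<open>Otherwise the form is negative at \<open>e\<^sub>i - r (cnj A\<^sub>i\<^sub>j) e\<^sub>j\<close> for large \<open>r\<close>.\<close>

lemma posform_diag_zero:
  assumes i: "i < n" and j: "j < n" and 0: "A j j = 0"
  shows "A i j = 0"
proof (cases "i = j")
  case False
  define a where "a = Re (A i i)"
  define m where "m = (cmod (A i j))\<^sup>2"
  have herm: "A j i = cnj (A i j)" by (rule posform_hermitian[OF i j])
  have mm: "A i j * cnj (A i j) = of_real m"
    unfolding m_def by (metis complex_norm_square)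
  have ge: "0 \<le> a - 2 * r * m" for r :: real
  proof -
    have "0 \<le> quad_form n A (\<lambda>k. if k = i then 1 else if k = j then - of_real r * cnj (A i
        j) else 0)"
      by (rule pos)
    also have "\<dots> = A i i - 2 * of_real r * (A i j * cnj (A i j))"
      unfolding quad_form_two_point[OF i j False] 0 herm by (simp add: algebra_simps)
    finally have "0 \<le> A i i - 2 * of_real r * of_real m" unfolding mm .
    then show ?thesis by (simp add: less_eq_complex_def a_def)
  qed
  have "m = 0"
  proof (rule ccontr)
    assume "m \<noteq> 0"
    then have "m > 0" by (simp add: m_def)
    \<comment> \<open>this \<open>r\<close> makes \<open>a - 2 r m\<close> equal to \<open>-1\<close>\<close>
    then show False using ge[of "(a + 1) / (2 * m)"] by (simp add: field_simps)
  qed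
  then show ?thesis by (simp add: m_def)
qed (use 0 in simp)

end

text \<open>Cholesky factorization: the last basis vector is split off and the Schur complement is
  treated by induction.  The Schur complement creates an entry \<open>(i, j)\<close> only from entries
  \<open>(i, n)\<close> and \<open>(n, j)\<close>, so a transitive relation that contains the support of the
  matrix contains the support of the factor; in particular the factor of a block diagonal
  matrix is block diagonal.\<close>

lemma posform_factor:
  assumes "\<And>v. 0 \<le> quad_form n A v"
    and trans: "\<And>i j k. R i j \<Longrightarrow> R j k \<Longrightarrow> R i k"
    and "\<And>i j. i < n \<Longrightarrow> j < n \<Longrightarrow> A i j \<noteq> 0 \<Longrightarrow> R i j"
  shows "\<exists>W. (\<forall>i<n. \<forall>j<n. A i j = (\<Sum>k<n. cnj (W k i) * W k j)) \<and>
    (\<forall>k<n. \<forall>i<n. W k i \<noteq> 0 \<longrightarrow> R k i)"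
  using assms(1,3)
proof (induction n arbitrary: A)
  case 0
  then show ?case by simp
next
  case (Suc n)
  note pos = Suc.prems(1)
  define a where "a = A n n"
  have a0: "0 \<le> a" unfolding a_def by (rule posform_diag[OF pos]) simp
  then have acnj: "cnj a = a" by (auto simp: less_eq_complex_def complex_eq_iff)
  have herm: "A n i = cnj (A i n)" if "i < Suc n" for i
    by (rule posform_hermitian[OF pos]) (use that in auto)
  \<comment> \<open>if \<open>a = 0\<close> then the last row and column vanish, and dividing by \<open>a\<close> yields \<open>0\<close>\<close>
  define B where "B i j = A i j - A i n * A n j / a" for i j
  define s where "s = (of_real (sqrt (Re a)) :: complex)"
  have ss: "s * s = a" "cnj s = s"
    using a0 by (auto simp: s_def less_eq_complex_def complex_eq_iff)
  have zero: "A i n = 0" if "a = 0" "i < Suc n" for i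
    by (rule posform_diag_zero[OF pos]) (use that in \<open>auto simp: a_def\<close>)
  have "0 \<le> quad_form n B v" for v
  proof -
    define S where "S = (\<Sum>j<n. A n j * v j)"
    have S': "(\<Sum>i<n. cnj (v i) * A i n) = cnj S"
      unfolding S_def by (simp add: herm mult.commute)
    \<comment> \<open>the last coordinate minimizes the form of \<open>A\<close> over all extensions of \<open>v\<close>\<close>
    define w where "w = (\<lambda>k. if k = n then - S / a else v k)"
    have "quad_form (Suc n) A w = (\<Sum>i<n. \<Sum>j<n. cnj (v i) * A i j * v j) +
        (\<Sum>i<n. cnj (v i) * A i n) * w n + cnj (w n) * S + cnj (w n) * a * w n"
    proof -
      have wi: "w i = v i" if "i < n" for i using that by (simp add: w_def)
      show ?thesis
        unfolding quad_form_def S_def a_def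
        by (simp add: wi sum.distrib sum_distrib_left sum_distrib_right mult.assoc add.assoc)
    qed
    also have "\<dots> = quad_form n A v - cnj S * S / a"
      unfolding S' quad_form_def using acnj by (cases "a = 0") (simp_all add: w_def field_simps)
    also have "\<dots> = quad_form n B v"
    proof -
      have "quad_form n B v = quad_form n A v - (\<Sum>i<n. \<Sum>j<n. (cnj (v i) * A i n) * (A n j *
          v j) / a)"
        unfolding quad_form_def B_def sum_subtractf[symmetric]
        by (intro sum.cong refl) (simp add: algebra_simps)
      also have "(\<Sum>i<n. \<Sum>j<n. (cnj (v i) * A i n) * (A n j * v j) / a) = cnj S * S / a"
        unfolding S'[symmetric] by (simp add: S_def sum_product sum_divide_distrib)
      finally show ?thesis by simp
    qed
    finally show ?thesis using pos[of w] by simp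
  qed
  moreover have "R i j" if "i < n" "j < n" "B i j \<noteq> 0" for i j
  proof (cases "A i j = 0")
    case True
    then have "A i n \<noteq> 0" "A n j \<noteq> 0" using that(3) by (auto simp: B_def)
    then show ?thesis using that Suc.prems(2) trans by (meson lessI less_SucI)
  qed (use that Suc.prems(2) in auto)
  ultimately obtain W where
    W: "\<And>i j. i < n \<Longrightarrow> j < n \<Longrightarrow> B i j = (\<Sum>k<n. cnj (W k i) * W k j)"
    and WR: "\<And>k i. k < n \<Longrightarrow> i < n \<Longrightarrow> W k i \<noteq> 0 \<Longrightarrow> R k i"
    using Suc.IH[of B] by blast
  define W' where
    "W' k i = (if k = n then A n i / s else if i = n then 0 else W k i)" for k i
  have last: "cnj (W' n i) * W' n j = A i n * A n j / a" if "i < Suc n" for i j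
    using that ss herm[OF that] by (simp add: W'_def)
  have "A i j = (\<Sum>k<Suc n. cnj (W' k i) * W' k j)" if "i < Suc n" "j < Suc n" for i j
  proof -
    have "(\<Sum>k<Suc n. cnj (W' k i) * W' k j) =
        (\<Sum>k<n. cnj (W' k i) * W' k j) + A i n * A n j / a"
      using last[OF that(1)] by simp
    also have "\<dots> = A i j"
    proof (cases "i < n \<and> j < n")
      case True
      then have "(\<Sum>k<n. cnj (W' k i) * W' k j) = B i j"
        by (simp add: W W'_def)
      then show ?thesis by (simp add: B_def)
    next
      case False
      then have ij: "i = n \<or> j = n" using that by auto
      then have "(\<Sum>k<n. cnj (W' k i) * W' k j) = 0"
        by (intro sum.neutral) (auto simp: W'_def)
      moreover have "A i n * A n j / a = A i j"
      proof (cases "a = 0")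
        case True
        then show ?thesis using ij zero that herm by auto
      qed (use ij a_def in auto)
      ultimately show ?thesis by simp
    qed
    finally show ?thesis by simp
  qed
  moreover have "R k i" if "k < Suc n" "i < Suc n" "W' k i \<noteq> 0" for k i
    using that Suc.prems(2)[of n i] WR[of k i]
    by (auto simp: W'_def less_Suc_eq split: if_splits)
  ultimately show ?case by blast
qed

section \<open>Vectors, adjoints and Holevo forms\<close>

abbreviation vec_state :: "complex vec \<Rightarrow> complex mat \<Rightarrow> complex" where
  "vec_state x X \<equiv> cinner x (X *\<^sub>v x)"

lemma cinner_eq_sum:
  "x \<in> carrier_vec d \<Longrightarrow> y \<in> carrier_vec d \<Longrightarrow> cinner x y = (\<Sum>i<d. cnj (x $ i) * y $ i)"
  by (simp add: cinner_def scalar_prod_def lessThan_atLeast0 mult.commute)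

lemma cinner_commute:
  "x \<in> carrier_vec d \<Longrightarrow> y \<in> carrier_vec d \<Longrightarrow> cinner y x = cnj (cinner x y)"
  by (simp add: cinner_eq_sum mult.commute)

lemma cinner_smult [simp]:
  "x \<in> carrier_vec d \<Longrightarrow> y \<in> carrier_vec d \<Longrightarrow> cinner x (c \<cdot>\<^sub>v y) = c * cinner x y"
  "x \<in> carrier_vec d \<Longrightarrow> y \<in> carrier_vec d \<Longrightarrow> cinner (c \<cdot>\<^sub>v x) y = cnj c * cinner x y"
  by (simp_all add: cinner_eq_sum sum_distrib_left mult_ac)

lemma cinner_minus_right:
  "x \<in> carrier_vec d \<Longrightarrow> y \<in> carrier_vec d \<Longrightarrow> z \<in> carrier_vec d \<Longrightarrow>
    cinner x (y - z) = cinner x y - cinner x z"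
  by (simp add: cinner_eq_sum sum_subtractf algebra_simps)

lemma cinner_minus_left:
  "x \<in> carrier_vec d \<Longrightarrow> y \<in> carrier_vec d \<Longrightarrow> z \<in> carrier_vec d \<Longrightarrow>
    cinner (y - z) x = cinner y x - cinner z x"
  by (subst (1 2 3) cinner_eq_sum[where d = d]) (auto simp: sum_subtractf left_diff_distrib)

lemma cinner_self_ge_0: "x \<in> carrier_vec d \<Longrightarrow> 0 \<le> cinner x x"
  by (simp add: cinner_eq_sum sum_nonneg less_eq_complex_def)

lemma cinner_self_eq_0_iff:
  assumes "x \<in> carrier_vec d"
  shows "cinner x x = 0 \<longleftrightarrow> x = 0\<^sub>v d"
  using assms by (auto simp: cinner_def conjugate_square_eq_0_vec[OF assms])

lemma vec_state_eq_sum: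
  "x \<in> carrier_vec d \<Longrightarrow> X \<in> carrier_mat d d \<Longrightarrow>
    vec_state x X = (\<Sum>i<d. \<Sum>j<d. cnj (x $ i) * X $$ (i, j) * x $ j)"
  by (simp add: cinner_eq_sum[where d = d] scalar_prod_def lessThan_atLeast0
      sum_distrib_left mult.assoc)

lemma vec_state_smult:
  "x \<in> carrier_vec d \<Longrightarrow> X \<in> carrier_mat d d \<Longrightarrow>
    vec_state (c \<cdot>\<^sub>v x) X = c * cnj c * vec_state x X"
  by (simp add: mult_mat_vec[where nr = d and nc = d] mult_ac cinner_smult[where d = d])

lemma vec_state_one [simp]: "x \<in> carrier_vec d \<Longrightarrow> vec_state x (1\<^sub>m d) = cinner x x"
  by simp

lemma ketbra_carrier [simp]:
  "x \<in> carrier_vec m \<Longrightarrow> y \<in> carrier_vec n \<Longrightarrow> ketbra x y \<in> carrier_mat m n"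
  by (simp add: ketbra_def)

lemma ketbra_index [simp]:
  "i < dim_vec x \<Longrightarrow> j < dim_vec y \<Longrightarrow> ketbra x y $$ (i, j) = x $ i * cnj (y $ j)"
  by (simp add: ketbra_def)

lemma ketbra_mult_vec:
  assumes "y \<in> carrier_vec d" "z \<in> carrier_vec d"
  shows "ketbra x y *\<^sub>v z = cinner y z \<cdot>\<^sub>v x"
  using assms
  by (intro eq_vecI)
    (auto simp: ketbra_def cinner_eq_sum[where d = d] scalar_prod_def lessThan_atLeast0
      sum_distrib_left mult_ac)

lemma vec_state_ketbra:
  assumes "x \<in> carrier_vec d" "a \<in> carrier_vec d"
  shows "vec_state x (ketbra a a) = cinner x a * cnj (cinner x a)"
  using assms by (simp add: ketbra_mult_vec[where d = d] cinner_commute[of x d a]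
      mult.commute cinner_smult[where d = d])

lemma psd_ketbra: "a \<in> carrier_vec d \<Longrightarrow> psd d (ketbra a a)"
  by (auto simp: psd_def vec_state_ketbra[where d = d] less_eq_complex_def)

lemma psd_vec_state: "psd d X \<Longrightarrow> x \<in> carrier_vec d \<Longrightarrow> 0 \<le> vec_state x X"
  by (simp add: psd_def)

text \<open>Testing a vector state against the projection onto the part of \<open>x\<close> orthogonal
  to a unit vector \<open>u\<close> detects whether \<open>x\<close> is a multiple of \<open>u\<close>.\<close>

lemma orthogonal_part:
  assumes u: "u \<in> carrier_vec d" "cinner u u = 1" and x: "x \<in> carrier_vec d"
  defines "a \<equiv> x - cinner u x \<cdot>\<^sub>v u"
  shows "a \<in> carrier_vec d" "cinner u a = 0" "cinner x a = cinner a a"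
    and "cinner x a = 0 \<Longrightarrow> x = cinner u x \<cdot>\<^sub>v u"
proof -
  show ac: "a \<in> carrier_vec d" using u x by (simp add: a_def)
  show ua: "cinner u a = 0"
    using u x by (simp add: a_def cinner_minus_right[where d = d] cinner_smult[where d = d])
  show xa: "cinner x a = cinner a a"
  proof -
    have "cinner a a = cinner x a - cnj (cinner u x) * cinner u a"
      by (subst a_def, subst cinner_minus_left[where d = d]) (use u x ac in simp_all)
    then show ?thesis by (simp add: ua)
  qed
  show "x = cinner u x \<cdot>\<^sub>v u" if "cinner x a = 0"
  proof -
    have "a = 0\<^sub>v d" using that xa ac by (simp add: cinner_self_eq_0_iff)
    then have "a $ i = 0" if "i < d" for i using that by simp
    then show ?thesis using u x unfolding a_def by (intro eq_vecI) auto
  qed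
qed

lemma mat_adjoint_dim [simp]:
  "dim_row (mat_adjoint A) = dim_col A" "dim_col (mat_adjoint A) = dim_row A"
  by (simp_all add: mat_adjoint_def)

lemma mat_adjoint_carrier [simp]: "A \<in> carrier_mat m n \<Longrightarrow> mat_adjoint A \<in> carrier_mat n m"
  by (rule carrier_matI) auto

lemma mat_adjoint_index [simp]:
  "i < dim_col A \<Longrightarrow> j < dim_row A \<Longrightarrow> mat_adjoint A $$ (i, j) = cnj (A $$ (j, i))"
  by (simp add: mat_adjoint_def mat_of_rows_index)

lemma mat_adjoint_adjoint [simp]: "mat_adjoint (mat_adjoint A) = (A :: complex mat)"
  by (rule eq_matI) simp_all

lemma mat_adjoint_one [simp]: "mat_adjoint (1\<^sub>m n) = (1\<^sub>m n :: complex mat)"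
  by (rule eq_matI) auto

lemma mat_adjoint_mult:
  "A \<in> carrier_mat m n \<Longrightarrow> B \<in> carrier_mat n l \<Longrightarrow>
    mat_adjoint (A * B) = mat_adjoint B * mat_adjoint (A :: complex mat)"
  by (rule eq_matI) (auto simp: scalar_prod_def mult.commute)

lemma cinner_mat_adjoint:
  assumes "A \<in> carrier_mat m n" "x \<in> carrier_vec n" "y \<in> carrier_vec m"
  shows "cinner x (mat_adjoint A *\<^sub>v y) = cinner (A *\<^sub>v x) y"
proof -
  have "mat_adjoint A *\<^sub>v y \<in> carrier_vec n" "A *\<^sub>v x \<in> carrier_vec m"
    using assms mat_adjoint_carrier mult_mat_vec_carrier by blast+
  note c = this assms
  have "cinner x (mat_adjoint A *\<^sub>v y) = (\<Sum>i<n. \<Sum>j<m. cnj (x $ i) * cnj (A $$ (j, i)) * y $ j)"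
    using c by (simp add: cinner_eq_sum[where d = n] scalar_prod_def lessThan_atLeast0
        sum_distrib_left mult.assoc)
  also have "\<dots> = (\<Sum>j<m. \<Sum>i<n. cnj (x $ i) * cnj (A $$ (j, i)) * y $ j)"
    by (rule sum.swap)
  also have "\<dots> = cinner (A *\<^sub>v x) y"
    using c by (simp add: cinner_eq_sum[where d = m] scalar_prod_def lessThan_atLeast0
        sum_distrib_left sum_distrib_right mult_ac)
  finally show ?thesis .
qed

lemma det_nonzero_inverse:
  assumes "A \<in> carrier_mat n n" "det A \<noteq> (0 :: complex)"
  obtains B where "B \<in> carrier_mat n n" "A * B = 1\<^sub>m n" "B * A = 1\<^sub>m n"
  using det_non_zero_imp_unit[OF assms, of "()"] by (auto simp: Units_def ring_mat_simps)

lemma invertible_mat_iff_det: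
  assumes A: "A \<in> carrier_mat n n"
  shows "invertible_mat A \<longleftrightarrow> det A \<noteq> (0 :: complex)"
proof
  assume "invertible_mat A"
  then obtain B where B: "A * B = 1\<^sub>m n" "B * A = 1\<^sub>m (dim_row B)"
    using A by (auto simp: invertible_mat_def inverts_mat_def)
  then have "B \<in> carrier_mat n n"
    using A by (metis carrier_mat_triv carrier_matD index_mult_mat(2,3) index_one_mat(2,3))
  then show "det A \<noteq> 0" using det_mult[OF A] B(1) by fastforce
next
  assume "det A \<noteq> 0"
  then obtain B where "B \<in> carrier_mat n n" "A * B = 1\<^sub>m n" "B * A = 1\<^sub>m n"
    using A det_nonzero_inverse by blast
  then show "invertible_mat A" using A by (auto simp: invertible_mat_def inverts_mat_def)
qed

lemma det_mat_adjoint_nonzero: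
  assumes A: "A \<in> carrier_mat n n" and "det A \<noteq> (0 :: complex)"
  shows "det (mat_adjoint A) \<noteq> 0"
proof -
  obtain B where B: "B \<in> carrier_mat n n" "B * A = 1\<^sub>m n"
    using det_nonzero_inverse assms by metis
  then have "mat_adjoint A * mat_adjoint B = 1\<^sub>m n"
    using mat_adjoint_mult[OF B(1) A] by simp
  then show ?thesis
    using det_mult[of "mat_adjoint A" n "mat_adjoint B"] A B(1) by fastforce
qed

lemma unitary_matI:
  "U \<in> carrier_mat n n \<Longrightarrow> mat_adjoint U * U = 1\<^sub>m n \<Longrightarrow> unitary_mat n U"
  unfolding unitary_mat_def using mat_mult_left_right_inverse mat_adjoint_carrier by blast

lemma psd_quad_form:
  assumes "psd n A"
  shows "0 \<le> quad_form n (\<lambda>i j. A $$ (i, j)) v"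
  using assms psd_vec_state[OF assms, of "vec n v"]
  by (simp add: psd_def vec_state_eq_sum[of _ n] quad_form_def)

lemma psd_factor:
  assumes A: "psd n A"
    and "\<And>i j k. R i j \<Longrightarrow> R j k \<Longrightarrow> R i k"
    and "\<And>i j. i < n \<Longrightarrow> j < n \<Longrightarrow> A $$ (i, j) \<noteq> 0 \<Longrightarrow> R i j"
  obtains W where "W \<in> carrier_mat n n" "A = mat_adjoint W * W"
    "\<And>k i. k < n \<Longrightarrow> i < n \<Longrightarrow> W $$ (k, i) \<noteq> 0 \<Longrightarrow> R k i"
proof -
  obtain W where W: "\<forall>i<n. \<forall>j<n. A $$ (i, j) = (\<Sum>k<n. cnj (W k i) * W k j)"
    "\<forall>k<n. \<forall>i<n. W k i \<noteq> 0 \<longrightarrow> R k i"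
    using posform_factor[of n "\<lambda>i j. A $$ (i, j)" R] psd_quad_form[OF A] assms(2,3) by blast
  show ?thesis
  proof (rule that[of "mat n n (\<lambda>(k, i). W k i)"])
    show "A = mat_adjoint (mat n n (\<lambda>(k, i). W k i)) * mat n n (\<lambda>(k, i). W k i)"
      using A W(1) by (intro eq_matI) (auto simp: psd_def scalar_prod_def lessThan_atLeast0)
  qed (use W(2) in auto)
qed

lemma mat_sum_carrier [simp]: "mat_sum nr nc A J \<in> carrier_mat nr nc"
  by (simp add: mat_sum_def)

lemma mat_sum_dim [simp]: "dim_row (mat_sum nr nc A J) = nr" "dim_col (mat_sum nr nc A J) = nc"
  by (simp_all add: mat_sum_def)

lemma mat_sum_index [simp]:
  "i < nr \<Longrightarrow> j < nc \<Longrightarrow> mat_sum nr nc A J $$ (i, j) = (\<Sum>k\<in>J. A k $$ (i, j))"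
  by (simp add: mat_sum_def)

lemma mat_sum_cong:
  "J = K \<Longrightarrow> (\<And>k. k \<in> K \<Longrightarrow> A k = B k) \<Longrightarrow> mat_sum m n A J = mat_sum m n B K"
  by (simp add: mat_sum_def cong: sum.cong)

lemma cinner_mat_sum:
  assumes "x \<in> carrier_vec m" "y \<in> carrier_vec n" "\<And>j. j \<in> J \<Longrightarrow> A j \<in> carrier_mat m n"
  shows "cinner x (mat_sum m n A J *\<^sub>v y) = (\<Sum>j\<in>J. cinner x (A j *\<^sub>v y))"
proof -
  have *: "cinner x (B *\<^sub>v y) = (\<Sum>r<m. \<Sum>c<n. cnj (x $ r) * B $$ (r, c) * y $ c)"
    if "B \<in> carrier_mat m n" for B
    using assms(1,2) that by (simp add: cinner_eq_sum[where d = m] scalar_prod_def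
        lessThan_atLeast0 sum_distrib_left mult.assoc)
  have "cinner x (mat_sum m n A J *\<^sub>v y) =
      (\<Sum>r<m. \<Sum>c<n. \<Sum>j\<in>J. cnj (x $ r) * A j $$ (r, c) * y $ c)"
    by (simp add: * sum_distrib_left sum_distrib_right)
  also have "\<dots> = (\<Sum>r<m. \<Sum>j\<in>J. \<Sum>c<n. cnj (x $ r) * A j $$ (r, c) * y $ c)"
    by (rule sum.cong[OF refl]) (rule sum.swap)
  also have "\<dots> = (\<Sum>j\<in>J. \<Sum>r<m. \<Sum>c<n. cnj (x $ r) * A j $$ (r, c) * y $ c)"
    by (rule sum.swap)
  also have "\<dots> = (\<Sum>j\<in>J. cinner x (A j *\<^sub>v y))"
    using * assms(3) by simp
  finally show ?thesis .
qed

lemma mat_eqI_cinner: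
  assumes A: "A \<in> carrier_mat n n" and B: "B \<in> carrier_mat n n"
    and eq: "\<And>x y. x \<in> carrier_vec n \<Longrightarrow> y \<in> carrier_vec n \<Longrightarrow>
      cinner x (A *\<^sub>v y) = cinner x (B *\<^sub>v y)"
  shows "A = B"
proof (rule eq_matI)
  fix i j assume ij: "i < dim_row B" "j < dim_col B"
  have *: "cinner (unit_vec n i) (C *\<^sub>v unit_vec n j) = C $$ (i, j)" if "C \<in> carrier_mat n n" for C
  proof -
    have "cinner (unit_vec n i) (C *\<^sub>v unit_vec n j) =
        (\<Sum>k<n. cnj (unit_vec n i $ k) * (C *\<^sub>v unit_vec n j) $ k)"
      by (rule cinner_eq_sum) (use that in auto)
    also have "\<dots> = (\<Sum>k<n. if k = i then C $$ (k, j) else 0)"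
      by (rule sum.cong) (use that ij B in auto)
    finally show ?thesis using ij B by simp
  qed
  show "A $$ (i, j) = B $$ (i, j)"
    using eq[of "unit_vec n i" "unit_vec n j"] *[OF A] *[OF B] by simp
qed (use A B in auto)

text \<open>The form \<open>X \<mapsto> \<Sum>\<^sub>j \<langle>x\<^sub>j, X x\<^sub>j\<rangle> |y\<^sub>j\<rangle>\<langle>y\<^sub>j|\<close> of Holevo: measure with respect
  to the \<open>y\<^sub>j\<close> and prepare the \<open>x\<^sub>j\<close>, in the Heisenberg picture.\<close>

definition holevo :: "nat \<Rightarrow> 'j set \<Rightarrow> ('j \<Rightarrow> complex vec) \<Rightarrow> ('j \<Rightarrow> complex vec) \<Rightarrow>
    complex mat \<Rightarrow> complex mat" where
  "holevo d J x y X = mat_sum d d (\<lambda>j. vec_state (x j) X \<cdot>\<^sub>m ketbra (y j) (y j)) J"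

lemma holevo_carrier [simp]: "holevo d J x y X \<in> carrier_mat d d"
  by (simp add: holevo_def)

lemma holevo_dim [simp]: "dim_row (holevo d J x y X) = d" "dim_col (holevo d J x y X) = d"
  by (simp_all add: holevo_def)

lemma holevo_index:
  assumes "\<And>j. j \<in> J \<Longrightarrow> y j \<in> carrier_vec d" "r < d" "c < d"
  shows "holevo d J x y X $$ (r, c) = (\<Sum>j\<in>J. vec_state (x j) X * (y j $ r * cnj (y j $ c)))"
proof -
  have "dim_vec (y j) = d" if "j \<in> J" for j using assms(1)[OF that] by simp
  then show ?thesis
    using assms(2,3) by (auto simp: holevo_def ketbra_def intro!: sum.cong)
qed

lemma cinner_holevo:
  assumes "\<And>j. j \<in> J \<Longrightarrow> y j \<in> carrier_vec d" "a \<in> carrier_vec d" "b \<in> carrier_vec d"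
  shows "cinner a (holevo d J x y X *\<^sub>v b) =
    (\<Sum>j\<in>J. vec_state (x j) X * (cinner a (y j) * cinner (y j) b))"
proof -
  have "cinner a ((c \<cdot>\<^sub>m ketbra z z) *\<^sub>v b) = c * (cinner a z * cinner z b)"
    if "z \<in> carrier_vec d" for c z
  proof -
    have "(c \<cdot>\<^sub>m ketbra z z) *\<^sub>v b = (c * cinner z b) \<cdot>\<^sub>v z"
      using that assms(3)
      by (intro eq_vecI) (auto simp: ketbra_def cinner_eq_sum[where d = d] scalar_prod_def
          lessThan_atLeast0 sum_distrib_left sum_distrib_right mult_ac)
    then show ?thesis using that assms(2) by (simp add: cinner_smult[where d = d] mult_ac)
  qed
  then show ?thesis
    unfolding holevo_def
    by (subst cinner_mat_sum[where m = d and n = d]) (use assms in auto)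
qed

lemma holevo_one:
  assumes "\<And>j. j \<in> J \<Longrightarrow> x j \<in> carrier_vec d1 \<and> cinner (x j) (x j) = 1"
  shows "holevo d J x y (1\<^sub>m d1) = mat_sum d d (\<lambda>j. ketbra (y j) (y j)) J"
  unfolding holevo_def by (rule mat_sum_cong) (use assms in auto)

section \<open>Simultaneous diagonalization\<close>

text \<open>The columns of \<open>W\<close> are joint eigenvectors of all \<open>\<Phi>(X)\<close>, and the eigenvalue
  functionals are vector states.  This is the normal form to which every characterization of
  the extreme points is reduced.\<close>

definition diagonalized_by :: "nat \<Rightarrow> nat \<Rightarrow> (complex mat \<Rightarrow> complex mat) \<Rightarrow>
    (nat \<Rightarrow> complex vec) \<Rightarrow> complex mat \<Rightarrow> bool" where
  "diagonalized_by d1 d2 \<Phi> u W \<longleftrightarrow> unitary_mat d2 W \<and>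
    (\<forall>k<d2. u k \<in> carrier_vec d1 \<and> cinner (u k) (u k) = 1) \<and>
    (\<forall>X\<in>carrier_mat d1 d1. \<Phi> X * W = W * mat_diag d2 (\<lambda>k. vec_state (u k) X))"

lemma cinner_unit_vec:
  assumes "x \<in> carrier_vec n" "i < n"
  shows "cinner (unit_vec n i) x = x $ i"
proof -
  have "cinner (unit_vec n i) x = (\<Sum>k<n. if k = i then x $ k else 0)"
    by (subst cinner_eq_sum[where d = n], (use assms in simp_all)[2], rule sum.cong)
      (use assms in auto)
  then show ?thesis using assms by simp
qed

lemma vec_eqI_cinner:
  assumes "x \<in> carrier_vec n" "y \<in> carrier_vec n"
    and "\<And>a. a \<in> carrier_vec n \<Longrightarrow> cinner a x = cinner a y"
  shows "x = y"
proof (rule eq_vecI)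
  fix i assume "i < dim_vec y"
  then show "x $ i = y $ i"
    using assms(3)[of "unit_vec n i"] cinner_unit_vec[OF assms(1)] cinner_unit_vec[OF assms(2)]
      assms(2) by simp
qed (use assms in auto)

lemma mat_adjoint_mult_self_index:
  assumes "Z \<in> carrier_mat m n" "k < n" "l < n"
  shows "(mat_adjoint Z * Z) $$ (k, l) = cinner (col Z k) (col Z l)"
  using assms by (simp add: scalar_prod_def cinner_eq_sum[where d = m] lessThan_atLeast0)

lemma psd_mat_adjoint_mult_self:
  assumes Z: "Z \<in> carrier_mat m n"
  shows "psd n (mat_adjoint Z * Z)"
  unfolding psd_def
proof (intro conjI ballI)
  fix v :: "complex vec" assume v: "v \<in> carrier_vec n"
  have "cinner v ((mat_adjoint Z * Z) *\<^sub>v v) = cinner (Z *\<^sub>v v) (Z *\<^sub>v v)"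
    using cinner_mat_adjoint[OF Z v, of "Z *\<^sub>v v"]
      assoc_mult_mat_vec[OF mat_adjoint_carrier[OF Z] Z v] Z v by simp
  then show "0 \<le> cinner v ((mat_adjoint Z * Z) *\<^sub>v v)"
    using cinner_self_ge_0[of "Z *\<^sub>v v" m] Z v by simp
qed (use Z mat_adjoint_carrier mult_carrier_mat in blast)

lemma cinner_resolution:
  assumes "\<And>j. j \<in> J \<Longrightarrow> y j \<in> carrier_vec d"
    and "mat_sum d d (\<lambda>j. ketbra (y j) (y j)) J = 1\<^sub>m d"
    and "a \<in> carrier_vec d" "b \<in> carrier_vec d"
  shows "(\<Sum>j\<in>J. cinner a (y j) * cinner (y j) b) = cinner a b"
proof -
  have "(\<Sum>j\<in>J. cinner a (y j) * cinner (y j) b) =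
      (\<Sum>j\<in>J. cinner a (ketbra (y j) (y j) *\<^sub>v b))"
    using assms by (intro sum.cong refl)
      (simp add: ketbra_mult_vec[where d = d] cinner_smult[where d = d] mult.commute)
  also have "\<dots> = cinner a (mat_sum d d (\<lambda>j. ketbra (y j) (y j)) J *\<^sub>v b)"
    by (rule cinner_mat_sum[symmetric]) (use assms in auto)
  also have "\<dots> = cinner a b" using assms by simp
  finally show ?thesis .
qed

text \<open>Only terms with the vector state of \<open>u\<^sub>k\<close> contribute to \<open>\<Phi>(X) z\<^sub>k\<close>, so the columns
  \<open>z\<^sub>k\<close> of \<open>Z\<close> are joint eigenvectors, \<open>\<Phi>(X) z\<^sub>k = \<langle>u\<^sub>k, X u\<^sub>k\<rangle> z\<^sub>k\<close>, and those with
      different vector states are orthogonal.  Hence the Gram matrix \<open>Z\<^sup>* Z\<close>, and by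
  the support statement in the Cholesky factorization also its factor \<open>T\<close>, commutes with the
  diagonal matrices that occur, and \<open>Z T\<^sup>-\<^sup>1\<close> is a unitary with the same eigenvector
  property.\<close>

lemma holevo_diagonalized:
  assumes y: "\<And>j. j \<in> J \<Longrightarrow> y j \<in> carrier_vec d2"
    and res: "mat_sum d2 d2 (\<lambda>j. ketbra (y j) (y j)) J = 1\<^sub>m d2"
    and \<Phi>: "\<And>X. X \<in> carrier_mat d1 d1 \<Longrightarrow> \<Phi> X = holevo d2 J x y X"
    and u: "\<And>k. k < d2 \<Longrightarrow> u k \<in> carrier_vec d1 \<and> cinner (u k) (u k) = 1"
    and Z: "Z \<in> carrier_mat d2 d2" "det Z \<noteq> 0"
    and eq: "\<And>j k X. j \<in> J \<Longrightarrow> k < d2 \<Longrightarrow> cinner (y j) (col Z k) \<noteq> 0 \<Longrightarrow>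
      X \<in> carrier_mat d1 d1 \<Longrightarrow> vec_state (x j) X = vec_state (u k) X"
  shows "\<exists>W. diagonalized_by d1 d2 \<Phi> u W"
proof -
  define D where "D X = mat_diag d2 (\<lambda>k. vec_state (u k) X)" for X
  have D: "D X \<in> carrier_mat d2 d2" for X by (simp add: D_def)
  have zc: "col Z k \<in> carrier_vec d2" if "k < d2" for k using Z that by auto
  have form: "cinner a (\<Phi> X *\<^sub>v col Z l) = vec_state (u l) X * cinner a (col Z l)"
    if "X \<in> carrier_mat d1 d1" "l < d2" "a \<in> carrier_vec d2" for X l a
  proof -
    have "cinner a (\<Phi> X *\<^sub>v col Z l) =
        (\<Sum>j\<in>J. vec_state (x j) X * (cinner a (y j) * cinner (y j) (col Z l)))"
      unfolding \<Phi>[OF that(1)] by (rule cinner_holevo) (use y that zc in auto)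
    also have "\<dots> = (\<Sum>j\<in>J. vec_state (u l) X * (cinner a (y j) * cinner (y j) (col Z l)))"
      by (rule sum.cong[OF refl]) (use eq[OF _ that(2) _ that(1)] in force)
    also have "\<dots> = vec_state (u l) X * cinner a (col Z l)"
      unfolding sum_distrib_left[symmetric]
      using cinner_resolution[OF y res that(3) zc[OF that(2)]] by simp
    finally show ?thesis .
  qed
  have eigen: "\<Phi> X * Z = Z * D X" if X: "X \<in> carrier_mat d1 d1" for X
  proof (rule eq_matI)
    fix r l assume "r < dim_row (Z * D X)" "l < dim_col (Z * D X)"
    then have rl: "r < d2" "l < d2" using Z by (auto simp: D_def mat_diag_def)
    have pc: "\<Phi> X \<in> carrier_mat d2 d2" using \<Phi>[OF X] by simp
    have "\<Phi> X *\<^sub>v col Z l = vec_state (u l) X \<cdot>\<^sub>v col Z l"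
      by (rule vec_eqI_cinner[of _ d2]) (use form[OF X rl(2)] pc zc[OF rl(2)] in auto)
    then have "(\<Phi> X *\<^sub>v col Z l) $ r = vec_state (u l) X * Z $$ (r, l)"
      using Z rl by simp
    then show "(\<Phi> X * Z) $$ (r, l) = (Z * D X) $$ (r, l)"
      using rl pc Z by (simp add: D_def mat_diag_mult_right[OF Z(1)])
  qed (use \<Phi>[OF X] Z in \<open>auto simp: D_def mat_diag_def holevo_def\<close>)
  define G where "G = mat_adjoint Z * Z"
  define R where "R k l \<longleftrightarrow> (\<forall>X\<in>carrier_mat d1 d1. vec_state (u k) X = vec_state (u l) X)"
    for k l
  have psd: "psd d2 G" unfolding G_def by (rule psd_mat_adjoint_mult_self[OF Z(1)])
  have GR: "R k l" if kl: "k < d2" "l < d2" and nz: "G $$ (k, l) \<noteq> 0" for k l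
    unfolding R_def
  proof
    fix X :: "complex mat" assume X: "X \<in> carrier_mat d1 d1"
    have g: "cinner (col Z k) (col Z l) \<noteq> 0"
      using nz mat_adjoint_mult_self_index[OF Z(1) kl] by (simp add: G_def)
    have "vec_state (u l) X * cinner (col Z k) (col Z l) = cinner (col Z k) (\<Phi> X *\<^sub>v col Z l)"
      using form[OF X kl(2) zc[OF kl(1)]] by simp
    also have "\<dots> = (\<Sum>j\<in>J. vec_state (x j) X * (cinner (col Z k) (y j) * cinner (y j) (col Z l)))"
      unfolding \<Phi>[OF X] by (rule cinner_holevo) (use y kl zc in auto)
    also have "\<dots> = (\<Sum>j\<in>J. vec_state (u k) X * (cinner (col Z k) (y j) * cinner (y j) (col Z l)))"
    proof (rule sum.cong[OF refl])
      fix j assume j: "j \<in> J"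
      show "vec_state (x j) X * (cinner (col Z k) (y j) * cinner (y j) (col Z l)) =
          vec_state (u k) X * (cinner (col Z k) (y j) * cinner (y j) (col Z l))"
        using eq[OF j kl(1) _ X] cinner_commute[OF y[OF j] zc[OF kl(1)]] by force
    qed
    also have "\<dots> = vec_state (u k) X * cinner (col Z k) (col Z l)"
      unfolding sum_distrib_left[symmetric]
      using cinner_resolution[OF y res zc[OF kl(1)] zc[OF kl(2)]] by simp
    finally show "vec_state (u k) X = vec_state (u l) X" using g by simp
  qed
  obtain T where T: "T \<in> carrier_mat d2 d2" "G = mat_adjoint T * T"
    and TR: "\<And>k l. k < d2 \<Longrightarrow> l < d2 \<Longrightarrow> T $$ (k, l) \<noteq> 0 \<Longrightarrow> R k l"
    by (rule psd_factor[OF psd, of R]) (use GR in \<open>auto simp: R_def\<close>)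
  have "det G \<noteq> 0"
    unfolding G_def using det_mult[OF mat_adjoint_carrier[OF Z(1)] Z(1)]
      det_mat_adjoint_nonzero[OF Z] Z(2) by simp
  then have "det T \<noteq> 0"
    unfolding T(2) using det_mult[OF mat_adjoint_carrier[OF T(1)] T(1)] by auto
  then obtain S where S: "S \<in> carrier_mat d2 d2" "T * S = 1\<^sub>m d2" "S * T = 1\<^sub>m d2"
    using det_nonzero_inverse[OF T(1)] by blast
  have TD: "T * D X = D X * T" if X: "X \<in> carrier_mat d1 d1" for X
    unfolding D_def mat_diag_mult_right[OF T(1)] mat_diag_mult_left[OF T(1)]
  proof (rule cong_mat)
    fix k l assume "k < d2" "l < d2"
    then show "(\<lambda>(i, j). T $$ (i, j) * vec_state (u j) X) (k, l) =
        (\<lambda>(i, j). vec_state (u i) X * T $$ (i, j)) (k, l)"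
      using TR[of k l] X by (cases "T $$ (k, l) = 0") (auto simp: R_def)
  qed simp_all
  have SD: "D X * S = S * D X" if X: "X \<in> carrier_mat d1 d1" for X
  proof -
    have "D X * S = (S * T) * (D X * S)"
      using left_mult_one_mat[OF mult_carrier_mat[OF D S(1)]] S(3) by simp
    also have "\<dots> = S * (T * D X) * S"
      using S(1) T(1) D[of X] by (smt (verit) assoc_mult_mat mult_carrier_mat)
    also have "\<dots> = S * (D X * T) * S" by (simp add: TD[OF X])
    also have "\<dots> = S * D X * (T * S)"
      using S(1) T(1) D[of X] by (smt (verit) assoc_mult_mat mult_carrier_mat)
    also have "\<dots> = S * D X" using right_mult_one_mat[OF mult_carrier_mat[OF S(1) D]] S by simp
    finally show ?thesis .
  qed
  define W where "W = Z * S"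
  have W: "W \<in> carrier_mat d2 d2" using Z(1) S(1) by (simp add: W_def)
  have "mat_adjoint W * W = mat_adjoint S * mat_adjoint Z * (Z * S)"
    unfolding W_def mat_adjoint_mult[OF Z(1) S(1)] ..
  also have "\<dots> = mat_adjoint S * G * S"
    unfolding G_def using S(1) Z(1) mat_adjoint_carrier[OF S(1)] mat_adjoint_carrier[OF Z(1)]
    by (smt (verit) assoc_mult_mat mult_carrier_mat)
  also have "\<dots> = (mat_adjoint S * mat_adjoint T) * (T * S)"
    unfolding T(2) using S(1) T(1) mat_adjoint_carrier[OF S(1)] mat_adjoint_carrier[OF T(1)]
    by (smt (verit) assoc_mult_mat mult_carrier_mat)
  also have "\<dots> = 1\<^sub>m d2"
    unfolding mat_adjoint_mult[OF T(1) S(1), symmetric] S(2) by simp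
  finally have "unitary_mat d2 W" by (rule unitary_matI[OF W])
  moreover have "\<Phi> X * W = W * D X" if X: "X \<in> carrier_mat d1 d1" for X
  proof -
    have pc: "\<Phi> X \<in> carrier_mat d2 d2" using \<Phi>[OF X] by simp
    have "\<Phi> X * W = \<Phi> X * Z * S" unfolding W_def using pc Z(1) S(1) by simp
    also have "\<dots> = Z * (D X * S)" unfolding eigen[OF X] using Z(1) S(1) D[of X] by simp
    also have "\<dots> = W * D X" unfolding W_def SD[OF X] using Z(1) S(1) D[of X] by simp
    finally show ?thesis .
  qed
  ultimately show ?thesis unfolding diagonalized_by_def D_def using u by blast
qed

text \<open>Expanding the determinant of \<open>I = \<Sum>\<^sub>j |y\<^sub>j\<rangle>\<langle>y\<^sub>j|\<close> by multilinearity in its rows gives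
  a sum of multiples of conjugate determinants of families \<open>y\<^bsub>b 0\<^esub>, \<dots>, y\<^bsub>b (d - 1)\<^esub>\<close>, which
  cannot all vanish.\<close>

lemma resolution_contains_basis:
  fixes J :: "nat set"
  assumes fin: "finite J" and y: "\<And>j. j \<in> J \<Longrightarrow> y j \<in> carrier_vec d"
    and res: "mat_sum d d (\<lambda>j. ketbra (y j) (y j)) J = 1\<^sub>m d"
  obtains b where "\<And>k. k < d \<Longrightarrow> b k \<in> J" "det (mat d d (\<lambda>(r, k). y (b k) $ r)) \<noteq> 0"
proof -
  define a where "a r j = (y j $ r) \<cdot>\<^sub>v conjugate (y j)" for r j
  have a: "a \<in> {0..<d} \<rightarrow> J \<rightarrow> carrier_vec d" using y by (auto simp: a_def)
  have "mat\<^sub>r d d (\<lambda>r. finsum_vec TYPE(complex) d (a r) J) =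
      mat_sum d d (\<lambda>j. ketbra (y j) (y j)) J"
  proof (rule eq_matI)
    fix r c assume "r < dim_row (mat_sum d d (\<lambda>j. ketbra (y j) (y j)) J)"
      "c < dim_col (mat_sum d d (\<lambda>j. ketbra (y j) (y j)) J)"
    then have rc: "r < d" "c < d" by auto
    have yd: "dim_vec (y j) = d" if "j \<in> J" for j using y[OF that] by simp
    have "a r \<in> J \<rightarrow> carrier_vec d" using a rc by auto
    then show "mat\<^sub>r d d (\<lambda>r. finsum_vec TYPE(complex) d (a r) J) $$ (r, c) =
        mat_sum d d (\<lambda>j. ketbra (y j) (y j)) J $$ (r, c)"
      using rc yd by (simp add: index_finsum_vec[OF fin] a_def)
  qed auto
  then have "det (mat\<^sub>r d d (\<lambda>r. finsum_vec TYPE(complex) d (a r) J)) \<noteq> 0"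
    unfolding res by simp
  then obtain f where f: "\<forall>i\<in>{0..<d}. f i \<in> J" and nz: "det (mat\<^sub>r d d (\<lambda>i. a i (f i))) \<noteq> 0"
    unfolding det_linear_rows_sum[OF fin a] using sum.not_neutral_contains_not_neutral by blast
  define Y where "Y = mat d d (\<lambda>(r, k). y (f k) $ r)"
  have Yc: "Y \<in> carrier_mat d d" by (simp add: Y_def)
  have yf: "dim_vec (y (f k)) = d" if "k < d" for k using y f that by auto
  have "mat\<^sub>r d d (\<lambda>i. conjugate (y (f i))) = mat_adjoint Y"
    by (rule eq_matI) (use yf in \<open>auto simp: Y_def\<close>)
  moreover have "det (mat\<^sub>r d d (\<lambda>i. a i (f i))) =
      (\<Prod>i\<in>{0..<d}. y (f i) $ i) * det (mat\<^sub>r d d (\<lambda>i. conjugate (y (f i))))"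
    unfolding a_def by (rule det_rows_mul) (use y f in auto)
  ultimately have "det (mat_adjoint Y) \<noteq> 0" using nz by auto
  then have "det Y \<noteq> 0"
    using det_mat_adjoint_nonzero[OF mat_adjoint_carrier[OF Yc]] by simp
  then show ?thesis using that[of f] f by (simp add: Y_def)
qed

section \<open>A lower bound for the Choi rank\<close>

lemma cinner_Ad:
  assumes V: "V \<in> carrier_mat d1 d2" and X: "X \<in> carrier_mat d1 d1"
    and z: "z \<in> carrier_vec d2" and w: "w \<in> carrier_vec d2"
  shows "cinner z (Ad V X *\<^sub>v w) = cinner (V *\<^sub>v z) (X *\<^sub>v (V *\<^sub>v w))"
proof -
  have Va: "mat_adjoint V \<in> carrier_mat d2 d1" using V by simp
  have Vw: "V *\<^sub>v w \<in> carrier_vec d1" using V w by simp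
  have "Ad V X *\<^sub>v w = mat_adjoint V *\<^sub>v (X *\<^sub>v (V *\<^sub>v w))"
    unfolding Ad_def assoc_mult_mat_vec[OF mult_carrier_mat[OF Va X] V w]
    by (rule assoc_mult_mat_vec[OF Va X Vw])
  then show ?thesis using cinner_mat_adjoint[OF V z] X Vw by simp
qed

lemma Ad_carrier: "V \<in> carrier_mat d1 d2 \<Longrightarrow> X \<in> carrier_mat d1 d1 \<Longrightarrow> Ad V X \<in> carrier_mat d2 d2"
  unfolding Ad_def by (meson mat_adjoint_carrier mult_carrier_mat)

lemma Ad_ketbra:
  assumes x: "x \<in> carrier_vec d1" and y: "y \<in> carrier_vec d2" and X: "X \<in> carrier_mat d1 d1"
  shows "Ad (ketbra x y) X = vec_state x X \<cdot>\<^sub>m ketbra y y"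
proof (rule mat_eqI_cinner[of _ d2])
  fix z w :: "complex vec" assume zw: "z \<in> carrier_vec d2" "w \<in> carrier_vec d2"
  have "cinner z (Ad (ketbra x y) X *\<^sub>v w) = cnj (cinner y z) * (cinner y w * vec_state x X)"
    using zw x y X
    by (simp add: cinner_Ad[where ?d1.0 = d1 and ?d2.0 = d2] ketbra_mult_vec[where d = d2]
        mult_mat_vec[where nr = d1 and nc = d1] cinner_smult[where d = d1])
  also have "\<dots> = cinner z (holevo d2 {()} (\<lambda>_. x) (\<lambda>_. y) X *\<^sub>v w)"
    using zw y by (simp add: cinner_holevo cinner_commute[of y d2 z])
  also have "holevo d2 {()} (\<lambda>_. x) (\<lambda>_. y) X = vec_state x X \<cdot>\<^sub>m ketbra y y"
    by (rule eq_matI) (use y in \<open>auto simp: holevo_def ketbra_def\<close>)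
  finally show "cinner z (Ad (ketbra x y) X *\<^sub>v w) = cinner z ((vec_state x X \<cdot>\<^sub>m ketbra y
      y) *\<^sub>v w)" .
qed (use assms Ad_carrier[of "ketbra x y" d1 d2 X] in auto)

lemma holevo_eq_Ad_sum:
  assumes "\<And>j. j \<in> J \<Longrightarrow> x j \<in> carrier_vec d1 \<and> y j \<in> carrier_vec d2" "X \<in> carrier_mat d1 d1"
  shows "holevo d2 J x y X = mat_sum d2 d2 (\<lambda>j. Ad (ketbra (x j) (y j)) X) J"
  unfolding holevo_def
  by (rule mat_sum_cong[OF refl], rule Ad_ketbra[symmetric]) (use assms in auto)

text \<open>The left side is the quadratic form of the Choi matrix at the tensor
  \<open>\<Sum>\<^sub>k c\<^sub>k (cnj a\<^sub>k) \<otimes> z\<^sub>k\<close>.  It depends on the map alone, whereas the right side refers to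
  one of the decompositions of the map.\<close>

lemma Ad_sum_choi_form:
  assumes V: "\<And>j. j \<in> J \<Longrightarrow> V j \<in> carrier_mat d1 d2"
    and a: "\<And>k. k < p \<Longrightarrow> a k \<in> carrier_vec d1"
    and z: "\<And>k. k < p \<Longrightarrow> z k \<in> carrier_vec d2"
  shows "(\<Sum>k<p. \<Sum>l<p. cnj (c k) * c l *
        cinner (z k) (mat_sum d2 d2 (\<lambda>j. Ad (V j) (ketbra (a k) (a l))) J *\<^sub>v z l)) =
    (\<Sum>j\<in>J. cnj (\<Sum>k<p. c k * cinner (a k) (V j *\<^sub>v z k)) *
      (\<Sum>k<p. c k * cinner (a k) (V j *\<^sub>v z k)))"
proof -
  let ?N = "\<lambda>j k. cinner (a k) (V j *\<^sub>v z k)"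
  have "(\<Sum>k<p. \<Sum>l<p. cnj (c k) * c l *
        cinner (z k) (mat_sum d2 d2 (\<lambda>j. Ad (V j) (ketbra (a k) (a l))) J *\<^sub>v z l)) =
      (\<Sum>k<p. \<Sum>l<p. \<Sum>j\<in>J. cnj (c k * ?N j k) * (c l * ?N j l))"
  proof (intro sum.cong refl)
    fix k l assume "k \<in> {..<p}" "l \<in> {..<p}"
    then have kl: "k < p" "l < p" by auto
    have Vz: "V j *\<^sub>v z i \<in> carrier_vec d1" if "j \<in> J" "i < p" for i j
      using V[OF that(1)] z[OF that(2)] by simp
    have "cinner (z k) (mat_sum d2 d2 (\<lambda>j. Ad (V j) (ketbra (a k) (a l))) J *\<^sub>v z l) =
        (\<Sum>j\<in>J. cinner (z k) (Ad (V j) (ketbra (a k) (a l)) *\<^sub>v z l))"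
      by (rule cinner_mat_sum) (use kl a z Ad_carrier[OF V] in \<open>auto intro!: ketbra_carrier\<close>)
    also have "\<dots> = (\<Sum>j\<in>J. cnj (?N j k) * ?N j l)"
    proof (rule sum.cong[OF refl])
      fix j assume j: "j \<in> J"
      have "cinner (z k) (Ad (V j) (ketbra (a k) (a l)) *\<^sub>v z l) =
          cinner (V j *\<^sub>v z k) (ketbra (a k) (a l) *\<^sub>v (V j *\<^sub>v z l))"
        by (rule cinner_Ad[OF V[OF j]]) (use a z kl in auto)
      also have "\<dots> = ?N j l * cinner (V j *\<^sub>v z k) (a k)"
        using Vz[OF j] a kl by (simp add: ketbra_mult_vec[where d = d1] cinner_smult[where d = d1])
      also have "cinner (V j *\<^sub>v z k) (a k) = cnj (?N j k)"
        by (rule cinner_commute) (use Vz[OF j] a kl in auto)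
      finally show "cinner (z k) (Ad (V j) (ketbra (a k) (a l)) *\<^sub>v z l) =
          cnj (?N j k) * ?N j l" by (simp add: mult.commute)
    qed
    finally show "cnj (c k) * c l *
        cinner (z k) (mat_sum d2 d2 (\<lambda>j. Ad (V j) (ketbra (a k) (a l))) J *\<^sub>v z l) =
        (\<Sum>j\<in>J. cnj (c k * ?N j k) * (c l * ?N j l))"
      by (simp add: sum_distrib_left mult_ac)
  qed
  also have "\<dots> = (\<Sum>k<p. \<Sum>j\<in>J. \<Sum>l<p. cnj (c k * ?N j k) * (c l * ?N j l))"
    by (rule sum.cong[OF refl]) (rule sum.swap)
  also have "\<dots> = (\<Sum>j\<in>J. \<Sum>k<p. \<Sum>l<p. cnj (c k * ?N j k) * (c l * ?N j l))"
    by (rule sum.swap)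
  finally show ?thesis by (simp add: sum_product)
qed

lemma underdetermined_system_solution:
  fixes N :: "nat \<Rightarrow> nat \<Rightarrow> complex"
  assumes "m < p"
  obtains c where "\<And>l. l < m \<Longrightarrow> (\<Sum>k<p. c k * N l k) = 0" "\<exists>k<p. c k \<noteq> 0"
proof -
  define M where "M = mat p p (\<lambda>(l, k). if l < m then N l k else 0)"
  have M: "M \<in> carrier_mat p p" by (simp add: M_def)
  have "det M = 0"
  proof (rule ccontr)
    assume "det M \<noteq> 0"
    then obtain B where B: "B \<in> carrier_mat p p" "M * B = 1\<^sub>m p"
      using det_nonzero_inverse[OF M] by blast
    have "(M * B) $$ (m, m) = 0" using assms B(1) by (simp add: M_def scalar_prod_def)
    then show False using assms by (simp add: B(2))
  qed
  then obtain v where v: "v \<in> carrier_vec p" "v \<noteq> 0\<^sub>v p" "M *\<^sub>v v = 0\<^sub>v p"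
    using det_0_iff_vec_prod_zero_field[OF M] by blast
  have "(\<Sum>k<p. v $ k * N l k) = 0" if "l < m" for l
  proof -
    have "(M *\<^sub>v v) $ l = (\<Sum>k<p. v $ k * N l k)"
      using that assms v(1) by (simp add: M_def scalar_prod_def lessThan_atLeast0 mult.commute)
    then show ?thesis using v(3) that assms by simp
  qed
  moreover have "\<exists>k<p. v $ k \<noteq> 0" using v(1,2) by (auto intro: eq_vecI)
  ultimately show ?thesis using that by blast
qed

text \<open>Say that \<open>V\<close> kills the combination \<open>c\<close> of the test tensors \<open>(cnj a\<^sub>k) \<otimes> z\<^sub>k\<close> if
  \<open>\<Sum>\<^sub>k c\<^sub>k \<langle>a\<^sub>k, V z\<^sub>k\<rangle> = 0\<close>.  If \<open>p > m\<close>, then \<open>W\<^sub>0, \<dots>, W\<^bsub>m - 1\<^esub>\<close> all kill some nonzero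
  combination.  The form of the Choi matrix vanishes there, so all \<open>V\<^sub>j\<close> kill it as well.\<close>

lemma Ad_sum_length_ge:
  assumes V: "\<And>j. j \<in> J \<Longrightarrow> V j \<in> carrier_mat d1 d2" and fin: "finite J"
    and W: "is_Ad_sum d1 d2 \<Phi> m W"
    and eq: "\<And>X. X \<in> carrier_mat d1 d1 \<Longrightarrow> \<Phi> X = mat_sum d2 d2 (\<lambda>j. Ad (V j) X) J"
    and a: "\<And>k. k < p \<Longrightarrow> a k \<in> carrier_vec d1"
    and z: "\<And>k. k < p \<Longrightarrow> z k \<in> carrier_vec d2"
    and indep: "\<And>c. (\<And>j. j \<in> J \<Longrightarrow> (\<Sum>k<p. c k * cinner (a k) (V j *\<^sub>v z k)) = 0) \<Longrightarrow>
      \<forall>k<p. c k = 0"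
  shows "p \<le> m"
proof (rule ccontr)
  assume "\<not> p \<le> m"
  then have "m < p" by simp
  then obtain c where c: "\<And>l. l < m \<Longrightarrow> (\<Sum>k<p. c k * cinner (a k) (W l *\<^sub>v z k)) = 0"
    and nz: "\<exists>k<p. c k \<noteq> 0"
    by (rule underdetermined_system_solution[where N = "\<lambda>l k. cinner (a k) (W l *\<^sub>v z k)"]) blast
  let ?S = "\<lambda>j. \<Sum>k<p. c k * cinner (a k) (V j *\<^sub>v z k)"
  have "(\<Sum>j\<in>J. cnj (?S j) * ?S j) = (\<Sum>k<p. \<Sum>l<p. cnj (c k) * c l *
        cinner (z k) (mat_sum d2 d2 (\<lambda>j. Ad (V j) (ketbra (a k) (a l))) J *\<^sub>v z l))"
    by (rule Ad_sum_choi_form[OF V a z, symmetric])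
  also have "\<dots> = (\<Sum>k<p. \<Sum>l<p. cnj (c k) * c l *
        cinner (z k) (mat_sum d2 d2 (\<lambda>j. Ad (W j) (ketbra (a k) (a l))) {..<m} *\<^sub>v z l))"
    using W eq a by (intro sum.cong refl) (simp add: is_Ad_sum_def)
  also have "\<dots> = 0"
    by (subst Ad_sum_choi_form[where ?d1.0 = d1]) (use W a z c in \<open>auto simp: is_Ad_sum_def\<close>)
  finally have "(\<Sum>j\<in>J. complex_of_real ((cmod (?S j))\<^sup>2)) = 0"
    unfolding complex_norm_square by (simp only: mult.commute)
  then have "(\<Sum>j\<in>J. (cmod (?S j))\<^sup>2) = 0" by (simp only: of_real_sum[symmetric] of_real_eq_0_iff)
  then have "?S j = 0" if "j \<in> J" for j
    using that fin by (simp add: sum_nonneg_eq_0_iff)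
  then show False using indep nz by blast
qed

section \<open>Entanglement breaking maps are the maps in Holevo form\<close>

lemma sum_blocks:
  fixes f :: "nat \<Rightarrow> complex"
  shows "(\<Sum>i<k * d. f i) = (\<Sum>p<k. \<Sum>a<d. f (p * d + a))"
proof (induction k)
  case (Suc k)
  have "(\<Sum>i<Suc k * d. f i) = (\<Sum>i<k * d + d. f i)" by (simp add: add.commute)
  also have "\<dots> = (\<Sum>i<k * d. f i) + (\<Sum>a<d. f (k * d + a))"
  proof -
    have "(\<Sum>i<n + m. f i) = (\<Sum>i<n. f i) + (\<Sum>a<m. f (n + a))" for n m
      by (induction m) (simp_all add: add.assoc)
    then show ?thesis .
  qed
  finally show ?case using Suc by simp
qed simp

lemma block_index_less: "p < k \<Longrightarrow> a < d \<Longrightarrow> p * d + a < k * (d :: nat)"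
  by (metis add.commute add_less_le_mono less_eq_Suc_le mult.commute mult_Suc mult_le_mono1
      nat_less_le order_less_le_trans add_less_cancel_right le_refl)

lemma psd_mat_sum:
  assumes "\<And>j. j \<in> J \<Longrightarrow> psd n (A j)"
  shows "psd n (mat_sum n n A J)"
  unfolding psd_def
proof (intro conjI ballI)
  fix v :: "complex vec" assume v: "v \<in> carrier_vec n"
  have "cinner v (mat_sum n n A J *\<^sub>v v) = (\<Sum>j\<in>J. cinner v (A j *\<^sub>v v))"
    by (rule cinner_mat_sum) (use v assms in \<open>auto simp: psd_def\<close>)
  also have "\<dots> \<ge> 0" by (rule sum_nonneg) (use v assms in \<open>auto simp: psd_def\<close>)
  finally show "0 \<le> cinner v (mat_sum n n A J *\<^sub>v v)" .
qed simp

text \<open>The form of \<open>A \<otimes> |y\<rangle>\<langle>y|\<close> at \<open>v\<close> is the form of \<open>A\<close> at the contraction of \<open>v\<close>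
  with \<open>y\<close>.\<close>

lemma psd_kron_ketbra:
  assumes A: "psd k A" and y: "y \<in> carrier_vec d"
  shows "psd (k * d) (kron A (ketbra y y))"
proof -
  have Ac: "A \<in> carrier_mat k k" using A by (simp add: psd_def)
  have Kc: "kron A (ketbra y y) \<in> carrier_mat (k * d) (k * d)"
    using Ac y by (auto simp: kron_def ketbra_def)
  have "0 \<le> vec_state v (kron A (ketbra y y))" if v: "v \<in> carrier_vec (k * d)" for v
  proof -
    define w where "w q = (\<Sum>b<d. cnj (y $ b) * v $ (q * d + b))" for q
    have ent: "kron A (ketbra y y) $$ (p * d + a, q * d + b) = A $$ (p, q) * (y $ a * cnj (y $ b))"
      if "p < k" "q < k" "a < d" "b < d" for p q a b
      using Ac y that block_index_less[of p k a d] block_index_less[of q k b d]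
      by (simp add: kron_def ketbra_def)
    have "vec_state v (kron A (ketbra y y)) =
        (\<Sum>p<k. \<Sum>a<d. \<Sum>q<k. \<Sum>b<d. cnj (v $ (p * d + a)) * (A $$ (p, q) * (y $ a * cnj (y $
            b))) * v $ (q * d + b))"
      unfolding vec_state_eq_sum[OF v Kc] sum_blocks by (simp add: ent)
    also have "\<dots> = (\<Sum>p<k. \<Sum>q<k. \<Sum>a<d. \<Sum>b<d. cnj (v $ (p * d + a)) * (A $$ (p, q) * (y $ a *
        cnj (y $ b))) * v $ (q * d + b))"
      by (rule sum.cong[OF refl], rule sum.swap)
    also have "\<dots> = quad_form k (\<lambda>p q. A $$ (p, q)) w"
      unfolding quad_form_def w_def
      by (intro sum.cong refl) (simp add: sum_product sum_distrib_left sum_distrib_right mult_ac)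
    also have "\<dots> \<ge> 0" by (rule psd_quad_form[OF A])
    finally show ?thesis .
  qed
  then show ?thesis using Kc by (simp add: psd_def)
qed

lemma tensor_block_carrier [simp]: "tensor_block d X i j \<in> carrier_mat d d"
  by (simp add: tensor_block_def)

text \<open>The form at \<open>v\<close> is the form of \<open>X\<close> at \<open>v \<otimes> x\<close>.\<close>

lemma psd_vec_state_blocks:
  assumes X: "psd (k * d) X" and x: "x \<in> carrier_vec d"
  shows "psd k (mat k k (\<lambda>(p, q). vec_state x (tensor_block d X p q)))" (is "psd k ?A")
proof -
  have Xc: "X \<in> carrier_mat (k * d) (k * d)" using X by (simp add: psd_def)
  have "0 \<le> vec_state v ?A" if v: "v \<in> carrier_vec k" for v
  proof -
    define w where "w = vec (k * d) (\<lambda>i. v $ (i div d) * x $ (i mod d))"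
    have wc: "w \<in> carrier_vec (k * d)" by (simp add: w_def)
    have went: "w $ (p * d + a) = v $ p * x $ a" if "p < k" "a < d" for p a
      using that block_index_less[of p k a d] by (simp add: w_def)
    have "vec_state w X = (\<Sum>p<k. \<Sum>a<d. \<Sum>q<k. \<Sum>b<d.
        cnj (v $ p * x $ a) * X $$ (p * d + a, q * d + b) * (v $ q * x $ b))"
      unfolding vec_state_eq_sum[OF wc Xc] sum_blocks by (simp add: went)
    also have "\<dots> = (\<Sum>p<k. \<Sum>q<k. \<Sum>a<d. \<Sum>b<d.
        cnj (v $ p * x $ a) * X $$ (p * d + a, q * d + b) * (v $ q * x $ b))"
      by (rule sum.cong[OF refl], rule sum.swap)
    also have "\<dots> = (\<Sum>p<k. \<Sum>q<k. cnj (v $ p) * vec_state x (tensor_block d X p q) * v $ q)"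
      by (intro sum.cong refl, subst vec_state_eq_sum[OF x tensor_block_carrier])
        (simp add: sum_distrib_left sum_distrib_right mult_ac tensor_block_def)
    also have "\<dots> = vec_state v ?A"
      using v by (subst vec_state_eq_sum[of v k]) auto
    finally show ?thesis using psd_vec_state[OF X wc] by simp
  qed
  then show ?thesis by (simp add: psd_def)
qed

lemma vec_state_add:
  assumes "x \<in> carrier_vec d" "X \<in> carrier_mat d d" "Y \<in> carrier_mat d d"
  shows "vec_state x (X + Y) = vec_state x X + vec_state x Y"
  using assms
  by (subst (1 2 3) vec_state_eq_sum[of x d]) (auto simp: sum.distrib distrib_left distrib_right)

lemma vec_state_smult_mat:
  assumes "x \<in> carrier_vec d" "X \<in> carrier_mat d d"
  shows "vec_state x (c \<cdot>\<^sub>m X) = c * vec_state x X"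
  using assms by (simp add: vec_state_eq_sum[of x d] sum_distrib_left mult_ac)

lemma holevo_linear:
  assumes x: "\<And>j. j \<in> J \<Longrightarrow> x j \<in> carrier_vec d1" and y: "\<And>j. j \<in> J \<Longrightarrow> y j \<in> carrier_vec d2"
  shows "linear_mat_map d1 d2 (holevo d2 J x y)"
proof -
  note idx = holevo_index[of J y d2, OF y]
  have "holevo d2 J x y (X + Y) = holevo d2 J x y X + holevo d2 J x y Y"
    if "X \<in> carrier_mat d1 d1" "Y \<in> carrier_mat d1 d1" for X Y
    using that x vec_state_add[of "x _" d1 X Y]
    by (intro eq_matI) (simp_all add: idx distrib_right sum.distrib)
  moreover have "holevo d2 J x y (e \<cdot>\<^sub>m X) = e \<cdot>\<^sub>m holevo d2 J x y X"
    if "X \<in> carrier_mat d1 d1" for X e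
    using that x vec_state_smult_mat[of "x _" d1 X e]
    by (intro eq_matI) (simp_all add: idx sum_distrib_left mult.assoc)
  ultimately show ?thesis by (simp add: linear_mat_map_def)
qed

lemma ampliation_holevo:
  assumes \<Phi>: "\<And>X. X \<in> carrier_mat d1 d1 \<Longrightarrow> \<Phi> X = holevo d2 J x y X"
    and y: "\<And>j. j \<in> J \<Longrightarrow> y j \<in> carrier_vec d2"
  shows "ampliation k d1 d2 \<Phi> X = mat_sum (k * d2) (k * d2)
    (\<lambda>j. kron (mat k k (\<lambda>(p, q). vec_state (x j) (tensor_block d1 X p q))) (ketbra (y j) (y j))) J"
proof (rule eq_matI, goal_cases)
  case (1 r c)
  then have rc: "r < k * d2" "c < k * d2" by auto
  then have d2: "0 < d2" by (cases d2) auto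
  have q: "r div d2 < k" "c div d2 < k" using rc by (auto simp: less_mult_imp_div_less)
  have m: "r mod d2 < d2" "c mod d2 < d2" using d2 by auto
  have yd: "dim_vec (y j) = d2" if "j \<in> J" for j using y[OF that] by simp
  show ?case
    using rc q m yd
    by (simp add: ampliation_def \<Phi> holevo_index[of J y d2, OF y m] kron_def ketbra_def)
qed (auto simp: ampliation_def)

lemma holevo_entanglement_breaking:
  assumes fin: "finite J" and \<Phi>: "\<And>X. X \<in> carrier_mat d1 d1 \<Longrightarrow> \<Phi> X = holevo d2 J x y X"
    and x: "\<And>j. j \<in> J \<Longrightarrow> x j \<in> carrier_vec d1" and y: "\<And>j. j \<in> J \<Longrightarrow> y j \<in> carrier_vec d2"
  shows "entanglement_breaking d1 d2 \<Phi>"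
proof -
  have lin: "linear_mat_map d1 d2 \<Phi>"
    using holevo_linear[of J x d1 y d2, OF x y] \<Phi> by (simp add: linear_mat_map_def)
  have sep: "separable k d2 (ampliation k d1 d2 \<Phi> X)" if X: "psd (k * d1) X" for k X
  proof -
    let ?A = "\<lambda>j. mat k k (\<lambda>(p, q). vec_state (x j) (tensor_block d1 X p q))"
    let ?B = "\<lambda>j. ketbra (y j) (y j)"
    have A: "psd k (?A j)" if "j \<in> J" for j by (rule psd_vec_state_blocks[OF X x[OF that]])
    have eq: "ampliation k d1 d2 \<Phi> X = mat_sum (k * d2) (k * d2) (\<lambda>j. kron (?A j) (?B j)) J"
      using ampliation_holevo[OF \<Phi> y] by simp
    have psd: "psd (k * d2) (ampliation k d1 d2 \<Phi> X)"
      unfolding eq by (rule psd_mat_sum, rule psd_kron_ketbra) (use A y in auto)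
    obtain h where h: "bij_betw h {..<card J} J"
      using ex_bij_betw_nat_finite[OF fin] by (auto simp: lessThan_atLeast0)
    have "ampliation k d1 d2 \<Phi> X =
        mat_sum (k * d2) (k * d2) (\<lambda>i. kron (?A (h i)) (?B (h i))) {..<card J}"
      unfolding eq mat_sum_def
      by (rule cong_mat[OF refl refl]) (auto simp: sum.reindex_bij_betw[OF h, symmetric])
    moreover have "psd k (?A (h i)) \<and> psd d2 (?B (h i))" if "i < card J" for i
    proof -
      have "h i \<in> J" using h that by (auto simp: bij_betw_def)
      then show ?thesis using A psd_ketbra y by blast
    qed
    ultimately have "\<exists>(n::nat) A B. (\<forall>i<n. psd k (A i) \<and> psd d2 (B i)) \<and>
        ampliation k d1 d2 \<Phi> X = mat_sum (k * d2) (k * d2) (\<lambda>i. kron (A i) (B i)) {..<n}"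
      by - (rule exI[of _ "card J"], rule exI[of _ "\<lambda>i. ?A (h i)"],
          rule exI[of _ "\<lambda>i. ?B (h i)"], blast)
    then show ?thesis using psd unfolding separable_def by blast
  qed
  then show ?thesis
    unfolding entanglement_breaking_def completely_positive_def using lin
    by (auto simp: separable_def)
qed

lemma linear_mat_map_expand:
  assumes lin: "linear_mat_map d1 d2 \<Phi>" and X: "X \<in> carrier_mat d1 d1"
  shows "\<Phi> X = mat_sum d2 d2
    (\<lambda>(i, j). X $$ (i, j) \<cdot>\<^sub>m \<Phi> (ketbra (unit_vec d1 i) (unit_vec d1 j))) ({..<d1} \<times> {..<d1})"
proof -
  let ?E = "\<lambda>i j. ketbra (unit_vec d1 i) (unit_vec d1 j)"
  have car: "\<And>X. X \<in> carrier_mat d1 d1 \<Longrightarrow> \<Phi> X \<in> carrier_mat d2 d2"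
    and add: "\<And>X Y. X \<in> carrier_mat d1 d1 \<Longrightarrow> Y \<in> carrier_mat d1 d1 \<Longrightarrow> \<Phi> (X + Y) = \<Phi> X + \<Phi> Y"
    and smult: "\<And>c X. X \<in> carrier_mat d1 d1 \<Longrightarrow> \<Phi> (c \<cdot>\<^sub>m X) = c \<cdot>\<^sub>m \<Phi> X"
    using lin by (auto simp: linear_mat_map_def)
  have E: "?E i j \<in> carrier_mat d1 d1" for i j by simp
  have step: "\<Phi> (mat_sum d1 d1 (\<lambda>(i, j). X $$ (i, j) \<cdot>\<^sub>m ?E i j) S) =
      mat_sum d2 d2 (\<lambda>(i, j). X $$ (i, j) \<cdot>\<^sub>m \<Phi> (?E i j)) S" if "finite S" for S
    using that
  proof induction
    case empty
    have "mat_sum d1 d1 (\<lambda>(i, j). X $$ (i, j) \<cdot>\<^sub>m ?E i j) {} = 0 \<cdot>\<^sub>m 0\<^sub>m d1 d1"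
      by (rule eq_matI) auto
    then have "\<Phi> (mat_sum d1 d1 (\<lambda>(i, j). X $$ (i, j) \<cdot>\<^sub>m ?E i j) {}) = 0 \<cdot>\<^sub>m \<Phi> (0\<^sub>m d1 d1)"
      using smult[of "0\<^sub>m d1 d1" 0] by simp
    then show ?case using car[of "0\<^sub>m d1 d1"] by (auto intro!: eq_matI)
  next
    case (insert s S)
    obtain i j where s: "s = (i, j)" by (cases s)
    have "mat_sum d1 d1 (\<lambda>(i, j). X $$ (i, j) \<cdot>\<^sub>m ?E i j) (insert s S) =
        X $$ (i, j) \<cdot>\<^sub>m ?E i j + mat_sum d1 d1 (\<lambda>(i, j). X $$ (i, j) \<cdot>\<^sub>m ?E i j) S"
      using insert by (intro eq_matI) (auto simp: s)
    then have "\<Phi> (mat_sum d1 d1 (\<lambda>(i, j). X $$ (i, j) \<cdot>\<^sub>m ?E i j) (insert s S)) =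
        X $$ (i, j) \<cdot>\<^sub>m \<Phi> (?E i j) + mat_sum d2 d2 (\<lambda>(i, j). X $$ (i, j) \<cdot>\<^sub>m \<Phi> (?E i j)) S"
      using add smult E insert.IH by simp
    also have "\<dots> = mat_sum d2 d2 (\<lambda>(i, j). X $$ (i, j) \<cdot>\<^sub>m \<Phi> (?E i j)) (insert s S)"
      using insert car[OF E] by (intro eq_matI) (auto simp: s)
    finally show ?case .
  qed
  have "X = mat_sum d1 d1 (\<lambda>(i, j). X $$ (i, j) \<cdot>\<^sub>m ?E i j) ({..<d1} \<times> {..<d1})"
  proof (rule eq_matI, goal_cases)
    case (1 r c)
    then have rc: "r < d1" "c < d1" by auto
    have "(\<Sum>s\<in>{..<d1} \<times> {..<d1}. (case s of (i, j) \<Rightarrow> X $$ (i, j) \<cdot>\<^sub>m ?E i j) $$ (r, c)) =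
        (\<Sum>s\<in>{(r, c)}. (case s of (i, j) \<Rightarrow> X $$ (i, j) \<cdot>\<^sub>m ?E i j) $$ (r, c))"
      by (rule sum.mono_neutral_right) (use rc in \<open>auto simp: ketbra_def split: if_splits\<close>)
    then show ?case using rc by (simp add: ketbra_def)
  qed (use X in auto)
  then show ?thesis using step[of "{..<d1} \<times> {..<d1}"] by simp
qed

lemma vec_state_sum_form:
  assumes "X \<in> carrier_mat d d"
  shows "vec_state (vec d w) X = (\<Sum>i<d. \<Sum>j<d. cnj (w i) * X $$ (i, j) * w j)"
  using vec_state_eq_sum[of "vec d w" d X] assms by simp

text \<open>The Choi matrix is \<open>(id \<otimes> \<Phi>)(|w\<rangle>\<langle>w|)\<close> for \<open>w = \<Sum>\<^sub>i e\<^sub>i \<otimes> e\<^sub>i\<close>.  A separable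
  decomposition of it, with both tensor factors split further into rank-one matrices, is a
  Holevo form of \<open>\<Phi>\<close>.\<close>

lemma entanglement_breaking_holevo_unnormalized:
  assumes d1: "d1 \<ge> 1" and EB: "entanglement_breaking d1 d2 \<Phi>"
  obtains J :: "(nat \<times> nat \<times> nat) set" and x y where "finite J"
    "\<And>j. j \<in> J \<Longrightarrow> x j \<in> carrier_vec d1" "\<And>j. j \<in> J \<Longrightarrow> y j \<in> carrier_vec d2"
    "\<And>X. X \<in> carrier_mat d1 d1 \<Longrightarrow> \<Phi> X = holevo d2 J x y X"
proof -
  have lin: "linear_mat_map d1 d2 \<Phi>"
    using EB by (simp add: entanglement_breaking_def completely_positive_def)
  define w where "w = vec (d1 * d1) (\<lambda>r. if r div d1 = r mod d1 then 1 else 0 :: complex)"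
  define C where "C = ampliation d1 d1 d2 \<Phi> (ketbra w w)"
  let ?E = "\<lambda>i j. ketbra (unit_vec d1 i) (unit_vec d1 j)"
  have E: "?E i j \<in> carrier_mat d1 d1" for i j by simp
  have "psd (d1 * d1) (ketbra w w)" by (rule psd_ketbra) (simp add: w_def)
  then have "separable d1 d2 C" using EB d1 by (auto simp: entanglement_breaking_def C_def)
  then obtain n :: nat and A B where AB: "\<And>l. l < n \<Longrightarrow> psd d1 (A l)" "\<And>l. l < n \<Longrightarrow> psd d2 (B l)"
    and C: "C = mat_sum (d1 * d2) (d1 * d2) (\<lambda>i. kron (A i) (B i)) {..<n}"
    by (auto simp: separable_def)
  have blk: "tensor_block d1 (ketbra w w) i j = ?E i j" if "i < d1" "j < d1" for i j
    using that block_index_less[of i d1 _ d1] block_index_less[of j d1 _ d1]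
    by (intro eq_matI) (auto simp: tensor_block_def w_def ketbra_def)
  have entry: "\<Phi> (?E i j) $$ (r, c) = (\<Sum>l<n. A l $$ (i, j) * B l $$ (r, c))"
    if ij: "i < d1" "j < d1" and rc: "r < d2" "c < d2" for i j r c
  proof -
    have idx: "i * d2 + r < d1 * d2" "j * d2 + c < d1 * d2"
      using block_index_less that by auto
    have "\<Phi> (?E i j) $$ (r, c) = C $$ (i * d2 + r, j * d2 + c)"
      using idx rc blk[OF ij] by (simp add: C_def ampliation_def)
    also have "\<dots> = (\<Sum>l<n. kron (A l) (B l) $$ (i * d2 + r, j * d2 + c))"
      unfolding C using idx by simp
    also have "\<dots> = (\<Sum>l<n. A l $$ (i, j) * B l $$ (r, c))"
    proof (rule sum.cong[OF refl])
      fix l assume "l \<in> {..<n}"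
      then have "A l \<in> carrier_mat d1 d1" "B l \<in> carrier_mat d2 d2"
        using AB by (auto simp: psd_def)
      then show "kron (A l) (B l) $$ (i * d2 + r, j * d2 + c) = A l $$ (i, j) * B l $$ (r, c)"
        using idx rc by (simp add: kron_def)
    qed
    finally show ?thesis .
  qed
  have factor: "\<exists>W. \<forall>i<m. \<forall>j<m. P $$ (i, j) = (\<Sum>k<m. cnj (W k i) * W k j)" if "psd m P" for m P
    using posform_factor[of m "\<lambda>i j. P $$ (i, j)" "\<lambda>_ _. True"] psd_quad_form[OF that] by blast
  have "\<forall>l\<in>{..<n}. \<exists>W. \<forall>i<d1. \<forall>j<d1. A l $$ (i, j) = (\<Sum>k<d1. cnj (W k i) * W k j)"
    using factor AB(1) by auto
  then obtain U where U: "\<And>l i j. l < n \<Longrightarrow> i < d1 \<Longrightarrow> j < d1 \<Longrightarrow>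
      A l $$ (i, j) = (\<Sum>k<d1. cnj (U l k i) * U l k j)"
    by (metis lessThan_iff)
  have "\<forall>l\<in>{..<n}. \<exists>W. \<forall>i<d2. \<forall>j<d2. B l $$ (i, j) = (\<Sum>k<d2. cnj (W k i) * W k j)"
    using factor AB(2) by auto
  then obtain V where V: "\<And>l i j. l < n \<Longrightarrow> i < d2 \<Longrightarrow> j < d2 \<Longrightarrow>
      B l $$ (i, j) = (\<Sum>k<d2. cnj (V l k i) * V l k j)"
    by (metis lessThan_iff)
  define J where "J = {..<n} \<times> {..<d1} \<times> {..<d2}"
  define x where "x = (\<lambda>(l, k, m :: nat). vec d1 (U l k))"
  define y where "y = (\<lambda>(l, k :: nat, m). vec d2 (\<lambda>r. cnj (V l m r)))"
  show ?thesis
  proof (rule that[of J x y])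
    fix X :: "complex mat" assume X: "X \<in> carrier_mat d1 d1"
    show "\<Phi> X = holevo d2 J x y X"
    proof (rule eq_matI, goal_cases)
      case (1 r c)
      then have rc: "r < d2" "c < d2" by auto
      have \<Phi>E: "\<Phi> (?E i j) \<in> carrier_mat d2 d2" for i j using lin E by (auto simp:
          linear_mat_map_def)
      have "\<Phi> X $$ (r, c) = (\<Sum>(i, j)\<in>{..<d1} \<times> {..<d1}. X $$ (i, j) * \<Phi> (?E i j) $$ (r, c))"
      proof -
        have "dim_row (\<Phi> (?E i j)) = d2" "dim_col (\<Phi> (?E i j)) = d2" for i j
          using \<Phi>E[of i j] by auto
        then show ?thesis
          unfolding linear_mat_map_expand[OF lin X] using rc
          by (simp add: case_prod_beta)
      qed
      also have "\<dots> = (\<Sum>i<d1. \<Sum>j<d1. X $$ (i, j) * (\<Sum>l<n. A l $$ (i, j) * B l $$ (r, c)))"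
        unfolding sum.cartesian_product[symmetric] using entry rc by (intro sum.cong refl) auto
      also have "\<dots> = (\<Sum>i<d1. \<Sum>j<d1. \<Sum>l<n. \<Sum>k<d1. cnj (U l k i) * X $$ (i, j) * U l k j * B l
          $$ (r, c))"
        by (intro sum.cong refl)
          (simp add: U sum_distrib_left sum_distrib_right mult_ac)
      also have "\<dots> = (\<Sum>i<d1. \<Sum>l<n. \<Sum>j<d1. \<Sum>k<d1. cnj (U l k i) * X $$ (i, j) * U l k j * B l
          $$ (r, c))"
        by (rule sum.cong[OF refl], rule sum.swap)
      also have "\<dots> = (\<Sum>l<n. \<Sum>i<d1. \<Sum>j<d1. \<Sum>k<d1. cnj (U l k i) * X $$ (i, j) * U l k j * B l
          $$ (r, c))"
        by (rule sum.swap)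
      also have "\<dots> = (\<Sum>l<n. \<Sum>i<d1. \<Sum>k<d1. \<Sum>j<d1. cnj (U l k i) * X $$ (i, j) * U l k j * B l
          $$ (r, c))"
        by (rule sum.cong[OF refl], rule sum.cong[OF refl], rule sum.swap)
      also have "\<dots> = (\<Sum>l<n. \<Sum>k<d1. \<Sum>i<d1. \<Sum>j<d1. cnj (U l k i) * X $$ (i, j) * U l k j * B l
          $$ (r, c))"
        by (rule sum.cong[OF refl], rule sum.swap)
      also have "\<dots> = (\<Sum>l<n. \<Sum>k<d1. vec_state (vec d1 (U l k)) X * B l $$ (r, c))"
        unfolding vec_state_sum_form[OF X] by (simp add: sum_distrib_right)
      also have "\<dots> = (\<Sum>l<n. \<Sum>k<d1. \<Sum>m<d2. vec_state (x (l, k, m)) X * (y (l, k, m) $ r * cnj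
          (y (l, k, m) $ c)))"
        by (intro sum.cong refl) (simp add: V rc x_def y_def sum_distrib_left)
      also have "\<dots> = (\<Sum>j\<in>J. vec_state (x j) X * (y j $ r * cnj (y j $ c)))"
        unfolding J_def sum.cartesian_product by (simp add: case_prod_beta)
      also have "\<dots> = holevo d2 J x y X $$ (r, c)"
        by (rule holevo_index[symmetric]) (use rc in \<open>auto simp: y_def\<close>)
      finally show ?case .
    qed (use lin X in \<open>auto simp: linear_mat_map_def\<close>)
  qed (auto simp: J_def x_def y_def)
qed

lemma normalize_vec:
  assumes x: "x \<in> carrier_vec d" "x \<noteq> 0\<^sub>v d"
  obtains s :: real where "s > 0" "cinner x x = of_real (s\<^sup>2)"
    "cinner (of_real (1 / s) \<cdot>\<^sub>v x) (of_real (1 / s) \<cdot>\<^sub>v x) = 1"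
proof -
  have "cinner x x \<ge> 0" "cinner x x \<noteq> 0"
    using cinner_self_ge_0 cinner_self_eq_0_iff x by auto
  then have c: "cinner x x = of_real (Re (cinner x x))" "Re (cinner x x) > 0"
    by (auto simp: less_eq_complex_def complex_eq_iff)
  define s where "s = sqrt (Re (cinner x x))"
  have s: "s > 0" "s\<^sup>2 = Re (cinner x x)" using c(2) by (auto simp: s_def)
  then have "cinner x x = of_real (s\<^sup>2)" using c(1) by simp
  moreover have "cinner (of_real (1 / s) \<cdot>\<^sub>v x) (of_real (1 / s) \<cdot>\<^sub>v x) = 1"
    using calculation s(1) x(1) by (simp add: cinner_smult[where d = d] power2_eq_square)
  ultimately show ?thesis using that s(1) by blast
qed

text \<open>The terms that vanish are dropped, and the lengths of the \<open>x\<^sub>j\<close> are moved to the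
  \<open>y\<^sub>j\<close>.\<close>

lemma entanglement_breaking_holevo:
  assumes d1: "d1 \<ge> 1" and EB: "entanglement_breaking d1 d2 \<Phi>"
  obtains m :: nat and x y where
    "\<And>j. j < m \<Longrightarrow> x j \<in> carrier_vec d1 \<and> cinner (x j) (x j) = 1"
    "\<And>j. j < m \<Longrightarrow> y j \<in> carrier_vec d2 \<and> y j \<noteq> 0\<^sub>v d2"
    "\<And>X. X \<in> carrier_mat d1 d1 \<Longrightarrow> \<Phi> X = holevo d2 {..<m} x y X"
proof -
  obtain J :: "(nat \<times> nat \<times> nat) set" and x y where fin: "finite J"
    and x: "\<And>j. j \<in> J \<Longrightarrow> x j \<in> carrier_vec d1" and y: "\<And>j. j \<in> J \<Longrightarrow> y j \<in> carrier_vec d2"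
    and \<Phi>: "\<And>X. X \<in> carrier_mat d1 d1 \<Longrightarrow> \<Phi> X = holevo d2 J x y X"
    using entanglement_breaking_holevo_unnormalized[OF assms] by metis
  define K where "K = {j \<in> J. x j \<noteq> 0\<^sub>v d1 \<and> y j \<noteq> 0\<^sub>v d2}"
  have K: "finite K" "K \<subseteq> J" using fin by (auto simp: K_def)
  have "\<exists>s::real. s > 0 \<and> cinner (of_real (1 / s) \<cdot>\<^sub>v x j) (of_real (1 / s) \<cdot>\<^sub>v x j) = 1" if
      "j \<in> K" for j
  proof -
    have "x j \<in> carrier_vec d1" "x j \<noteq> 0\<^sub>v d1" using x that by (auto simp: K_def)
    then show ?thesis by (rule normalize_vec) blast
  qed
  then obtain s :: "nat \<times> nat \<times> nat \<Rightarrow> real" where s: "\<And>j. j \<in> K \<Longrightarrow> s j > 0"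
    "\<And>j. j \<in> K \<Longrightarrow> cinner (of_real (1 / s j) \<cdot>\<^sub>v x j) (of_real (1 / s j) \<cdot>\<^sub>v x j) = 1"
    by metis
  obtain h where h: "bij_betw h {..<card K} K"
    using ex_bij_betw_nat_finite[OF K(1)] by (auto simp: lessThan_atLeast0)
  define x' where "x' i = of_real (1 / s (h i)) \<cdot>\<^sub>v x (h i)" for i
  define y' where "y' i = of_real (s (h i)) \<cdot>\<^sub>v y (h i)" for i
  have hK: "h i \<in> K" if "i < card K" for i using h that by (auto simp: bij_betw_def)
  have hx: "x (h i) \<in> carrier_vec d1" "y (h i) \<in> carrier_vec d2" "y (h i) \<noteq> 0\<^sub>v d2" if "i <
      card K" for i
    using hK[OF that] x y by (auto simp: K_def)
  show ?thesis
  proof (rule that[of "card K" x' y'])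
    fix i assume i: "i < card K"
    show "x' i \<in> carrier_vec d1 \<and> cinner (x' i) (x' i) = 1"
      using s(2)[OF hK[OF i]] hx[OF i] by (simp add: x'_def)
    have "cinner (y (h i)) (y (h i)) \<noteq> 0" using hx[OF i] cinner_self_eq_0_iff by blast
    then have "cinner (y' i) (y' i) \<noteq> 0"
      using hx(2)[OF i] s(1)[OF hK[OF i]] by (simp add: y'_def cinner_smult[where d = d2])
    then show "y' i \<in> carrier_vec d2 \<and> y' i \<noteq> 0\<^sub>v d2"
      using hx(2)[OF i] by (auto simp: y'_def cinner_def)
  next
    fix X :: "complex mat" assume X: "X \<in> carrier_mat d1 d1"
    show "\<Phi> X = holevo d2 {..<card K} x' y' X"
      unfolding \<Phi>[OF X]
    proof (rule eq_matI, goal_cases)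
      case (1 r c)
      then have rc: "r < d2" "c < d2" by auto
      let ?f = "\<lambda>j. vec_state (x j) X * (y j $ r * cnj (y j $ c))"
      have "holevo d2 J x y X $$ (r, c) = (\<Sum>j\<in>J. ?f j)"
        by (rule holevo_index) (use y rc in auto)
      also have "\<dots> = (\<Sum>j\<in>K. ?f j)"
      proof (rule sum.mono_neutral_right[OF fin K(2)], rule ballI)
        fix j assume j: "j \<in> J - K"
        then have "x j = 0\<^sub>v d1 \<or> y j = 0\<^sub>v d2" by (auto simp: K_def)
        then show "?f j = 0" using X rc by (auto simp: cinner_def)
      qed
      also have "\<dots> = (\<Sum>i<card K. ?f (h i))" by (rule sum.reindex_bij_betw[OF h, symmetric])
      also have "\<dots> = (\<Sum>i<card K. vec_state (x' i) X * (y' i $ r * cnj (y' i $ c)))"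
      proof (rule sum.cong[OF refl])
        fix i assume "i \<in> {..<card K}"
        then have i: "i < card K" by simp
        have "dim_vec (y (h i)) = d2" using hx(2)[OF i] by simp
        then show "?f (h i) = vec_state (x' i) X * (y' i $ r * cnj (y' i $ c))"
          unfolding x'_def y'_def vec_state_smult[OF hx(1)[OF i] X]
          using s(1)[OF hK[OF i]] rc by (simp add: field_simps)
      qed
      also have "\<dots> = holevo d2 {..<card K} x' y' X $$ (r, c)"
        by (rule holevo_index[symmetric]) (use hx(2) rc in \<open>auto simp: y'_def\<close>)
      finally show ?case .
    qed auto
  qed
qed

section \<open>Pure states are vector states\<close>

lemma vec_state_eqI:
  assumes u: "u \<in> carrier_vec d" "cinner u u = 1" and x: "x \<in> carrier_vec d" "cinner x x = 1"
    and 0: "cinner x (x - cinner u x \<cdot>\<^sub>v u) = 0" and X: "X \<in> carrier_mat d d"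
  shows "vec_state x X = vec_state u X"
proof -
  define c where "c = cinner u x"
  have xu: "x = c \<cdot>\<^sub>v u" unfolding c_def by (rule orthogonal_part(4)[OF u x(1) 0])
  have "c * cnj c = 1" using x(2) u unfolding xu by (simp add: cinner_smult[where d = d])
  then show ?thesis unfolding xu vec_state_smult[OF u(1) X] by simp
qed

text \<open>Positive semidefinite matrices in \<open>M\<^sub>k \<otimes> M\<^sub>1 = M\<^sub>k\<close> are separable.\<close>

lemma functional_entanglement_breaking:
  assumes CP: "completely_positive d 1 \<Psi>"
  shows "entanglement_breaking d 1 \<Psi>"
proof -
  have "separable k 1 M" if "psd (k * 1) M" for k M
  proof -
    have M: "psd k M" "M \<in> carrier_mat k k" using that by (auto simp: psd_def)
    have "M = mat_sum (k * 1) (k * 1) (\<lambda>i. kron M (1\<^sub>m 1)) {..<1::nat}"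
      using M(2) by (intro eq_matI) (auto simp: kron_def)
    moreover have "psd 1 (1\<^sub>m 1)" using cinner_self_ge_0[of _ 1] by (simp add: psd_def)
    ultimately have "\<exists>(n::nat) A B. (\<forall>i<n. psd k (A i) \<and> psd 1 (B i)) \<and>
        M = mat_sum (k * 1) (k * 1) (\<lambda>i. kron (A i) (B i)) {..<n}"
      using M(1) by - (rule exI[of _ 1], rule exI[of _ "\<lambda>_. M"], rule exI[of _ "\<lambda>_. 1\<^sub>m 1"], blast)
    then show ?thesis using that unfolding separable_def by blast
  qed
  then show ?thesis using CP by (simp add: entanglement_breaking_def completely_positive_def)
qed

lemma completely_positive_ketbra:
  assumes CP: "completely_positive d 1 \<Psi>" and a: "a \<in> carrier_vec d"
  shows "0 \<le> \<Psi> (ketbra a a) $$ (0, 0)"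
proof -
  have "tensor_block d (ketbra a a) 0 0 = ketbra a a"
    using a by (intro eq_matI) (auto simp: tensor_block_def ketbra_def)
  then have amp: "ampliation 1 d 1 \<Psi> (ketbra a a) $$ (0, 0) = \<Psi> (ketbra a a) $$ (0, 0)"
    by (simp add: ampliation_def)
  have "psd (1 * d) (ketbra a a)" using psd_ketbra[OF a] by simp
  then have "psd (1 * 1) (ampliation 1 d 1 \<Psi> (ketbra a a))"
    using CP by (simp add: completely_positive_def del: mult_1)
  then have "0 \<le> quad_form 1 (\<lambda>i j. ampliation 1 d 1 \<Psi> (ketbra a a) $$ (i, j)) (\<lambda>_. 1)"
    using psd_quad_form by (metis mult_1)
  then show ?thesis by (simp add: quad_form_def amp[unfolded One_nat_def])
qed

text \<open>A completely positive map below the vector state of \<open>u\<close> vanishes at \<open>|a\<rangle>\<langle>a|\<close> for all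
  \<open>a\<close> orthogonal to \<open>u\<close>, so every vector in a Holevo form of it is a multiple of
  \<open>u\<close>.\<close>

lemma vec_state_pure:
  assumes u: "u \<in> carrier_vec d" "cinner u u = 1" and d: "d \<ge> 1"
    and \<phi>: "\<And>X. X \<in> carrier_mat d d \<Longrightarrow> \<phi> X = vec_state u X"
  shows "pure_state d \<phi>"
proof -
  have "entanglement_breaking d 1 (as_M1_map \<phi>)"
    by (rule holevo_entanglement_breaking[of "{()}" d _ 1 "\<lambda>_. u" "\<lambda>_. vec 1 (\<lambda>_. 1)"])
      (use u \<phi> in \<open>auto simp: as_M1_map_def holevo_def ketbra_def intro!: eq_matI\<close>)
  then have CP: "completely_positive d 1 (as_M1_map \<phi>)" by (simp add: entanglement_breaking_def)
  have "\<exists>t::real. 0 \<le> t \<and> (\<forall>X\<in>carrier_mat d d. \<Psi> X = complex_of_real t \<cdot>\<^sub>m as_M1_map \<phi> X)"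
    if \<Psi>: "completely_positive d 1 \<Psi>" and diff: "completely_positive d 1 (\<lambda>X. as_M1_map \<phi> X - \<Psi> X)"
    for \<Psi>
  proof -
    obtain m :: nat and x y where x: "\<And>j. j < m \<Longrightarrow> x j \<in> carrier_vec d \<and> cinner (x j) (x j) = 1"
      and y: "\<And>j. j < m \<Longrightarrow> y j \<in> carrier_vec 1 \<and> y j \<noteq> 0\<^sub>v 1"
      and \<Psi>xy: "\<And>X. X \<in> carrier_mat d d \<Longrightarrow> \<Psi> X = holevo 1 {..<m} x y X"
      using entanglement_breaking_holevo[OF d functional_entanglement_breaking[OF \<Psi>]] by metis
    define t where "t j = (cmod (y j $ 0))\<^sup>2" for j
    have ent: "\<Psi> X $$ (0, 0) = (\<Sum>j<m. vec_state (x j) X * of_real (t j))"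
      if "X \<in> carrier_mat d d" for X
      unfolding \<Psi>xy[OF that] t_def complex_norm_square
      by (rule holevo_index) (use y in auto)
    have t: "t j > 0" if "j < m" for j
    proof -
      have "y j $ 0 \<noteq> 0" using y[OF that] by (auto intro: eq_vecI)
      then show ?thesis by (simp add: t_def)
    qed
    have same: "vec_state (x j) X = vec_state u X" if j: "j < m" and X: "X \<in> carrier_mat d
        d" for j X
    proof (rule vec_state_eqI[OF u _ _ _ X])
      let ?a = "x j - cinner u (x j) \<cdot>\<^sub>v u"
      have a: "?a \<in> carrier_vec d" "cinner u ?a = 0"
        using orthogonal_part[OF u, of "x j"] x[OF j] by auto
      have K: "ketbra ?a ?a \<in> carrier_mat d d" using a(1) by simp
      have "0 \<le> (as_M1_map \<phi> (ketbra ?a ?a) - \<Psi> (ketbra ?a ?a)) $$ (0, 0)"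
        by (rule completely_positive_ketbra[OF diff a(1)])
      also have "\<dots> = - (\<Sum>i<m. vec_state (x i) (ketbra ?a ?a) * of_real (t i))"
        using ent[OF K] \<Psi>xy[OF K] \<phi>[OF K] vec_state_ketbra[OF u(1) a(1)] a(2)
        by (simp add: as_M1_map_def)
      finally have le: "(\<Sum>i<m. vec_state (x i) (ketbra ?a ?a) * of_real (t i)) \<le> 0" by simp
      have nn: "0 \<le> vec_state (x i) (ketbra ?a ?a) * of_real (t i)" if "i < m" for i
        using psd_vec_state[OF psd_ketbra[OF a(1)]] x[OF that] t[OF that]
        by (simp add: less_eq_complex_def)
      define f where "f i = vec_state (x i) (ketbra ?a ?a) * of_real (t i)" for i
      have "sum f {..<m} = 0"
        using le nn by (intro antisym sum_nonneg) (auto simp: f_def)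
      then have "f j = 0"
        using j nn sum_nonneg_eq_0_iff[of "{..<m}" f] by (auto simp: f_def)
      then have "vec_state (x j) (ketbra ?a ?a) * of_real (t j) = 0" by (simp only: f_def)
      then show "cinner (x j) ?a = 0"
        using t[OF j] vec_state_ketbra[of "x j" d ?a] x[OF j] a(1) by simp
    qed (use x[OF j] in auto)
    have "\<Psi> X = complex_of_real (\<Sum>j<m. t j) \<cdot>\<^sub>m as_M1_map \<phi> X" if X: "X \<in> carrier_mat d d" for X
    proof (rule eq_matI)
      fix i j assume "i < dim_row (complex_of_real (\<Sum>j<m. t j) \<cdot>\<^sub>m as_M1_map \<phi> X)"
        "j < dim_col (complex_of_real (\<Sum>j<m. t j) \<cdot>\<^sub>m as_M1_map \<phi> X)"
      then have "i = 0" "j = 0" by (auto simp: as_M1_map_def)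
      then show "\<Psi> X $$ (i, j) = (complex_of_real (\<Sum>j<m. t j) \<cdot>\<^sub>m as_M1_map \<phi> X) $$ (i, j)"
        using ent[OF X] same[OF _ X] \<phi>[OF X]
        by (simp add: as_M1_map_def sum_distrib_left sum_distrib_right mult.commute)
    qed (use \<Psi>xy[OF X] in \<open>auto simp: as_M1_map_def\<close>)
    moreover have "0 \<le> (\<Sum>j<m. t j)" by (rule sum_nonneg) (simp add: t_def)
    ultimately show ?thesis by blast
  qed
  then show ?thesis
    using CP u \<phi>[of "1\<^sub>m d"] by (auto simp: pure_state_def state_def pure_cp_def)
qed

text \<open>A single term of a Holevo form of \<open>\<phi>\<close> lies below \<open>\<phi>\<close>, so by purity it is a
  multiple of \<open>\<phi>\<close>.\<close>

lemma pure_state_vec_state: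
  assumes d: "d \<ge> 1" and pure: "pure_state d \<phi>"
  obtains u where "u \<in> carrier_vec d" "cinner u u = 1"
    "\<And>X. X \<in> carrier_mat d d \<Longrightarrow> \<phi> X = vec_state u X"
proof -
  have CP: "completely_positive d 1 (as_M1_map \<phi>)" and one: "\<phi> (1\<^sub>m d) = 1"
    and P: "\<And>\<Psi>. completely_positive d 1 \<Psi> \<Longrightarrow> completely_positive d 1 (\<lambda>X. as_M1_map \<phi> X - \<Psi> X) \<Longrightarrow>
        \<exists>t::real. 0 \<le> t \<and> (\<forall>X\<in>carrier_mat d d. \<Psi> X = complex_of_real t \<cdot>\<^sub>m as_M1_map \<phi> X)"
    using pure by (auto simp: pure_state_def state_def pure_cp_def)
  obtain m :: nat and x y where x: "\<And>j. j < m \<Longrightarrow> x j \<in> carrier_vec d \<and> cinner (x j) (x j) = 1"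
    and y: "\<And>j. j < m \<Longrightarrow> y j \<in> carrier_vec 1 \<and> y j \<noteq> 0\<^sub>v 1"
    and \<phi>xy: "\<And>X. X \<in> carrier_mat d d \<Longrightarrow> as_M1_map \<phi> X = holevo 1 {..<m} x y X"
    using entanglement_breaking_holevo[OF d functional_entanglement_breaking[OF CP]] by metis
  have ent: "holevo 1 J x y X $$ (0, 0) = (\<Sum>j\<in>J. vec_state (x j) X * (y j $ 0 * cnj (y j $ 0)))"
    if "J \<subseteq> {..<m}" for J X
    by (rule holevo_index) (use y that in auto)
  have \<phi>00: "\<phi> X = (\<Sum>j<m. vec_state (x j) X * (y j $ 0 * cnj (y j $ 0)))" if "X \<in>
      carrier_mat d d" for X
    using \<phi>xy[OF that] ent[of "{..<m}" X] by (simp add: as_M1_map_def mat_eq_iff)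
  have m: "m > 0" using \<phi>00[of "1\<^sub>m d"] one by (cases m) auto
  let ?\<Psi> = "holevo 1 {0} x y"
  have "entanglement_breaking d 1 ?\<Psi>"
    by (rule holevo_entanglement_breaking[of "{0::nat}"]) (use x y m in auto)
  then have cp1: "completely_positive d 1 ?\<Psi>" by (simp add: entanglement_breaking_def)
  have "entanglement_breaking d 1 (\<lambda>X. as_M1_map \<phi> X - ?\<Psi> X)"
  proof (rule holevo_entanglement_breaking[of "{1..<m}" d _ 1 x y])
    fix X :: "complex mat" assume X: "X \<in> carrier_mat d d"
    have "{..<m} = insert 0 {1..<m}" using m by auto
    then have "(\<Sum>j<m. vec_state (x j) X * (y j $ 0 * cnj (y j $ 0))) =
        vec_state (x 0) X * (y 0 $ 0 * cnj (y 0 $ 0)) +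
        (\<Sum>j\<in>{1..<m}. vec_state (x j) X * (y j $ 0 * cnj (y j $ 0)))" by simp
    moreover have "{1..<m} \<subseteq> {..<m}" by auto
    ultimately show "as_M1_map \<phi> X - ?\<Psi> X = holevo 1 {1..<m} x y X"
      using \<phi>00[OF X] ent[of "{0}" X] ent[of "{1..<m}" X] m
      by (intro eq_matI) (auto simp: as_M1_map_def)
  qed (use x y in auto)
  then have "completely_positive d 1 (\<lambda>X. as_M1_map \<phi> X - ?\<Psi> X)"
    by (simp add: entanglement_breaking_def)
  then obtain t where t: "\<And>X. X \<in> carrier_mat d d \<Longrightarrow> ?\<Psi> X = complex_of_real t \<cdot>\<^sub>m as_M1_map \<phi> X"
    using P[OF cp1] by blast
  define q where "q = y 0 $ 0 * cnj (y 0 $ 0)"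
  have q: "q \<noteq> 0" using y[OF m] by (auto simp: q_def intro: eq_vecI)
  have eq: "vec_state (x 0) X * q = complex_of_real t * \<phi> X" if "X \<in> carrier_mat d d" for X
    using arg_cong[OF t[OF that], of "\<lambda>M. M $$ (0, 0)"] ent[of "{0}" X] m
    by (simp add: as_M1_map_def q_def)
  have "q = complex_of_real t" using eq[of "1\<^sub>m d"] one x[OF m] by simp
  then have "\<phi> X = vec_state (x 0) X" if "X \<in> carrier_mat d d" for X
    using eq[OF that] q by simp
  then show ?thesis using that x[OF m] by blast
qed

section \<open>Diagonal maps and their decompositions\<close>

definition udiag :: "nat \<Rightarrow> complex mat \<Rightarrow> (nat \<Rightarrow> complex) \<Rightarrow> complex mat" where
  "udiag d W g = W * mat_diag d g * mat_adjoint W"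

lemma mat_diag_carrier [simp]: "mat_diag d g \<in> carrier_mat d d"
  by (simp add: mat_diag_def)

context
  fixes d :: nat and W :: "complex mat"
  assumes W: "W \<in> carrier_mat d d"
begin

lemma udiag_carrier [simp]: "udiag d W g \<in> carrier_mat d d"
  unfolding udiag_def using W by (meson mat_adjoint_carrier mat_diag_carrier mult_carrier_mat)

lemma udiag_dim [simp]: "dim_row (udiag d W g) = d" "dim_col (udiag d W g) = d"
  using carrier_matD[OF udiag_carrier] by auto

lemma udiag_index:
  "r < d \<Longrightarrow> c < d \<Longrightarrow> udiag d W g $$ (r, c) = (\<Sum>k<d. W $$ (r, k) * g k * cnj (W $$ (c, k)))"
  unfolding udiag_def mat_diag_mult_right[OF W] using W by (simp add: scalar_prod_def
      lessThan_atLeast0)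

lemma mat_adjoint_udiag: "mat_adjoint (udiag d W g) = udiag d W (\<lambda>k. cnj (g k))"
  by (rule eq_matI) (auto simp: udiag_index mult_ac)

lemma mat_sum_udiag:
  "mat_sum d d (\<lambda>i. f i \<cdot>\<^sub>m udiag d W (g i)) J = udiag d W (\<lambda>k. \<Sum>i\<in>J. f i * g i k)"
proof (rule eq_matI, goal_cases)
  case (1 r c)
  then have rc: "r < d" "c < d" by auto
  have "mat_sum d d (\<lambda>i. f i \<cdot>\<^sub>m udiag d W (g i)) J $$ (r, c) =
      (\<Sum>i\<in>J. \<Sum>k<d. f i * (W $$ (r, k) * g i k * cnj (W $$ (c, k))))"
    using rc by (simp add: udiag_index sum_distrib_left)
  also have "\<dots> = (\<Sum>k<d. \<Sum>i\<in>J. f i * (W $$ (r, k) * g i k * cnj (W $$ (c, k))))"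
    by (rule sum.swap)
  also have "\<dots> = udiag d W (\<lambda>k. \<Sum>i\<in>J. f i * g i k) $$ (r, c)"
    using rc by (simp add: udiag_index sum_distrib_left sum_distrib_right mult_ac)
  finally show ?case .
qed auto

lemma holevo_cols: "holevo d {..<d} x (col W) X = udiag d W (\<lambda>k. vec_state (x k) X)"
proof (rule eq_matI, goal_cases)
  case (1 r c)
  then have rc: "r < d" "c < d" by auto
  have "holevo d {..<d} x (col W) X $$ (r, c) =
      (\<Sum>k<d. vec_state (x k) X * (col W k $ r * cnj (col W k $ c)))"
    by (rule holevo_index) (use W rc in auto)
  then show ?case using rc W by (simp add: udiag_index mult_ac)
qed auto

lemma mat_sum_ketbra_cols: "mat_sum d d (\<lambda>k. ketbra (col W k) (col W k)) {..<d} = W * mat_adjoint W"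
  by (rule eq_matI) (use W in \<open>auto simp: scalar_prod_def lessThan_atLeast0 ketbra_def\<close>)

end

lemma unitary_matD:
  assumes "unitary_mat d W"
  shows "W \<in> carrier_mat d d" "mat_adjoint W \<in> carrier_mat d d"
    "mat_adjoint W * W = 1\<^sub>m d" "W * mat_adjoint W = 1\<^sub>m d"
  using assms by (auto simp: unitary_mat_def)

lemma unitary_mat_adjoint: "unitary_mat d W \<Longrightarrow> unitary_mat d (mat_adjoint W)"
  by (simp add: unitary_mat_def)

lemma unitary_mat_mult:
  assumes U: "unitary_mat d U" and W: "unitary_mat d W"
  shows "unitary_mat d (U * W)"
proof (rule unitary_matI)
  note u = unitary_matD[OF U] and w = unitary_matD[OF W]
  have "mat_adjoint (U * W) * (U * W) = mat_adjoint W * (mat_adjoint U * U) * W"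
    unfolding mat_adjoint_mult[OF u(1) w(1)] using u(1,2) w(1,2)
    by (smt (verit) assoc_mult_mat mult_carrier_mat)
  then show "mat_adjoint (U * W) * (U * W) = 1\<^sub>m d" using u w by simp
  show "U * W \<in> carrier_mat d d" using u w by simp
qed

lemma unitary_mat_cols:
  assumes "unitary_mat d W" "i < d" "j < d"
  shows "cinner (col W i) (col W j) = (if i = j then 1 else 0)"
  using mat_adjoint_mult_self_index[of W d d i j] unitary_matD[OF assms(1)] assms by simp

lemma udiag_mult:
  assumes "unitary_mat d W"
  shows "udiag d W g * udiag d W h = udiag d W (\<lambda>k. g k * h k)"
proof -
  note w = unitary_matD[OF assms]
  let ?g = "mat_diag d g" and ?h = "mat_diag d h" and ?A = "mat_adjoint W"
  have c: "?g \<in> carrier_mat d d" "?h \<in> carrier_mat d d" by simp_all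
  have "udiag d W g * udiag d W h = W * ?g * (?A * W) * (?h * ?A)"
    unfolding udiag_def using w(1,2) c by (smt (verit) assoc_mult_mat mult_carrier_mat)
  also have "\<dots> = W * (?g * ?h) * ?A"
    unfolding w(3) right_mult_one_mat[OF mult_carrier_mat[OF w(1) c(1)]]
    using w(1,2) c by (smt (verit) assoc_mult_mat mult_carrier_mat)
  also have "?g * ?h = mat_diag d (\<lambda>k. g k * h k)" by (rule mat_diag_diag)
  finally show ?thesis unfolding udiag_def .
qed

lemma udiag_one: "unitary_mat d W \<Longrightarrow> udiag d W (\<lambda>_. 1) = 1\<^sub>m d"
  unfolding udiag_def mat_diag_one using unitary_matD by (metis right_mult_one_mat)

lemma Ad_udiag:
  assumes U: "U \<in> carrier_mat d d" and W: "W \<in> carrier_mat d d"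
  shows "Ad U (udiag d W g) = udiag d (mat_adjoint U * W) g"
proof -
  have "mat_adjoint (mat_adjoint U * W) = mat_adjoint W * U"
    using mat_adjoint_mult[OF mat_adjoint_carrier[OF U] W] by simp
  then show ?thesis
    unfolding udiag_def Ad_def
    using mat_adjoint_carrier[OF U] mat_adjoint_carrier[OF W] U W mat_diag_carrier[of d g]
    by (smt (verit) assoc_mult_mat mult_carrier_mat)
qed

lemma diagonalized_by_iff:
  assumes \<Phi>: "\<And>X. X \<in> carrier_mat d1 d1 \<Longrightarrow> \<Phi> X \<in> carrier_mat d2 d2"
  shows "diagonalized_by d1 d2 \<Phi> u W \<longleftrightarrow> unitary_mat d2 W \<and>
    (\<forall>k<d2. u k \<in> carrier_vec d1 \<and> cinner (u k) (u k) = 1) \<and>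
    (\<forall>X\<in>carrier_mat d1 d1. \<Phi> X = udiag d2 W (\<lambda>k. vec_state (u k) X))"
proof -
  have "\<Phi> X * W = W * mat_diag d2 g \<longleftrightarrow> \<Phi> X = udiag d2 W g"
    if W: "unitary_mat d2 W" and X: "X \<in> carrier_mat d1 d1" for X g
  proof
    note w = unitary_matD[OF W]
    assume "\<Phi> X * W = W * mat_diag d2 g"
    then have "udiag d2 W g = \<Phi> X * W * mat_adjoint W" by (simp add: udiag_def)
    also have "\<dots> = \<Phi> X * (W * mat_adjoint W)" by (rule assoc_mult_mat[OF \<Phi>[OF X] w(1,2)])
    also have "\<dots> = \<Phi> X" using w \<Phi>[OF X] by simp
    finally show "\<Phi> X = udiag d2 W g" by simp
  next
    note w = unitary_matD[OF W]
    assume "\<Phi> X = udiag d2 W g"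
    then have "\<Phi> X * W = W * mat_diag d2 g * mat_adjoint W * W" by (simp add: udiag_def)
    also have "\<dots> = W * mat_diag d2 g * (mat_adjoint W * W)"
      by (rule assoc_mult_mat[OF mult_carrier_mat[OF w(1) mat_diag_carrier] w(2,1)])
    also have "\<dots> = W * mat_diag d2 g"
      unfolding w(3) by (rule right_mult_one_mat[OF mult_carrier_mat[OF w(1) mat_diag_carrier]])
    finally show "\<Phi> X * W = W * mat_diag d2 g" .
  qed
  then show ?thesis unfolding diagonalized_by_def by blast
qed

lemma diagonalized_unitarily_equivalent:
  assumes \<Phi>: "\<And>X. X \<in> carrier_mat d1 d1 \<Longrightarrow> \<Phi> X \<in> carrier_mat d2 d2"
    and \<Psi>: "\<And>X. X \<in> carrier_mat d1 d1 \<Longrightarrow> \<Psi> X \<in> carrier_mat d2 d2"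
    and "diagonalized_by d1 d2 \<Phi> u W" "diagonalized_by d1 d2 \<Psi> u W'"
  shows "unitarily_equivalent d1 d2 \<Psi> \<Phi>"
proof -
  have W: "unitary_mat d2 W" and \<Phi>W: "\<And>X. X \<in> carrier_mat d1 d1 \<Longrightarrow> \<Phi> X = udiag d2 W (\<lambda>k.
      vec_state (u k) X)"
    using assms(3) diagonalized_by_iff[OF \<Phi>] by auto
  have W': "unitary_mat d2 W'" and \<Psi>W: "\<And>X. X \<in> carrier_mat d1 d1 \<Longrightarrow> \<Psi> X = udiag d2 W' (\<lambda>k.
      vec_state (u k) X)"
    using assms(4) diagonalized_by_iff[OF \<Psi>] by auto
  note w = unitary_matD[OF W] and w' = unitary_matD[OF W']
  have U: "unitary_mat d2 (W' * mat_adjoint W)"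
    by (intro unitary_mat_mult unitary_mat_adjoint W W')
  have "mat_adjoint (W' * mat_adjoint W) * W' = W * (mat_adjoint W' * W')"
    unfolding mat_adjoint_mult[OF w'(1) w(2)] mat_adjoint_adjoint
    by (rule assoc_mult_mat[OF w(1) w'(2,1)])
  then have "mat_adjoint (W' * mat_adjoint W) * W' = W" using w w' by simp
  then have "\<Phi> X = Ad (W' * mat_adjoint W) (\<Psi> X)" if "X \<in> carrier_mat d1 d1" for X
    using that \<Phi>W \<Psi>W Ad_udiag[OF unitary_matD(1)[OF U] w'(1)] by simp
  then show ?thesis unfolding unitarily_equivalent_def using U by blast
qed

text \<open>When the number of vectors equals the dimension, \<open>\<Sum>\<^sub>k |y\<^sub>k\<rangle>\<langle>y\<^sub>k| = I\<close> makes them an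
  orthonormal basis.\<close>

lemma holevo_square_diagonalized:
  assumes x: "\<And>k. k < d2 \<Longrightarrow> x k \<in> carrier_vec d1 \<and> cinner (x k) (x k) = 1"
    and y: "\<And>k. k < d2 \<Longrightarrow> y k \<in> carrier_vec d2"
    and res: "mat_sum d2 d2 (\<lambda>k. ketbra (y k) (y k)) {..<d2} = 1\<^sub>m d2"
    and \<Phi>: "\<And>X. X \<in> carrier_mat d1 d1 \<Longrightarrow> \<Phi> X = holevo d2 {..<d2} x y X"
  shows "\<exists>W. diagonalized_by d1 d2 \<Phi> x W"
proof -
  define W where "W = mat d2 d2 (\<lambda>(r, k). y k $ r)"
  have W: "W \<in> carrier_mat d2 d2" by (simp add: W_def)
  have col: "col W k = y k" if "k < d2" for k
    using that y[OF that] by (intro eq_vecI) (auto simp: W_def)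
  have "W * mat_adjoint W = mat_sum d2 d2 (\<lambda>k. ketbra (y k) (y k)) {..<d2}"
    unfolding mat_sum_ketbra_cols[OF W, symmetric] by (rule mat_sum_cong) (auto simp: col)
  then have U: "unitary_mat d2 W"
    using res mat_mult_left_right_inverse[OF W mat_adjoint_carrier[OF W]]
    by (intro unitary_matI[OF W]) simp
  have "\<Phi> X = udiag d2 W (\<lambda>k. vec_state (x k) X)" if "X \<in> carrier_mat d1 d1" for X
    unfolding \<Phi>[OF that] holevo_cols[OF W, symmetric] holevo_def
    by (rule mat_sum_cong) (auto simp: col)
  then show ?thesis using U x diagonalized_by_iff[of d1 \<Phi> d2 x W] udiag_carrier[OF W] by auto
qed

lemma diagonalized_holevo:
  assumes \<Phi>: "\<And>X. X \<in> carrier_mat d1 d1 \<Longrightarrow> \<Phi> X \<in> carrier_mat d2 d2"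
    and "diagonalized_by d1 d2 \<Phi> u W" "X \<in> carrier_mat d1 d1"
  shows "\<Phi> X = holevo d2 {..<d2} u (col W) X"
  using assms(2,3) diagonalized_by_iff[OF \<Phi>] holevo_cols[OF unitary_matD(1)] by auto

lemma unitary_orthonormal_basis:
  assumes U: "unitary_mat d W"
  shows "orthonormal_basis d (col W)"
proof -
  note w = unitary_matD[OF U]
  interpret vec_space "TYPE(complex)" d .
  have "det (mat_adjoint W) * det W = 1" using w det_mult[OF w(2,1)] by simp
  then have det: "det W \<noteq> 0" by auto
  have cols: "set (cols W) = col W ` {..<d}" using w(1) by (auto simp: cols_def)
  have inj: "inj_on (col W) {..<d}"
    using unitary_mat_cols[OF U] by (intro inj_onI) (metis lessThan_iff zero_neq_one)
  then have dist: "distinct (cols W)"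
    using w(1) by (simp add: cols_def distinct_map lessThan_atLeast0)
  have "lin_indpt (set (cols W))"
    using full_rank_lin_indpt[OF w(1) low_rank_det_zero[OF w(1) det] dist] .
  moreover have "card (set (cols W)) = d" using distinct_card[OF dist] w(1) by simp
  ultimately have "basis (set (cols W))"
    using w(1) cols_dim[of W] by (intro dim_li_is_basis) (auto simp: dim_is_n)
  then show ?thesis
    unfolding orthonormal_basis_def using unitary_mat_cols[OF U] w(1) cols by auto
qed

lemma diagonalized_iff_orthonormal_basis:
  assumes \<Phi>: "\<And>X. X \<in> carrier_mat d1 d1 \<Longrightarrow> \<Phi> X \<in> carrier_mat d2 d2"
  shows "(\<exists>u W. diagonalized_by d1 d2 \<Phi> u W) \<longleftrightarrow>
    (\<exists>u v. (\<forall>i<d2. u i \<in> carrier_vec d1 \<and> cinner (u i) (u i) = 1) \<and> orthonormal_basis d2 v \<and>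
      (\<forall>X\<in>carrier_mat d1 d1. \<Phi> X = holevo d2 {..<d2} u v X))"
proof safe
  fix u W assume D: "diagonalized_by d1 d2 \<Phi> u W"
  then have "unitary_mat d2 W" "\<forall>i<d2. u i \<in> carrier_vec d1 \<and> cinner (u i) (u i) = 1"
    by (auto simp: diagonalized_by_def)
  then show "\<exists>u v. (\<forall>i<d2. u i \<in> carrier_vec d1 \<and> cinner (u i) (u i) = 1) \<and> orthonormal_basis d2 v \<and>
      (\<forall>X\<in>carrier_mat d1 d1. \<Phi> X = holevo d2 {..<d2} u v X)"
    using unitary_orthonormal_basis diagonalized_holevo[OF \<Phi> D] by blast
next
  fix u v assume u: "\<forall>i<d2. u i \<in> carrier_vec d1 \<and> cinner (u i) (u i) = 1"
    and v: "orthonormal_basis d2 v" and \<Phi>uv: "\<forall>X\<in>carrier_mat d1 d1. \<Phi> X = holevo d2 {..<d2} u v X"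
  define W where "W = mat d2 d2 (\<lambda>(r, k). v k $ r)"
  have W: "W \<in> carrier_mat d2 d2" by (simp add: W_def)
  have vc: "v k \<in> carrier_vec d2" if "k < d2" for k using v that by (simp add:
      orthonormal_basis_def)
  have col: "col W k = v k" if "k < d2" for k
    using that vc[OF that] by (intro eq_vecI) (auto simp: W_def)
  have "mat_adjoint W * W = 1\<^sub>m d2"
    using v mat_adjoint_mult_self_index[OF W] W
    by (intro eq_matI) (auto simp: col orthonormal_basis_def)
  then have "W * mat_adjoint W = 1\<^sub>m d2"
    using mat_mult_left_right_inverse[OF mat_adjoint_carrier[OF W] W] by simp
  then have "mat_sum d2 d2 (\<lambda>k. ketbra (v k) (v k)) {..<d2} = 1\<^sub>m d2"
    unfolding mat_sum_ketbra_cols[OF W, symmetric] by (subst mat_sum_cong) (auto simp: col)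
  then show "\<exists>u W. diagonalized_by d1 d2 \<Phi> u W"
    using holevo_square_diagonalized[of d2 u d1 v \<Phi>] u vc \<Phi>uv by auto
qed

lemma diagonalized_iff_direct_sum:
  assumes d1: "d1 \<ge> 1" and \<Phi>: "\<And>X. X \<in> carrier_mat d1 d1 \<Longrightarrow> \<Phi> X \<in> carrier_mat d2 d2"
  shows "(\<exists>u W. diagonalized_by d1 d2 \<Phi> u W) \<longleftrightarrow>
    (\<exists>\<phi>. (\<forall>i<d2. pure_state d1 (\<phi> i)) \<and>
      unitarily_equivalent d1 d2 \<Phi> (direct_sum_functionals d2 \<phi>))"
proof safe
  fix u W assume D: "diagonalized_by d1 d2 \<Phi> u W"
  then have u: "\<forall>i<d2. u i \<in> carrier_vec d1 \<and> cinner (u i) (u i) = 1"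
    by (simp add: diagonalized_by_def)
  let ?\<phi> = "\<lambda>i. vec_state (u i)"
  have "diagonalized_by d1 d2 (direct_sum_functionals d2 ?\<phi>) u (1\<^sub>m d2)"
    using u by (simp add: diagonalized_by_def direct_sum_functionals_def unitary_mat_def
        left_mult_one_mat[OF mat_diag_carrier] right_mult_one_mat[OF mat_diag_carrier])
  then have "unitarily_equivalent d1 d2 \<Phi> (direct_sum_functionals d2 ?\<phi>)"
    by (intro diagonalized_unitarily_equivalent[OF _ \<Phi> _ D])
      (simp_all add: direct_sum_functionals_def)
  moreover have "pure_state d1 (?\<phi> i)" if "i < d2" for i
    using vec_state_pure[of "u i"] u that d1 by simp
  ultimately show "\<exists>\<phi>. (\<forall>i<d2. pure_state d1 (\<phi> i)) \<and>
      unitarily_equivalent d1 d2 \<Phi> (direct_sum_functionals d2 \<phi>)"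
    by - (rule exI[of _ ?\<phi>], simp)
next
  fix \<phi> assume pure: "\<forall>i<d2. pure_state d1 (\<phi> i)"
    and "unitarily_equivalent d1 d2 \<Phi> (direct_sum_functionals d2 \<phi>)"
  then obtain U where U: "unitary_mat d2 U"
    and eq: "\<And>X. X \<in> carrier_mat d1 d1 \<Longrightarrow> mat_diag d2 (\<lambda>i. \<phi> i X) = Ad U (\<Phi> X)"
    by (auto simp: unitarily_equivalent_def direct_sum_functionals_def)
  have "\<forall>i<d2. \<exists>u. u \<in> carrier_vec d1 \<and> cinner u u = 1 \<and> (\<forall>X\<in>carrier_mat d1 d1. \<phi> i X =
      vec_state u X)"
  proof (intro allI impI)
    fix i assume "i < d2"
    then have "pure_state d1 (\<phi> i)" using pure by simp
    then show "\<exists>u. u \<in> carrier_vec d1 \<and> cinner u u = 1 \<and> (\<forall>X\<in>carrier_mat d1 d1. \<phi> i X =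
        vec_state u X)"
      by (rule pure_state_vec_state[OF d1]) blast
  qed
  then obtain u where u: "\<And>i. i < d2 \<Longrightarrow> u i \<in> carrier_vec d1 \<and> cinner (u i) (u i) = 1"
    and \<phi>: "\<And>i X. i < d2 \<Longrightarrow> X \<in> carrier_mat d1 d1 \<Longrightarrow> \<phi> i X = vec_state (u i) X"
    by metis
  note w = unitary_matD[OF U]
  have "\<Phi> X * U = U * mat_diag d2 (\<lambda>k. vec_state (u k) X)" if X: "X \<in> carrier_mat d1 d1" for X
  proof -
    have "mat_diag d2 (\<lambda>k. vec_state (u k) X) = mat_diag d2 (\<lambda>i. \<phi> i X)"
      using \<phi> X by (auto simp: mat_diag_def)
    then have "U * mat_diag d2 (\<lambda>k. vec_state (u k) X) = U * (mat_adjoint U * \<Phi> X * U)"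
      using eq[OF X] by (simp add: Ad_def)
    also have "\<dots> = (U * mat_adjoint U) * (\<Phi> X * U)"
      using w(1,2) \<Phi>[OF X] by (smt (verit) assoc_mult_mat mult_carrier_mat)
    also have "\<dots> = \<Phi> X * U"
      unfolding w(4) by (rule left_mult_one_mat[OF mult_carrier_mat[OF \<Phi>[OF X] w(1)]])
    finally show ?thesis by simp
  qed
  then show "\<exists>u W. diagonalized_by d1 d2 \<Phi> u W" unfolding diagonalized_by_def using u U by blast
qed

text \<open>The diagonal entries are grouped by equality of their vector states; the projections are
  the sums of the corresponding \<open>|v\<^sub>k\<rangle>\<langle>v\<^sub>k|\<close>.\<close>

lemma diagonalized_imp_state_projections:
  assumes d1: "d1 \<ge> 1" and \<Phi>: "\<And>X. X \<in> carrier_mat d1 d1 \<Longrightarrow> \<Phi> X \<in> carrier_mat d2 d2"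
    and D: "diagonalized_by d1 d2 \<Phi> u W"
  shows "\<exists>n\<le>d2. \<exists>\<phi> P. (\<forall>i<n. pure_state d1 (\<phi> i)) \<and>
    (\<forall>i<n. \<forall>j<n. i \<noteq> j \<longrightarrow> (\<exists>X\<in>carrier_mat d1 d1. \<phi> i X \<noteq> \<phi> j X)) \<and>
    (\<forall>i<n. projection_mat d2 (P i)) \<and>
    (\<forall>i<n. \<forall>j<n. i \<noteq> j \<longrightarrow> P i * P j = 0\<^sub>m d2 d2) \<and>
    mat_sum d2 d2 P {..<n} = 1\<^sub>m d2 \<and>
    (\<forall>X\<in>carrier_mat d1 d1. \<Phi> X = mat_sum d2 d2 (\<lambda>i. \<phi> i X \<cdot>\<^sub>m P i) {..<n})"
proof -
  have U: "unitary_mat d2 W" and u: "\<And>k. k < d2 \<Longrightarrow> u k \<in> carrier_vec d1 \<and> cinner (u k) (u k) = 1"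
    and \<Phi>W: "\<And>X. X \<in> carrier_mat d1 d1 \<Longrightarrow> \<Phi> X = udiag d2 W (\<lambda>k. vec_state (u k) X)"
    using D diagonalized_by_iff[OF \<Phi>] by auto
  note W = unitary_matD(1)[OF U]
  define R where "R k l \<longleftrightarrow> (\<forall>X\<in>carrier_mat d1 d1. vec_state (u k) X = vec_state (u l) X)"
    for k l
  define rep where "rep k = (LEAST l. R k l)" for k
  have Rrep: "R k (rep k)" for k unfolding rep_def by (rule LeastI[of _ k]) (simp add: R_def)
  have rep_eq: "rep k = rep l" if "R k l" for k l
    using that unfolding rep_def R_def by simp
  have rep_less: "rep k < d2" if "k < d2" for k
  proof -
    have "R k k" by (simp add: R_def)
    then show ?thesis using that Least_le[of "R k" k] unfolding rep_def by linarith
  qed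
  define n where "n = card (rep ` {..<d2})"
  obtain h where h: "bij_betw h {..<n} (rep ` {..<d2})"
    using ex_bij_betw_nat_finite[of "rep ` {..<d2}"] by (auto simp: n_def lessThan_atLeast0)
  have n: "n \<le> d2" unfolding n_def using card_image_le[of "{..<d2}" rep] by simp
  have hrep: "\<exists>k<d2. h i = rep k" if "i < n" for i using h that by (auto simp: bij_betw_def)
  have repsum: "(\<Sum>i<n. f i * (if rep k = h i then 1 else 0)) = g k"
    if "k < d2" "\<And>i. i < n \<Longrightarrow> rep k = h i \<Longrightarrow> f i = g k" for k and f g :: "nat \<Rightarrow> complex"
  proof -
    have "rep k \<in> h ` {..<n}" using h that(1) by (auto simp: bij_betw_def)
    then obtain i where i: "i < n" "rep k = h i" by auto
    have "(\<Sum>j<n. f j * (if rep k = h j then 1 else 0)) = (\<Sum>j<n. if j = i then f j else 0)"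
      using h i by (intro sum.cong refl) (auto simp: bij_betw_def inj_on_def)
    then show ?thesis using i that(2) by simp
  qed
  define \<phi> where "\<phi> i = vec_state (u (h i))" for i
  define P where "P i = udiag d2 W (\<lambda>k. if rep k = h i then 1 else 0)" for i
  have hu: "h i < d2" if "i < n" for i using hrep[OF that] rep_less by auto
  have "pure_state d1 (\<phi> i)" if "i < n" for i
    by (rule vec_state_pure[of "u (h i)"]) (use u hu[OF that] d1 in \<open>auto simp: \<phi>_def\<close>)
  moreover have "\<exists>X\<in>carrier_mat d1 d1. \<phi> i X \<noteq> \<phi> j X" if ij: "i < n" "j < n" "i \<noteq> j" for i j
  proof (rule ccontr)
    assume "\<not> ?thesis"
    then have "R (h i) (h j)" by (auto simp: \<phi>_def R_def)
    moreover obtain k where "h i = rep k" using hrep[OF ij(1)] by blast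
    moreover obtain l where "h j = rep l" using hrep[OF ij(2)] by blast
    ultimately have "R k l" using Rrep[of k] Rrep[of l] by (simp add: R_def)
    then have "h i = h j" using rep_eq \<open>h i = rep k\<close> \<open>h j = rep l\<close> by simp
    then show False using h ij by (auto simp: bij_betw_def inj_on_def)
  qed
  moreover have "projection_mat d2 (P i)" for i
    unfolding projection_mat_def P_def mat_adjoint_udiag[OF W] udiag_mult[OF U]
    using W by (auto intro!: arg_cong[of _ _ "udiag d2 W"])
  moreover have "P i * P j = 0\<^sub>m d2 d2" if "i < n" "j < n" "i \<noteq> j" for i j
  proof -
    have "h i \<noteq> h j" using h that by (auto simp: bij_betw_def inj_on_def)
    then show ?thesis
      unfolding P_def udiag_mult[OF U] by (intro eq_matI) (auto simp: udiag_index[OF W]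
          udiag_dim[OF W])
  qed
  moreover have "mat_sum d2 d2 P {..<n} = 1\<^sub>m d2"
  proof -
    have "mat_sum d2 d2 P {..<n} = mat_sum d2 d2 (\<lambda>i. 1 \<cdot>\<^sub>m P i) {..<n}"
      by (intro mat_sum_cong refl eq_matI) auto
    also have "\<dots> = udiag d2 W (\<lambda>_. 1)"
      unfolding P_def mat_sum_udiag[OF W]
      by (rule eq_matI) (use repsum[where f = "\<lambda>_. 1" and g = "\<lambda>_. 1"] in
          \<open>auto simp: udiag_index[OF W] udiag_dim[OF W]\<close>)
    finally show ?thesis using udiag_one[OF U] by simp
  qed
  moreover have "\<Phi> X = mat_sum d2 d2 (\<lambda>i. \<phi> i X \<cdot>\<^sub>m P i) {..<n}" if X: "X \<in> carrier_mat d1 d1" for X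
  proof -
    have "(\<Sum>i<n. \<phi> i X * (if rep k = h i then 1 else 0)) = vec_state (u k) X" if k: "k < d2" for k
    proof (rule repsum[where g = "\<lambda>k. vec_state (u k) X", OF k])
      fix i assume "rep k = h i"
      then show "\<phi> i X = vec_state (u k) X"
        using Rrep[of k] X by (simp add: \<phi>_def R_def)
    qed
    then show ?thesis
      unfolding \<Phi>W[OF X] P_def mat_sum_udiag[OF W]
      by (intro eq_matI) (auto simp: udiag_index[OF W] udiag_dim[OF W])
  qed
  ultimately show ?thesis using n by (intro exI[of _ n] conjI exI[of _ \<phi>] exI[of _ P]) blast+
qed

text \<open>The columns \<open>P\<^sub>i e\<^sub>c\<close> of the projections give a Holevo form of \<open>\<Phi>\<close>.  A basis
  selected from them consists of joint eigenvectors, because columns of different projections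
  are orthogonal.\<close>

lemma state_projections_imp_diagonalized:
  fixes n :: nat
  assumes u: "\<And>i. i < n \<Longrightarrow> u i \<in> carrier_vec d1 \<and> cinner (u i) (u i) = 1"
    and P: "\<And>i. i < n \<Longrightarrow> projection_mat d2 (P i)"
    and orth: "\<And>i j. i < n \<Longrightarrow> j < n \<Longrightarrow> i \<noteq> j \<Longrightarrow> P i * P j = 0\<^sub>m d2 d2"
    and one: "mat_sum d2 d2 P {..<n} = 1\<^sub>m d2"
    and \<Phi>: "\<And>X. X \<in> carrier_mat d1 d1 \<Longrightarrow> \<Phi> X = mat_sum d2 d2 (\<lambda>i. vec_state (u i) X \<cdot>\<^sub>m P i) {..<n}"
  shows "\<exists>u W. diagonalized_by d1 d2 \<Phi> u W"
proof -
  \<comment> \<open>column \<open>c\<close> of \<open>P\<^sub>i\<close> has the number \<open>j = i d\<^sub>2 + c\<close>\<close>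
  define x where "x j = u (j div d2)" for j
  define y where "y j = col (P (j div d2)) (j mod d2)" for j
  have Pc: "P i \<in> carrier_mat d2 d2" "mat_adjoint (P i) = P i" "P i * P i = P i" if "i < n" for i
    using P[OF that] by (auto simp: projection_mat_def)
  have jn: "j div d2 < n" "j mod d2 < d2" if "j < n * d2" for j
  proof -
    have "0 < d2" using that by (cases d2) auto
    then show "j div d2 < n" "j mod d2 < d2" using that by (auto simp: less_mult_imp_div_less)
  qed
  have x: "x j \<in> carrier_vec d1 \<and> cinner (x j) (x j) = 1" if "j < n * d2" for j
    using u jn[OF that] by (simp add: x_def)
  have y: "y j \<in> carrier_vec d2" if "j < n * d2" for j
    unfolding y_def using col_dim[of "P (j div d2)"] carrier_matD(1)[OF Pc(1)[OF jn(1)[OF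
        that]]] by metis
  have split: "(\<Sum>j<n * d2. g (j div d2) * (y j $ r * cnj (y j $ c))) = (\<Sum>i<n. g i * P i $$ (r, c))"
    if rc: "r < d2" "c < d2" for g :: "nat \<Rightarrow> complex" and r c
    unfolding sum_blocks
  proof (rule sum.cong[OF refl])
    fix i assume "i \<in> {..<n}"
    then have i: "i < n" by simp
    have "(P i * mat_adjoint (P i)) $$ (r, c) = (\<Sum>a<d2. P i $$ (r, a) * cnj (P i $$ (c, a)))"
      using Pc(1)[OF i] rc by (simp add: scalar_prod_def lessThan_atLeast0)
    then have "P i $$ (r, c) = (\<Sum>a<d2. P i $$ (r, a) * cnj (P i $$ (c, a)))"
      using Pc[OF i] by simp
    then show "(\<Sum>a<d2. g ((i * d2 + a) div d2) * (y (i * d2 + a) $ r * cnj (y (i * d2 + a) $ c))) =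
        g i * P i $$ (r, c)"
      using Pc(1)[OF i] rc by (simp add: y_def sum_distrib_left)
  qed
  have \<Phi>xy: "\<Phi> X = holevo d2 {..<n * d2} x y X" if X: "X \<in> carrier_mat d1 d1" for X
  proof (rule eq_matI)
    fix r c assume "r < dim_row (holevo d2 {..<n * d2} x y X)" "c < dim_col (holevo d2 {..<n
        * d2} x y X)"
    then have rc: "r < d2" "c < d2" by auto
    have dims: "dim_row (P i) = d2" "dim_col (P i) = d2" if "i < n" for i
      using Pc(1)[OF that] by auto
    have "\<Phi> X $$ (r, c) = (\<Sum>i<n. vec_state (u i) X * P i $$ (r, c))"
      unfolding \<Phi>[OF X] using rc dims by simp
    also have "\<dots> = holevo d2 {..<n * d2} x y X $$ (r, c)"
      using split[OF rc, of "\<lambda>i. vec_state (u i) X"] holevo_index[of "{..<n * d2}" y d2 r c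
          x X] y rc
      by (simp add: x_def)
    finally show "\<Phi> X $$ (r, c) = holevo d2 {..<n * d2} x y X $$ (r, c)" .
  qed (use \<Phi>[OF X] in auto)
  have res: "mat_sum d2 d2 (\<lambda>j. ketbra (y j) (y j)) {..<n * d2} = 1\<^sub>m d2"
  proof -
    have "holevo d2 {..<n * d2} x y (1\<^sub>m d1) = mat_sum d2 d2 P {..<n}"
    proof -
      have "holevo d2 {..<n * d2} x y (1\<^sub>m d1) =
          mat_sum d2 d2 (\<lambda>i. vec_state (u i) (1\<^sub>m d1) \<cdot>\<^sub>m P i) {..<n}"
        using \<Phi>xy[of "1\<^sub>m d1"] \<Phi>[of "1\<^sub>m d1"] by simp
      also have "\<dots> = mat_sum d2 d2 P {..<n}"
        by (intro mat_sum_cong refl eq_matI) (use u in auto)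
      finally show ?thesis .
    qed
    moreover have "holevo d2 {..<n * d2} x y (1\<^sub>m d1) =
        mat_sum d2 d2 (\<lambda>j. ketbra (y j) (y j)) {..<n * d2}"
      by (rule holevo_one) (use x in auto)
    ultimately show ?thesis using one by simp
  qed
  obtain b where b: "\<And>k. k < d2 \<Longrightarrow> b k \<in> {..<n * d2}"
    and det: "det (mat d2 d2 (\<lambda>(r, k). y (b k) $ r)) \<noteq> 0"
    by (rule resolution_contains_basis[OF _ _ res]) (use y in auto)
  have eq: "vec_state (x j) X = vec_state (x (b k)) X"
    if j: "j < n * d2" and k: "k < d2" and "cinner (y j) (col (mat d2 d2 (\<lambda>(r, k). y (b k) $
        r)) k) \<noteq> 0"
    for j k X
  proof -
    have bk: "b k < n * d2" using b[OF k] by simp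
    have "col (mat d2 d2 (\<lambda>(r, k). y (b k) $ r)) k = y (b k)"
      using k y[OF bk] by (intro eq_vecI) auto
    then have nz: "cinner (y j) (y (b k)) \<noteq> 0" using that by simp
    let ?P = "P (j div d2)" and ?Q = "P (b k div d2)"
    note p = Pc[OF jn(1)[OF j]] and q = Pc[OF jn(1)[OF bk]]
    have "cinner (y j) (y (b k)) = (mat_adjoint ?P * ?Q) $$ (j mod d2, b k mod d2)"
      unfolding cinner_eq_sum[OF y[OF j] y[OF bk]]
      using p(1) q(1) jn[OF j] jn[OF bk] by (simp add: y_def scalar_prod_def lessThan_atLeast0)
    then have "(?P * ?Q) $$ (j mod d2, b k mod d2) \<noteq> 0" using nz p(2) by simp
    then have "j div d2 = b k div d2" 
      using orth[OF jn(1)[OF j] jn(1)[OF bk]] index_zero_mat(1)[OF jn(2)[OF j] jn(2)[OF bk]]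
          by force
    then show ?thesis by (simp add: x_def)
  qed
  have "\<exists>W. diagonalized_by d1 d2 \<Phi> (\<lambda>k. x (b k)) W"
    by (rule holevo_diagonalized[where J = "{..<n * d2}" and Z = "mat d2 d2 (\<lambda>(r, k). y (b k) $ r)",
          OF _ res \<Phi>xy]) (use x y b det eq in auto)
  then show ?thesis by blast
qed

lemma diagonalized_iff_state_projections:
  assumes d1: "d1 \<ge> 1" and \<Phi>: "\<And>X. X \<in> carrier_mat d1 d1 \<Longrightarrow> \<Phi> X \<in> carrier_mat d2 d2"
  shows "(\<exists>u W. diagonalized_by d1 d2 \<Phi> u W) \<longleftrightarrow>
    (\<exists>n\<le>d2. \<exists>\<phi> P. (\<forall>i<n. pure_state d1 (\<phi> i)) \<and>
    (\<forall>i<n. \<forall>j<n. i \<noteq> j \<longrightarrow> (\<exists>X\<in>carrier_mat d1 d1. \<phi> i X \<noteq> \<phi> j X)) \<and>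
    (\<forall>i<n. projection_mat d2 (P i)) \<and>
    (\<forall>i<n. \<forall>j<n. i \<noteq> j \<longrightarrow> P i * P j = 0\<^sub>m d2 d2) \<and>
    mat_sum d2 d2 P {..<n} = 1\<^sub>m d2 \<and>
    (\<forall>X\<in>carrier_mat d1 d1. \<Phi> X = mat_sum d2 d2 (\<lambda>i. \<phi> i X \<cdot>\<^sub>m P i) {..<n}))"
    (is "?D \<longleftrightarrow> ?P")
proof
  assume ?D
  then obtain u W where "diagonalized_by d1 d2 \<Phi> u W" by blast
  with d1 \<Phi> show ?P by (rule diagonalized_imp_state_projections)
next
  assume ?P
  then show ?D
  proof (elim exE conjE)
    fix n :: nat and \<phi> P
    assume pure: "\<forall>i<n. pure_state d1 (\<phi> i)" and P: "\<forall>i<n. projection_mat d2 (P i)"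
      and orth: "\<forall>i<n. \<forall>j<n. i \<noteq> j \<longrightarrow> P i * P j = 0\<^sub>m d2 d2"
      and one: "mat_sum d2 d2 P {..<n} = 1\<^sub>m d2"
      and \<Phi>P: "\<forall>X\<in>carrier_mat d1 d1. \<Phi> X = mat_sum d2 d2 (\<lambda>i. \<phi> i X \<cdot>\<^sub>m P i) {..<n}"
    have "\<forall>i<n. \<exists>u. u \<in> carrier_vec d1 \<and> cinner u u = 1 \<and> (\<forall>X\<in>carrier_mat d1 d1. \<phi> i X =
        vec_state u X)"
    proof (intro allI impI)
      fix i assume "i < n"
      then have "pure_state d1 (\<phi> i)" using pure by simp
      then show "\<exists>u. u \<in> carrier_vec d1 \<and> cinner u u = 1 \<and> (\<forall>X\<in>carrier_mat d1 d1. \<phi> i X =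
          vec_state u X)"
        by (rule pure_state_vec_state[OF d1]) blast
    qed
    then obtain u where u: "\<And>i. i < n \<Longrightarrow> u i \<in> carrier_vec d1 \<and> cinner (u i) (u i) = 1"
      and \<phi>: "\<And>i X. i < n \<Longrightarrow> X \<in> carrier_mat d1 d1 \<Longrightarrow> \<phi> i X = vec_state (u i) X"
      by metis
    show ?D
    proof (rule state_projections_imp_diagonalized[where n = n and u = u and P = P])
      fix X :: "complex mat" assume X: "X \<in> carrier_mat d1 d1"
      show "\<Phi> X = mat_sum d2 d2 (\<lambda>i. vec_state (u i) X \<cdot>\<^sub>m P i) {..<n}"
        unfolding \<Phi>P[rule_format, OF X] by (rule mat_sum_cong) (use \<phi> X in auto)
    qed (use u P orth one in auto)
  qed
qed

section \<open>C*-extreme points and diagonal maps\<close>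

lemma UEB_linear: "\<Phi> \<in> UEB d1 d2 \<Longrightarrow> linear_mat_map d1 d2 \<Phi>"
  by (simp add: UEB_def entanglement_breaking_def completely_positive_def)

lemma UEB_carrier: "\<Phi> \<in> UEB d1 d2 \<Longrightarrow> X \<in> carrier_mat d1 d1 \<Longrightarrow> \<Phi> X \<in> carrier_mat d2 d2"
  using UEB_linear by (simp add: linear_mat_map_def)

lemma UEB_holevo:
  assumes "d1 \<ge> 1" "\<Phi> \<in> UEB d1 d2"
  obtains m :: nat and x y where
    "\<And>j. j < m \<Longrightarrow> x j \<in> carrier_vec d1 \<and> cinner (x j) (x j) = 1"
    "\<And>j. j < m \<Longrightarrow> y j \<in> carrier_vec d2 \<and> y j \<noteq> 0\<^sub>v d2"
    "\<And>X. X \<in> carrier_mat d1 d1 \<Longrightarrow> \<Phi> X = holevo d2 {..<m} x y X"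
    "mat_sum d2 d2 (\<lambda>j. ketbra (y j) (y j)) {..<m} = 1\<^sub>m d2"
proof -
  have EB: "entanglement_breaking d1 d2 \<Phi>" and one: "\<Phi> (1\<^sub>m d1) = 1\<^sub>m d2"
    using assms(2) by (auto simp: UEB_def)
  obtain m :: nat and x y where x: "\<And>j. j < m \<Longrightarrow> x j \<in> carrier_vec d1 \<and> cinner (x j) (x j) = 1"
    and y: "\<And>j. j < m \<Longrightarrow> y j \<in> carrier_vec d2 \<and> y j \<noteq> 0\<^sub>v d2"
    and \<Phi>: "\<And>X. X \<in> carrier_mat d1 d1 \<Longrightarrow> \<Phi> X = holevo d2 {..<m} x y X"
    by (rule entanglement_breaking_holevo[OF assms(1) EB]) blast
  have "holevo d2 {..<m} x y (1\<^sub>m d1) = mat_sum d2 d2 (\<lambda>j. ketbra (y j) (y j)) {..<m}"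
    by (rule holevo_one) (use x in auto)
  then have "mat_sum d2 d2 (\<lambda>j. ketbra (y j) (y j)) {..<m} = 1\<^sub>m d2"
    using one \<Phi>[of "1\<^sub>m d1"] by simp
  then show ?thesis using that x y \<Phi> by blast
qed

lemma holevo_UEB:
  assumes "finite J" "\<And>j. j \<in> J \<Longrightarrow> x j \<in> carrier_vec d1" "\<And>j. j \<in> J \<Longrightarrow> y j \<in> carrier_vec d2"
    and "holevo d2 J x y (1\<^sub>m d1) = 1\<^sub>m d2"
  shows "holevo d2 J x y \<in> UEB d1 d2"
  using holevo_entanglement_breaking[OF assms(1), of d1 "holevo d2 J x y" d2 x y] assms
  by (simp add: UEB_def)

lemma holevo_ketbra_form:
  assumes "\<And>j. j \<in> J \<Longrightarrow> x j \<in> carrier_vec d1" "\<And>j. j \<in> J \<Longrightarrow> y j \<in> carrier_vec d2"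
    and "a \<in> carrier_vec d1" "z \<in> carrier_vec d2"
  shows "cinner z (holevo d2 J x y (ketbra a a) *\<^sub>v z) =
    of_real (\<Sum>j\<in>J. (cmod (cinner (x j) a))\<^sup>2 * (cmod (cinner (y j) z))\<^sup>2)"
proof -
  have "cinner z (holevo d2 J x y (ketbra a a) *\<^sub>v z) =
      (\<Sum>j\<in>J. vec_state (x j) (ketbra a a) * (cinner z (y j) * cinner (y j) z))"
    by (rule cinner_holevo) (use assms in auto)
  also have "\<dots> = (\<Sum>j\<in>J. of_real ((cmod (cinner (x j) a))\<^sup>2 * (cmod (cinner (y j) z))\<^sup>2))"
  proof (rule sum.cong[OF refl])
    fix j assume j: "j \<in> J"
    have "vec_state (x j) (ketbra a a) = of_real ((cmod (cinner (x j) a))\<^sup>2)"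
      using vec_state_ketbra[OF assms(1)[OF j] assms(3)] complex_norm_square by metis
    moreover have "cinner z (y j) * cinner (y j) z = of_real ((cmod (cinner (y j) z))\<^sup>2)"
      using cinner_commute[OF assms(2)[OF j] assms(4)] complex_norm_square by (metis mult.commute)
    ultimately show "vec_state (x j) (ketbra a a) * (cinner z (y j) * cinner (y j) z) =
        of_real ((cmod (cinner (x j) a))\<^sup>2 * (cmod (cinner (y j) z))\<^sup>2)" by simp
  qed
  finally show ?thesis by simp
qed

text \<open>For a vector \<open>v\<^sub>k\<close> with \<open>\<Phi>(X) v\<^sub>k = \<langle>u\<^sub>k, X u\<^sub>k\<rangle> v\<^sub>k\<close> and \<open>a\<close> orthogonal to
  \<open>u\<^sub>k\<close>, the number \<open>\<langle>v\<^sub>k, \<Phi>(|a\<rangle>\<langle>a|) v\<^sub>k\<rangle>\<close> vanishes and is the sum of the nonnegative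
  numbers \<open>\<langle>T\<^sub>i v\<^sub>k, \<Psi>\<^sub>i(|a\<rangle>\<langle>a|) T\<^sub>i v\<^sub>k\<rangle>\<close>.  So in a Holevo form of \<open>\<Psi>\<^sub>i\<close> only vectors
  proportional to \<open>u\<^sub>k\<close> are paired with vectors not orthogonal to \<open>T\<^sub>i v\<^sub>k\<close>, and
  \<open>\<Psi>\<^sub>i\<close> is diagonalized with the same \<open>u\<^sub>k\<close> as \<open>\<Phi>\<close>.\<close>

lemma diagonalized_imp_cstar_extreme:
  assumes d1: "d1 \<ge> 1" and \<Phi>: "\<Phi> \<in> UEB d1 d2" and D: "diagonalized_by d1 d2 \<Phi> u W"
  shows "cstar_extreme_UEB d1 d2 \<Phi>"
  unfolding cstar_extreme_UEB_def
proof (intro conjI allI impI \<Phi>)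
  fix n :: nat and T \<Psi> i
  assume T: "\<forall>i<n. T i \<in> carrier_mat d2 d2 \<and> invertible_mat (T i) \<and> \<Psi> i \<in> UEB d1 d2"
    and comb: "\<forall>X\<in>carrier_mat d1 d1. \<Phi> X = mat_sum d2 d2 (\<lambda>i. Ad (T i) (\<Psi> i X)) {..<n}"
    and i: "i < n"
  note \<Phi>c = UEB_carrier[OF \<Phi>]
  have U: "unitary_mat d2 W" and u: "\<And>k. k < d2 \<Longrightarrow> u k \<in> carrier_vec d1 \<and> cinner (u k) (u k) = 1"
    using D by (auto simp: diagonalized_by_def)
  note w = unitary_matD[OF U]
  have Tc: "T l \<in> carrier_mat d2 d2" and \<Psi>l: "\<Psi> l \<in> UEB d1 d2" if "l < n" for l
    using T that by auto
  obtain m :: nat and x y where x: "\<And>j. j < m \<Longrightarrow> x j \<in> carrier_vec d1 \<and> cinner (x j) (x j) = 1"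
    and y: "\<And>j. j < m \<Longrightarrow> y j \<in> carrier_vec d2 \<and> y j \<noteq> 0\<^sub>v d2"
    and \<Psi>i: "\<And>X. X \<in> carrier_mat d1 d1 \<Longrightarrow> \<Psi> i X = holevo d2 {..<m} x y X"
    and res: "mat_sum d2 d2 (\<lambda>j. ketbra (y j) (y j)) {..<m} = 1\<^sub>m d2"
    by (rule UEB_holevo[OF d1 \<Psi>l[OF i]]) blast
  have nonneg: "0 \<le> cinner z (\<Psi> l (ketbra a a) *\<^sub>v z)"
    if l: "l < n" and a: "a \<in> carrier_vec d1" and z: "z \<in> carrier_vec d2" for l a z
  proof -
    obtain m :: nat and x y where "\<And>j. j < m \<Longrightarrow> x j \<in> carrier_vec d1 \<and> cinner (x j) (x j) = 1"
      and "\<And>j. j < m \<Longrightarrow> y j \<in> carrier_vec d2 \<and> y j \<noteq> 0\<^sub>v d2"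
      and \<Psi>: "\<And>X. X \<in> carrier_mat d1 d1 \<Longrightarrow> \<Psi> l X = holevo d2 {..<m} x y X"
      by (rule UEB_holevo[OF d1 \<Psi>l[OF l]]) blast
    then have "cinner z (holevo d2 {..<m} x y (ketbra a a) *\<^sub>v z) =
        of_real (\<Sum>j<m. (cmod (cinner (x j) a))\<^sup>2 * (cmod (cinner (y j) z))\<^sup>2)"
      by (intro holevo_ketbra_form) (use a z in auto)
    moreover have "0 \<le> (\<Sum>j<m. (cmod (cinner (x j) a))\<^sup>2 * (cmod (cinner (y j) z))\<^sup>2)"
      by (rule sum_nonneg) simp
    ultimately show ?thesis using \<Psi>[of "ketbra a a"] a by (simp add: less_eq_complex_def)
  qed
  define Z where "Z = T i * W"
  have Z: "Z \<in> carrier_mat d2 d2" using Tc[OF i] w(1) by (simp add: Z_def)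
  have "det (T i) \<noteq> 0" using T i invertible_mat_iff_det Tc by blast
  moreover have "det W \<noteq> 0" using w(3) det_mult[OF w(2,1)] by auto
  ultimately have detZ: "det Z \<noteq> 0" using det_mult[OF Tc[OF i] w(1)] by (simp add: Z_def)
  have eq: "vec_state (x j) X = vec_state (u k) X"
    if j: "j < m" and k: "k < d2" and nz: "cinner (y j) (col Z k) \<noteq> 0" and X: "X \<in>
        carrier_mat d1 d1"
    for j k X
  proof (rule vec_state_eqI[OF _ _ _ _ _ X])
    let ?a = "x j - cinner (u k) (x j) \<cdot>\<^sub>v u k" and ?v = "col W k"
    have a: "?a \<in> carrier_vec d1" "cinner (u k) ?a = 0"
      using orthogonal_part[of "u k" d1 "x j"] u[OF k] x[OF j] by auto
    have K: "ketbra ?a ?a \<in> carrier_mat d1 d1" using a(1) by simp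
    have v: "?v \<in> carrier_vec d2" using w(1) k by auto
    have Tv: "T l *\<^sub>v ?v \<in> carrier_vec d2" if "l < n" for l using Tc[OF that] v by simp
    define q where "q l = cinner (T l *\<^sub>v ?v) (\<Psi> l (ketbra ?a ?a) *\<^sub>v (T l *\<^sub>v ?v))" for l
    have "cinner ?v (\<Phi> (ketbra ?a ?a) *\<^sub>v ?v) = 0"
    proof -
      have "\<Phi> (ketbra ?a ?a) = holevo d2 {..<d2} u (col W) (ketbra ?a ?a)"
        by (rule diagonalized_holevo[OF _ D K]) (rule \<Phi>c)
      then have "cinner ?v (\<Phi> (ketbra ?a ?a) *\<^sub>v ?v) =
          cinner ?v (holevo d2 {..<d2} u (col W) (ketbra ?a ?a) *\<^sub>v ?v)" by simp
      also have "\<dots> =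
          (\<Sum>l<d2. vec_state (u l) (ketbra ?a ?a) * (cinner ?v (col W l) * cinner (col W l) ?v))"
        by (rule cinner_holevo) (use w(1) v in auto)
      also have "\<dots> = (\<Sum>l<d2. if l = k then vec_state (u k) (ketbra ?a ?a) else 0)"
        by (intro sum.cong refl) (use unitary_mat_cols[OF U] k in auto)
      also have "\<dots> = 0" using k vec_state_ketbra[of "u k" d1 ?a] u[OF k] a by simp
      finally show ?thesis .
    qed
    moreover have "cinner ?v (\<Phi> (ketbra ?a ?a) *\<^sub>v ?v) = (\<Sum>l<n. q l)"
    proof -
      have "cinner ?v (\<Phi> (ketbra ?a ?a) *\<^sub>v ?v) =
          (\<Sum>l<n. cinner ?v (Ad (T l) (\<Psi> l (ketbra ?a ?a)) *\<^sub>v ?v))"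
        unfolding comb[rule_format, OF K]
        by (rule cinner_mat_sum) (use v Ad_carrier[OF Tc UEB_carrier[OF \<Psi>l K]] in auto)
      also have "\<dots> = (\<Sum>l<n. q l)"
        unfolding q_def by (intro sum.cong refl cinner_Ad[OF Tc UEB_carrier[OF \<Psi>l K] v v]) auto
      finally show ?thesis .
    qed
    moreover have "0 \<le> q l" if "l < n" for l unfolding q_def by (rule nonneg[OF that a(1)
        Tv[OF that]])
    ultimately have "q i = 0" using i sum_nonneg_eq_0_iff[of "{..<n}" q] by auto
    moreover have "T i *\<^sub>v ?v = col Z k" 
      unfolding Z_def by (rule col_mult2[symmetric, OF Tc[OF i] w(1) k])
    ultimately have "cinner (col Z k) (holevo d2 {..<m} x y (ketbra ?a ?a) *\<^sub>v col Z k) = 0"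
      by (simp add: q_def \<Psi>i[OF K])
    then have "complex_of_real (\<Sum>j<m. (cmod (cinner (x j) ?a))\<^sup>2 * (cmod (cinner (y j) (col
        Z k)))\<^sup>2) = 0"
      by (subst (asm) holevo_ketbra_form[of _ _ d1]) (use x y a(1) Z k in auto)
    then have "(\<Sum>j<m. (cmod (cinner (x j) ?a))\<^sup>2 * (cmod (cinner (y j) (col Z k)))\<^sup>2) = 0"
      by (simp only: of_real_eq_0_iff)
    then have "(cmod (cinner (x j) ?a))\<^sup>2 * (cmod (cinner (y j) (col Z k)))\<^sup>2 = 0"
      using j by (subst (asm) sum_nonneg_eq_0_iff) auto
    then show "cinner (x j) ?a = 0" using nz by simp
  qed (use u[OF k] x[OF j] in auto)
  have "\<exists>W'. diagonalized_by d1 d2 (\<Psi> i) u W'"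
    by (rule holevo_diagonalized[where J = "{..<m}" and Z = Z, OF _ res \<Psi>i])
      (use x y u Z detZ eq in auto)
  then obtain W' where D': "diagonalized_by d1 d2 (\<Psi> i) u W'" ..
  show "unitarily_equivalent d1 d2 (\<Psi> i) \<Phi>"
    by (rule diagonalized_unitarily_equivalent[OF \<Phi>c UEB_carrier[OF \<Psi>l[OF i]] D D'])
qed

lemma Ad_holevo:
  assumes T: "T \<in> carrier_mat d d" and y: "\<And>j. j \<in> J \<Longrightarrow> y j \<in> carrier_vec d"
  shows "Ad T (holevo d J x y X) = holevo d J x (\<lambda>j. mat_adjoint T *\<^sub>v y j) X"
proof (rule mat_eqI_cinner[of _ d])
  have Ty: "mat_adjoint T *\<^sub>v y j \<in> carrier_vec d" if "j \<in> J" for j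
    by (rule mult_mat_vec_carrier[OF mat_adjoint_carrier[OF T] y[OF that]])
  fix z w :: "complex vec" assume z: "z \<in> carrier_vec d" and w: "w \<in> carrier_vec d"
  have Tz: "T *\<^sub>v z \<in> carrier_vec d" "T *\<^sub>v w \<in> carrier_vec d" using T z w by auto
  have "cinner z (Ad T (holevo d J x y X) *\<^sub>v w) = cinner (T *\<^sub>v z) (holevo d J x y X *\<^sub>v (T
      *\<^sub>v w))"
    by (rule cinner_Ad[OF T holevo_carrier z w])
  also have "\<dots> = (\<Sum>j\<in>J. vec_state (x j) X * (cinner (T *\<^sub>v z) (y j) * cinner (y j) (T *\<^sub>v w)))"
    by (rule cinner_holevo) (use y Tz in auto)
  also have "\<dots> = (\<Sum>j\<in>J. vec_state (x j) X *
      (cinner z (mat_adjoint T *\<^sub>v y j) * cinner (mat_adjoint T *\<^sub>v y j) w))"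
  proof (rule sum.cong[OF refl])
    fix j assume j: "j \<in> J"
    have "cinner (y j) (T *\<^sub>v w) = cinner (mat_adjoint T *\<^sub>v y j) w"
      using cinner_mat_adjoint[OF mat_adjoint_carrier[OF T] y[OF j] w] by simp
    then show "vec_state (x j) X * (cinner (T *\<^sub>v z) (y j) * cinner (y j) (T *\<^sub>v w)) =
        vec_state (x j) X * (cinner z (mat_adjoint T *\<^sub>v y j) * cinner (mat_adjoint T *\<^sub>v y j) w)"
      using cinner_mat_adjoint[OF T z y[OF j]] by simp
  qed
  also have "\<dots> = cinner z (holevo d J x (\<lambda>j. mat_adjoint T *\<^sub>v y j) X *\<^sub>v w)"
    by (rule cinner_holevo[symmetric]) (use Ty z w in auto)
  finally show "cinner z (Ad T (holevo d J x y X) *\<^sub>v w) =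
      cinner z (holevo d J x (\<lambda>j. mat_adjoint T *\<^sub>v y j) X *\<^sub>v w)" .
qed (use Ad_carrier[OF T holevo_carrier] in auto)

lemma Ad_one: "T \<in> carrier_mat d d \<Longrightarrow> Ad T (1\<^sub>m d) = mat_adjoint T * T"
  unfolding Ad_def using right_mult_one_mat[OF mat_adjoint_carrier] by simp

text \<open>Let \<open>y\<^bsub>b 0\<^esub>, \<dots>, y\<^bsub>b (d - 1)\<^esub>\<close> be a basis selected from a Holevo form of \<open>\<Phi>\<close>.
  Half of the corresponding terms of \<open>\<Phi>\<close> form \<open>Ad\<^bsub>T\<^esub> \<circ> \<Psi>\<close> with \<open>\<Psi>\<close> diagonal and
  \<open>T\<close> invertible; keeping the other half in the rest makes the rest of the form
  \<open>Ad\<^bsub>V\<^esub> \<circ> \<Xi>\<close> with \<open>V\<close> invertible as well.  So an extreme \<open>\<Phi>\<close> is unitarily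
  equivalent to the diagonal map \<open>\<Psi>\<close>.\<close>

lemma cstar_extreme_imp_diagonalized:
  assumes d1: "d1 \<ge> 1" and ext: "cstar_extreme_UEB d1 d2 \<Phi>"
  shows "\<exists>u W. diagonalized_by d1 d2 \<Phi> u W"
proof -
  have \<Phi>: "\<Phi> \<in> UEB d1 d2" using ext by (simp add: cstar_extreme_UEB_def)
  obtain m :: nat and x y where x: "\<And>j. j < m \<Longrightarrow> x j \<in> carrier_vec d1 \<and> cinner (x j) (x j) = 1"
    and y': "\<And>j. j < m \<Longrightarrow> y j \<in> carrier_vec d2 \<and> y j \<noteq> 0\<^sub>v d2"
    and \<Phi>xy: "\<And>X. X \<in> carrier_mat d1 d1 \<Longrightarrow> \<Phi> X = holevo d2 {..<m} x y X"
    and res: "mat_sum d2 d2 (\<lambda>j. ketbra (y j) (y j)) {..<m} = 1\<^sub>m d2"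
    by (rule UEB_holevo[OF d1 \<Phi>]) blast
  have y: "y j \<in> carrier_vec d2" if "j < m" for j using y' that by simp
  obtain b where "\<And>k. k < d2 \<Longrightarrow> b k \<in> {..<m}"
    and detY': "det (mat d2 d2 (\<lambda>(r, k). y (b k) $ r)) \<noteq> 0"
    by (rule resolution_contains_basis[OF _ _ res]) (use y in auto)
  then have b: "\<And>k. k < d2 \<Longrightarrow> b k < m" by simp
  define Y where "Y = mat d2 d2 (\<lambda>(r, k). y (b k) $ r)"
  have Y: "Y \<in> carrier_mat d2 d2" and detY: "det Y \<noteq> 0" using detY' by (auto simp: Y_def)
  have colY: "col Y k = y (b k)" if "k < d2" for k
    using that y[OF b[OF that]] by (intro eq_vecI) (auto simp: Y_def)
  have inj: "inj_on b {..<d2}"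
  proof (rule inj_onI, rule ccontr)
    fix k l assume kl: "k \<in> {..<d2}" "l \<in> {..<d2}" "b k = b l" "k \<noteq> l"
    then have "det Y = 0" by (intro det_identical_cols[OF Y, of k l]) (auto simp: colY)
    then show False using detY by simp
  qed
  define S where "S = b ` {..<d2}"
  have Sm: "S \<subseteq> {..<m}" using b by (auto simp: S_def)
  define h where "h = complex_of_real (sqrt (1 / 2))"
  have hh: "h * cnj h = 1 / 2" by (simp add: h_def flip: of_real_mult)
  define c where "c j = (if j \<in> S then h else 1)" for j
  define T where "T = h \<cdot>\<^sub>m mat_adjoint Y"
  have T: "T \<in> carrier_mat d2 d2" using Y by (simp add: T_def)
  have Tadj: "mat_adjoint T = h \<cdot>\<^sub>m Y"
    using Y by (intro eq_matI) (auto simp: T_def h_def)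
  have detT: "det T \<noteq> 0" using det_mat_adjoint_nonzero[OF Y detY] by (simp add: T_def h_def)
  define \<Psi> where "\<Psi> = holevo d2 {..<d2} (\<lambda>k. x (b k)) (col (1\<^sub>m d2))"
  have \<Psi>diag: "\<Psi> X = mat_diag d2 (\<lambda>k. vec_state (x (b k)) X)" for X
    unfolding \<Psi>_def holevo_cols[OF one_carrier_mat] udiag_def
    by (simp add: left_mult_one_mat[OF mat_diag_carrier] right_mult_one_mat[OF mat_diag_carrier])
  have "\<Psi> (1\<^sub>m d1) = 1\<^sub>m d2"
    unfolding \<Psi>diag using x b by (auto simp: mat_diag_def intro!: eq_matI)
  then have \<Psi>U: "\<Psi> \<in> UEB d1 d2"
    unfolding \<Psi>_def by (intro holevo_UEB) (use x b in auto)
  define H where "H = mat_sum d2 d2 (\<lambda>j. ketbra (c j \<cdot>\<^sub>v y j) (c j \<cdot>\<^sub>v y j)) {..<m}"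
  have cy: "c j \<cdot>\<^sub>v y j \<in> carrier_vec d2" if "j < m" for j using y[OF that] by simp
  have H: "psd d2 H" unfolding H_def by (rule psd_mat_sum, rule psd_ketbra) (use cy in auto)
  then have Hc: "H \<in> carrier_mat d2 d2" by (simp add: psd_def)
  have detH: "det H \<noteq> 0"
  proof
    assume "det H = 0"
    then obtain v where v: "v \<in> carrier_vec d2" "v \<noteq> 0\<^sub>v d2" "H *\<^sub>v v = 0\<^sub>v d2"
      using det_0_iff_vec_prod_zero_field[OF Hc] by blast
    define t where "t j = (cmod (cinner (y j) v))\<^sup>2" for j
    have "0 = cinner v (H *\<^sub>v v)" using v by (simp add: cinner_def)
    also have "\<dots> = (\<Sum>j<m. cinner v (ketbra (c j \<cdot>\<^sub>v y j) (c j \<cdot>\<^sub>v y j) *\<^sub>v v))"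
      unfolding H_def by (rule cinner_mat_sum) (use v cy in auto)
    also have "\<dots> = (\<Sum>j<m. of_real ((cmod (c j))\<^sup>2 * t j))"
    proof (rule sum.cong[OF refl])
      fix j assume "j \<in> {..<m}"
      then have j: "j < m" by simp
      have "cinner v (ketbra (c j \<cdot>\<^sub>v y j) (c j \<cdot>\<^sub>v y j) *\<^sub>v v) =
          (c j * cnj (c j)) * (cinner (y j) v * cnj (cinner (y j) v))"
        using y[OF j] v(1)
        by (simp add: ketbra_mult_vec[where d = d2] cinner_smult[where d = d2]
            cinner_commute[of "y j" d2 v] mult_ac)
      then show "cinner v (ketbra (c j \<cdot>\<^sub>v y j) (c j \<cdot>\<^sub>v y j) *\<^sub>v v) = of_real ((cmod (c
          j))\<^sup>2 * t j)"
        unfolding t_def of_real_mult complex_norm_square by simp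
    qed
    also have "\<dots> = complex_of_real (\<Sum>j<m. (cmod (c j))\<^sup>2 * t j)" by simp
    finally have "complex_of_real (\<Sum>j<m. (cmod (c j))\<^sup>2 * t j) = 0" by (rule sym)
    then have "(\<Sum>j<m. (cmod (c j))\<^sup>2 * t j) = 0" by (simp only: of_real_eq_0_iff)
    moreover have "c j \<noteq> 0" for j by (simp add: c_def h_def)
    ultimately have "t j = 0" if "j < m" for j
      using that by (subst (asm) sum_nonneg_eq_0_iff) (auto simp: t_def)
    then have "cinner (y j) v = 0" if "j < m" for j using that by (simp add: t_def)
    then have "cinner v v = 0"
      using cinner_resolution[OF _ res v(1) v(1)] y by simp
    then show False using v by (simp add: cinner_self_eq_0_iff)
  qed
  obtain V where V: "V \<in> carrier_mat d2 d2" "H = mat_adjoint V * V"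
    by (rule psd_factor[OF H, of "\<lambda>_ _. True"]) auto
  have detV: "det V \<noteq> 0"
    using detH det_mult[OF mat_adjoint_carrier[OF V(1)] V(1)] by (auto simp: V(2))
  obtain R where R: "R \<in> carrier_mat d2 d2" "V * R = 1\<^sub>m d2" "R * V = 1\<^sub>m d2"
    by (rule det_nonzero_inverse[OF V(1) detV])
  define \<Xi> where "\<Xi> = holevo d2 {..<m} x (\<lambda>j. mat_adjoint R *\<^sub>v (c j \<cdot>\<^sub>v y j))"
  have \<Xi>R: "\<Xi> X = Ad R (holevo d2 {..<m} x (\<lambda>j. c j \<cdot>\<^sub>v y j) X)" for X
    unfolding \<Xi>_def by (rule Ad_holevo[symmetric, OF R(1)]) (use cy in auto)
  have VR: "mat_adjoint R * mat_adjoint V = 1\<^sub>m d2"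
    using mat_adjoint_mult[OF V(1) R(1)] R(2) by simp
  have "\<Xi> (1\<^sub>m d1) = 1\<^sub>m d2"
  proof -
    have "holevo d2 {..<m} x (\<lambda>j. c j \<cdot>\<^sub>v y j) (1\<^sub>m d1) = H"
      unfolding H_def by (rule holevo_one) (use x in auto)
    then have "\<Xi> (1\<^sub>m d1) = mat_adjoint R * (mat_adjoint V * V) * R"
      by (simp add: \<Xi>R Ad_def V(2))
    also have "\<dots> = (mat_adjoint R * mat_adjoint V) * (V * R)"
      using R(1) V(1) mat_adjoint_carrier[OF R(1)] mat_adjoint_carrier[OF V(1)]
      by (smt (verit) assoc_mult_mat mult_carrier_mat)
    finally show ?thesis by (simp add: VR R(2))
  qed
  moreover have "mat_adjoint R *\<^sub>v (c j \<cdot>\<^sub>v y j) \<in> carrier_vec d2" if "j < m" for j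
    by (rule mult_mat_vec_carrier[OF mat_adjoint_carrier[OF R(1)] cy[OF that]])
  ultimately have \<Xi>U: "\<Xi> \<in> UEB d1 d2"
    unfolding \<Xi>_def by (intro holevo_UEB) (use x in auto)
  have AdV: "Ad V (\<Xi> X) = holevo d2 {..<m} x (\<lambda>j. c j \<cdot>\<^sub>v y j) X" for X
  proof -
    let ?B = "holevo d2 {..<m} x (\<lambda>j. c j \<cdot>\<^sub>v y j) X"
    have VR': "mat_adjoint V * mat_adjoint R = 1\<^sub>m d2"
      using mat_adjoint_mult[OF R(1) V(1)] R(3) by simp
    have "Ad V (\<Xi> X) = (mat_adjoint V * mat_adjoint R) * ?B * (R * V)"
      unfolding \<Xi>R Ad_def
      using R(1) V(1) mat_adjoint_carrier[OF R(1)] mat_adjoint_carrier[OF V(1)]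
        holevo_carrier[of d2 "{..<m}" x "\<lambda>j. c j \<cdot>\<^sub>v y j" X]
      by (smt (verit) assoc_mult_mat mult_carrier_mat)
    then show ?thesis
      by (simp add: VR' R(3) left_mult_one_mat[OF holevo_carrier] right_mult_one_mat[OF
          holevo_carrier])
  qed
  have split: "\<Phi> X = Ad T (\<Psi> X) + Ad V (\<Xi> X)" if X: "X \<in> carrier_mat d1 d1" for X
  proof (rule eq_matI)
    fix r s assume "r < dim_row (Ad T (\<Psi> X) + Ad V (\<Xi> X))" "s < dim_col (Ad T (\<Psi> X) + Ad V (\<Xi> X))"
    then have rs: "r < d2" "s < d2" by (auto simp: AdV)
    let ?f = "\<lambda>j. vec_state (x j) X * (y j $ r * cnj (y j $ s))"
    have dims: "dim_vec (y j) = d2" if "j < m" for j using y[OF that] by simp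
    have "Ad T (\<Psi> X) = holevo d2 {..<d2} (\<lambda>k. x (b k)) (\<lambda>k. mat_adjoint T *\<^sub>v col (1\<^sub>m d2) k) X"
      unfolding \<Psi>_def by (rule Ad_holevo[OF T]) auto
    also have "\<dots> $$ (r, s) =
        (\<Sum>k<d2. vec_state (x (b k)) X * ((h * y (b k) $ r) * cnj (h * y (b k) $ s)))"
    proof (subst holevo_index)
      have colT: "(mat_adjoint T *\<^sub>v col (1\<^sub>m d2) k) $ i = h * y (b k) $ i" if "k < d2" "i <
          d2" for k i
      proof -
        have "(mat_adjoint T *\<^sub>v col (1\<^sub>m d2) k) $ i = (mat_adjoint T * 1\<^sub>m d2) $$ (i, k)"
          using T that by simp
        also have "\<dots> = h * Y $$ (i, k)"
          using right_mult_one_mat[OF mat_adjoint_carrier[OF T]] Y that by (simp add: Tadj)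
        finally show ?thesis using that by (simp add: Y_def)
      qed
      show "(\<Sum>j<d2. vec_state (x (b j)) X *
          ((mat_adjoint T *\<^sub>v col (1\<^sub>m d2) j) $ r * cnj ((mat_adjoint T *\<^sub>v col (1\<^sub>m d2) j) $ s))) =
          (\<Sum>k<d2. vec_state (x (b k)) X * ((h * y (b k) $ r) * cnj (h * y (b k) $ s)))"
        by (intro sum.cong refl) (use rs colT in auto)
      show "mat_adjoint T *\<^sub>v col (1\<^sub>m d2) j \<in> carrier_vec d2" for j
        by (rule mult_mat_vec_carrier[OF mat_adjoint_carrier[OF T]]) (metis col_dim
            index_one_mat(2))
    qed (use rs in auto)
    also have "\<dots> = (\<Sum>k<d2. (h * cnj h) * ?f (b k))" by (simp add: mult_ac)
    also have "\<dots> = (\<Sum>j\<in>S. (h * cnj h) * ?f j)"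
      unfolding S_def by (rule sum.reindex[OF inj, symmetric, unfolded o_def])
    also have "\<dots> = (\<Sum>j<m. if j \<in> S then 1 / 2 * ?f j else 0)"
      using Sm by (simp add: hh sum.If_cases Int_absorb1)
    finally have 1: "Ad T (\<Psi> X) $$ (r, s) = (\<Sum>j<m. if j \<in> S then 1 / 2 * ?f j else 0)" .
    have "Ad V (\<Xi> X) $$ (r, s) = (\<Sum>j<m. vec_state (x j) X * ((c j \<cdot>\<^sub>v y j) $ r * cnj ((c j
        \<cdot>\<^sub>v y j) $ s)))"
      unfolding AdV by (rule holevo_index) (use cy rs in auto)
    also have "\<dots> = (\<Sum>j<m. (c j * cnj (c j)) * ?f j)"
      by (intro sum.cong refl) (use dims rs in auto)
    also have "\<dots> = (\<Sum>j<m. if j \<in> S then 1 / 2 * ?f j else ?f j)"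
      by (intro sum.cong refl) (simp add: c_def hh)
    finally have "Ad T (\<Psi> X) $$ (r, s) + Ad V (\<Xi> X) $$ (r, s) =
        (\<Sum>j<m. (if j \<in> S then 1 / 2 * ?f j else 0) + (if j \<in> S then 1 / 2 * ?f j else ?f j))"
      unfolding 1 by (simp only: sum.distrib)
    also have "\<dots> = (\<Sum>j<m. ?f j)" by (intro sum.cong refl) auto
    also have "\<dots> = \<Phi> X $$ (r, s)"
      unfolding \<Phi>xy[OF X] by (rule holevo_index[symmetric]) (use y rs in auto)
    finally show "\<Phi> X $$ (r, s) = (Ad T (\<Psi> X) + Ad V (\<Xi> X)) $$ (r, s)"
      using rs by (simp add: AdV)
  qed (simp_all add: AdV \<Phi>xy[OF X])
  define TT where "TT i = (if i = 0 then T else V)" for i :: nat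
  define PP where "PP i = (if i = 0 then \<Psi> else \<Xi>)" for i :: nat
  have two: "{..<2::nat} = {0, 1}" by auto
  have AdT: "Ad T (\<Psi> X) \<in> carrier_mat d2 d2" if "X \<in> carrier_mat d1 d1" for X
    using Ad_carrier[OF T UEB_carrier[OF \<Psi>U that]] .
  have sum: "\<Phi> X = mat_sum d2 d2 (\<lambda>i. Ad (TT i) (PP i X)) {..<2}" if X: "X \<in> carrier_mat d1
      d1" for X
    unfolding split[OF X] two using AdT[OF X]
    by (intro eq_matI) (auto simp: TT_def PP_def AdV)
  moreover have "mat_sum d2 d2 (\<lambda>i. mat_adjoint (TT i) * TT i) {..<2} = 1\<^sub>m d2"
  proof -
    have "mat_sum d2 d2 (\<lambda>i. mat_adjoint (TT i) * TT i) {..<2} =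
        mat_sum d2 d2 (\<lambda>i. Ad (TT i) (PP i (1\<^sub>m d1))) {..<2}"
      by (rule mat_sum_cong) (use \<Psi>U \<Xi>U T V(1) Ad_one in \<open>auto simp: TT_def PP_def UEB_def\<close>)
    also have "\<dots> = 1\<^sub>m d2" using sum[of "1\<^sub>m d1"] \<Phi> by (simp add: UEB_def)
    finally show ?thesis .
  qed
  moreover have "TT i \<in> carrier_mat d2 d2 \<and> invertible_mat (TT i) \<and> PP i \<in> UEB d1 d2" for i
    using T V(1) detT detV \<Psi>U \<Xi>U by (auto simp: TT_def PP_def invertible_mat_iff_det[where n = d2])
  ultimately have "\<forall>i<2. unitarily_equivalent d1 d2 (PP i) \<Phi>"
    using ext unfolding cstar_extreme_UEB_def by blast
  then have "unitarily_equivalent d1 d2 (PP 0) \<Phi>" by simp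
  then have "unitarily_equivalent d1 d2 \<Psi> \<Phi>" by (simp add: PP_def)
  then obtain U where U: "unitary_mat d2 U"
    and eq: "\<And>X. X \<in> carrier_mat d1 d1 \<Longrightarrow> \<Phi> X = Ad U (\<Psi> X)"
    by (auto simp: unitarily_equivalent_def)
  have "\<Phi> X = udiag d2 (mat_adjoint U) (\<lambda>k. vec_state (x (b k)) X)" if X: "X \<in> carrier_mat
      d1 d1" for X
    unfolding eq[OF X] \<Psi>diag Ad_def udiag_def by simp
  then have "diagonalized_by d1 d2 \<Phi> (\<lambda>k. x (b k)) (mat_adjoint U)"
    using diagonalized_by_iff[of d1 \<Phi> d2 "\<lambda>k. x (b k)" "mat_adjoint U"] UEB_carrier[OF \<Phi>]
      unitary_mat_adjoint[OF U] x b by simp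
  then show ?thesis by blast
qed

section \<open>Maps whose Choi rank is the dimension\<close>

lemma (in vec_space) rank_one_product_entries:
  assumes A: "A \<in> carrier_mat n nc" and rank: "rank A = 1"
  obtains f g where "\<And>r c. r < n \<Longrightarrow> c < nc \<Longrightarrow> A $$ (r, c) = f r * g c"
proof -
  let ?P = "\<lambda>T. T \<subseteq> set (cols A) \<and> lin_indpt T"
  have colsc: "set (cols A) \<subseteq> carrier_vec n" using cols_dim[of A] A by auto
  have "lin_indpt {}" unfolding lin_dep_def by auto
  then obtain S where S: "maximal S ?P"
    using maximal_exists_superset[of "set (cols A)" ?P "{}"] by auto
  then have "card S = 1" using rank_card_indpt[OF A S] rank by simp
  then obtain s where s: "S = {s}" by (auto simp: card_1_singleton_iff)
  have li: "lin_indpt {s}" and sc: "s \<in> carrier_vec n"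
    using S colsc by (auto simp: maximal_def s)
  have "\<exists>a. col A c = a \<cdot>\<^sub>v s" if c: "c < nc" for c
  proof (cases "col A c = s")
    case True
    then show ?thesis using sc by (intro exI[of _ 1]) auto
  next
    case False
    have colc: "col A c \<in> set (cols A)" using A c by (auto simp: cols_def)
    have "\<not> lin_indpt ({s} \<union> {col A c})"
    proof
      assume "lin_indpt ({s} \<union> {col A c})"
      then have "?P ({s} \<union> {col A c})" using S colc by (auto simp: maximal_def s)
      moreover have "S \<subseteq> {s} \<union> {col A c}" by (auto simp: s)
      ultimately have "S = {s} \<union> {col A c}" using S unfolding maximal_def by blast
      then show False using False by (auto simp: s)
    qed
    then have "col A c \<in> span {s}"
      using lin_dep_iff_in_span[of "{s}" "col A c"] li sc colc colsc False by auto
    then obtain a where "col A c = lincomb a {s}"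
      using finite_in_span[of "{s}"] sc by (metis empty_subsetI finite.emptyI finite.insertI
          insert_subset)
    then show ?thesis using sc by (auto simp: lincomb_def finsum_vec_def)
  qed
  then obtain g where g: "\<And>c. c < nc \<Longrightarrow> col A c = g c \<cdot>\<^sub>v s" by metis
  show ?thesis
  proof (rule that[of "\<lambda>r. s $ r" g])
    fix r c assume rc: "r < n" "c < nc"
    have "A $$ (r, c) = col A c $ r" using A rc by simp
    also have "\<dots> = s $ r * g c" using g[OF rc(2)] sc rc by simp
    finally show "A $$ (r, c) = s $ r * g c" .
  qed
qed

lemma (in vec_space) rank_product_entries:
  assumes A: "A \<in> carrier_mat n nc"
    and fg: "\<And>r c. r < n \<Longrightarrow> c < nc \<Longrightarrow> A $$ (r, c) = f r * g c"
    and nz: "A \<noteq> 0\<^sub>m n nc"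
  shows "rank A = 1"
proof -
  have "rank A \<le> 1" by (rule rank_le_1_product_entries[OF A, of f g]) (use A fg in auto)
  moreover have "rank A \<ge> 1"
  proof -
    obtain r c where rc: "r < n" "c < nc" "A $$ (r, c) \<noteq> 0"
      using nz A by (metis carrier_matD eq_matI index_zero_mat)
    let ?v = "col A c"
    have v: "?v \<in> carrier_vec n" "?v \<in> set (cols A)" using A rc by (auto simp: cols_def)
    have "?v \<noteq> 0\<^sub>v n"
    proof
      assume "?v = 0\<^sub>v n"
      then have "?v $ r = 0" using rc by simp
      then show False using A rc by simp
    qed
    moreover have "lin_indpt {}" unfolding lin_dep_def by auto
    ultimately have "lin_indpt ({} \<union> {?v})"
      using lin_dep_iff_in_span[of "{}" ?v] v(1) by (auto simp: span_empty)
    then show ?thesis using rank_ge_card_indpt[OF A, of "{?v}"] v(2) by simp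
  qed
  ultimately show ?thesis by simp
qed

lemma rank_ketbra:
  assumes x: "x \<in> carrier_vec d1" "x \<noteq> 0\<^sub>v d1" and y: "y \<in> carrier_vec d2" "y \<noteq> 0\<^sub>v d2"
  shows "vec_space.rank d1 (ketbra x y) = 1"
proof (rule vec_space.rank_product_entries[where f = "\<lambda>r. x $ r" and g = "\<lambda>c. cnj (y $ c)"])
  show "ketbra x y \<noteq> 0\<^sub>m d1 d2"
  proof
    assume 0: "ketbra x y = 0\<^sub>m d1 d2"
    obtain i j where ij: "i < d1" "x $ i \<noteq> 0" "j < d2" "y $ j \<noteq> 0"
      using x y by (metis carrier_vecD eq_vecI index_zero_vec)
    then have "ketbra x y $$ (i, j) \<noteq> 0" using x y by (simp add: ketbra_def)
    then show False using 0 ij by simp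
  qed
qed (use x y in \<open>auto simp: ketbra_def\<close>)

lemma rank_one_ketbra:
  assumes V: "V \<in> carrier_mat d1 d2" and "vec_space.rank d1 V = 1"
  obtains x y where "x \<in> carrier_vec d1" "cinner x x = (1 :: complex)" "y \<in> carrier_vec d2"
      "V = ketbra x y"
proof -
  obtain f g where fg: "\<And>r c. r < d1 \<Longrightarrow> c < d2 \<Longrightarrow> V $$ (r, c) = f r * g c"
    by (rule vec_space.rank_one_product_entries[OF assms]) blast
  have nz: "vec d1 f \<noteq> 0\<^sub>v d1"
  proof
    assume "vec d1 f = 0\<^sub>v d1"
    then have "f r = 0" if "r < d1" for r using that by (metis index_vec index_zero_vec(1))
    then have "V = 0\<^sub>m d1 d2" using V fg by (intro eq_matI) auto
    then show False using assms(2) by (simp add: vec_space.rank_0I)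
  qed
  obtain s :: real where s: "s > 0"
    and unit: "cinner (of_real (1 / s) \<cdot>\<^sub>v vec d1 f) (of_real (1 / s) \<cdot>\<^sub>v vec d1 f) = 1"
    by (rule normalize_vec[OF vec_carrier nz]) blast
  show ?thesis
  proof (rule that[of "of_real (1 / s) \<cdot>\<^sub>v vec d1 f" "vec d2 (\<lambda>c. of_real s * cnj (g c))"])
    show "V = ketbra (of_real (1 / s) \<cdot>\<^sub>v vec d1 f) (vec d2 (\<lambda>c. of_real s * cnj (g c)))"
      using V fg s by (intro eq_matI) (auto simp: ketbra_def)
  qed (use unit in auto)
qed

text \<open>With \<open>V\<^sub>i = |x\<^sub>i\<rangle>\<langle>y\<^sub>i|\<close> and unit vectors \<open>x\<^sub>i\<close>, the value at \<open>I\<close> says that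
  \<open>\<Sum>\<^sub>i |y\<^sub>i\<rangle>\<langle>y\<^sub>i| = I\<close>, a resolution with as many terms as the dimension.\<close>

lemma rank_one_Ad_sum_diagonalized:
  assumes \<Phi>: "\<Phi> \<in> UEB d1 d2" and V: "is_Ad_sum d1 d2 \<Phi> d2 V"
    and rank: "\<forall>i<d2. vec_space.rank d1 (V i) = 1"
  shows "\<exists>u W. diagonalized_by d1 d2 \<Phi> u W"
proof -
  have "\<forall>i<d2. \<exists>x y. x \<in> carrier_vec d1 \<and> cinner x x = 1 \<and> y \<in> carrier_vec d2 \<and> V i = ketbra x y"
  proof (intro allI impI)
    fix i assume "i < d2"
    then have "V i \<in> carrier_mat d1 d2" "vec_space.rank d1 (V i) = 1"
      using V rank by (auto simp: is_Ad_sum_def)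
    then show "\<exists>x y. x \<in> carrier_vec d1 \<and> cinner x x = 1 \<and> y \<in> carrier_vec d2 \<and> V i = ketbra x y"
      by (rule rank_one_ketbra) blast
  qed
  then obtain x y where xy: "\<And>i. i < d2 \<Longrightarrow> x i \<in> carrier_vec d1 \<and> cinner (x i) (x i) = 1"
    "\<And>i. i < d2 \<Longrightarrow> y i \<in> carrier_vec d2" "\<And>i. i < d2 \<Longrightarrow> V i = ketbra (x i) (y i)"
    by metis
  have eq: "\<Phi> X = holevo d2 {..<d2} x y X" if X: "X \<in> carrier_mat d1 d1" for X
  proof -
    have "holevo d2 {..<d2} x y X = mat_sum d2 d2 (\<lambda>j. Ad (ketbra (x j) (y j)) X) {..<d2}"
      by (rule holevo_eq_Ad_sum) (use xy X in auto)
    also have "\<dots> = mat_sum d2 d2 (\<lambda>j. Ad (V j) X) {..<d2}"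
      by (rule mat_sum_cong) (use xy(3) in auto)
    finally show ?thesis using V X by (simp add: is_Ad_sum_def)
  qed
  have "holevo d2 {..<d2} x y (1\<^sub>m d1) = mat_sum d2 d2 (\<lambda>j. ketbra (y j) (y j)) {..<d2}"
    by (rule holevo_one) (use xy in auto)
  then have "mat_sum d2 d2 (\<lambda>j. ketbra (y j) (y j)) {..<d2} = 1\<^sub>m d2"
    using eq[of "1\<^sub>m d1"] \<Phi> by (simp add: UEB_def)
  then show ?thesis using holevo_square_diagonalized[of d2 x d1 y \<Phi>] xy eq by blast
qed

context
  fixes d1 d2 :: nat and \<Phi> :: "complex mat \<Rightarrow> complex mat" and u :: "nat \<Rightarrow> complex vec" and W
      :: "complex mat"
  assumes \<Phi>: "\<Phi> \<in> UEB d1 d2" and D: "diagonalized_by d1 d2 \<Phi> u W"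
begin

private lemma W: "unitary_mat d2 W"
  using D by (simp add: diagonalized_by_def)

private lemma u: "k < d2 \<Longrightarrow> u k \<in> carrier_vec d1 \<and> cinner (u k) (u k) = 1"
  using D by (simp add: diagonalized_by_def)

private lemma colW: "col W k \<in> carrier_vec d2"
  using unitary_matD(1)[OF W] by (metis carrier_matD(1) col_dim)

lemma diagonalized_Ad_sum: "is_Ad_sum d1 d2 \<Phi> d2 (\<lambda>k. ketbra (u k) (col W k))"
  unfolding is_Ad_sum_def
proof (intro conjI allI impI ballI)
  fix X :: "complex mat" assume X: "X \<in> carrier_mat d1 d1"
  have "\<Phi> X = holevo d2 {..<d2} u (col W) X"
    by (rule diagonalized_holevo[OF _ D X]) (rule UEB_carrier[OF \<Phi>])
  also have "\<dots> = mat_sum d2 d2 (\<lambda>k. Ad (ketbra (u k) (col W k)) X) {..<d2}"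
    by (rule holevo_eq_Ad_sum[OF _ X]) (use u colW in auto)
  finally show "\<Phi> X = mat_sum d2 d2 (\<lambda>k. Ad (ketbra (u k) (col W k)) X) {..<d2}" .
qed (use u colW in auto)

lemma diagonalized_rank_one: "k < d2 \<Longrightarrow> vec_space.rank d1 (ketbra (u k) (col W k)) = 1"
proof (rule rank_ketbra)
  assume k: "k < d2"
  have "cinner (col W k) (col W k) = 1" using unitary_mat_cols[OF W k k] by simp
  then show "col W k \<noteq> 0\<^sub>v d2" using cinner_self_eq_0_iff[OF colW] by force
  show "u k \<noteq> 0\<^sub>v d1" using u[OF k] cinner_self_eq_0_iff[of "u k" d1] by force
qed (use u colW in auto)

text \<open>The operators \<open>|u\<^sub>k\<rangle>\<langle>v\<^sub>k|\<close> are independent: the tests with the pairs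
  \<open>u\<^sub>k, v\<^sub>k\<close> separate them.\<close>

lemma diagonalized_Ad_sum_length:
  assumes "is_Ad_sum d1 d2 \<Phi> m V"
  shows "d2 \<le> m"
proof (rule Ad_sum_length_ge[where J = "{..<d2}" and V = "\<lambda>k. ketbra (u k) (col W k)" and a
    = u and z = "col W",
      OF _ _ assms])
  fix c :: "nat \<Rightarrow> complex"
  assume 0: "\<And>j. j \<in> {..<d2} \<Longrightarrow> (\<Sum>k<d2. c k * cinner (u k) (ketbra (u j) (col W j) *\<^sub>v col W k)) = 0"
  show "\<forall>k<d2. c k = 0"
  proof (intro allI impI)
    fix j assume j: "j < d2"
    have "(\<Sum>k<d2. c k * cinner (u k) (ketbra (u j) (col W j) *\<^sub>v col W k)) =
        (\<Sum>k<d2. if k = j then c k else 0)"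
      using unitary_mat_cols[OF W j] u j
      by (intro sum.cong refl)
        (auto simp: ketbra_mult_vec[OF colW colW] cinner_smult[where d = d1])
    then show "c j = 0" using 0[of j] j by simp
  qed
qed (use diagonalized_Ad_sum u colW in \<open>auto simp: is_Ad_sum_def\<close>)

lemma diagonalized_choi_rank: "choi_rank d1 d2 \<Phi> = d2"
  unfolding choi_rank_def
  by (rule Least_equality) (use diagonalized_Ad_sum diagonalized_Ad_sum_length in blast)+

lemma diagonalized_eb_rank: "eb_rank d1 d2 \<Phi> = d2"
  unfolding eb_rank_def
  by (rule Least_equality)
    (use diagonalized_Ad_sum diagonalized_rank_one diagonalized_Ad_sum_length in blast)+

text \<open>A proper subsum of \<open>\<Sum>\<^sub>k |v\<^sub>k\<rangle>\<langle>v\<^sub>k|\<close> kills an omitted \<open>v\<^sub>i\<close>.\<close>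

lemma diagonalized_minimal:
  assumes S: "S \<subseteq> {..<d2}" "card S < d2"
  shows "\<not> invertible_mat (mat_sum d2 d2
    (\<lambda>k. mat_adjoint (ketbra (u k) (col W k)) * ketbra (u k) (col W k)) S)"
proof -
  let ?M = "mat_sum d2 d2 (\<lambda>k. mat_adjoint (ketbra (u k) (col W k)) * ketbra (u k) (col W k)) S"
  obtain i where i: "i < d2" "i \<notin> S"
    using S by (metis card_lessThan lessThan_iff less_irrefl subsetI subset_antisym)
  have M: "?M = mat_sum d2 d2 (\<lambda>k. ketbra (col W k) (col W k)) S"
  proof (rule mat_sum_cong[OF refl])
    fix k assume "k \<in> S"
    then have k: "k < d2" using S by auto
    have K: "ketbra (u k) (col W k) \<in> carrier_mat d1 d2" using u[OF k] colW by simp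
    have "mat_adjoint (ketbra (u k) (col W k)) * ketbra (u k) (col W k) = Ad (ketbra (u k)
        (col W k)) (1\<^sub>m d1)"
      unfolding Ad_def using right_mult_one_mat[OF mat_adjoint_carrier[OF K]] by simp
    also have "\<dots> = vec_state (u k) (1\<^sub>m d1) \<cdot>\<^sub>m ketbra (col W k) (col W k)"
      by (rule Ad_ketbra) (use u[OF k] colW in auto)
    also have "\<dots> = ketbra (col W k) (col W k)" using u[OF k] by (intro eq_matI) auto
    finally show "mat_adjoint (ketbra (u k) (col W k)) * ketbra (u k) (col W k) =
        ketbra (col W k) (col W k)" .
  qed
  have "?M *\<^sub>v col W i = 0\<^sub>v d2"
  proof (rule vec_eqI_cinner[of _ d2])
    fix a :: "complex vec" assume a: "a \<in> carrier_vec d2"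
    have "cinner a (?M *\<^sub>v col W i) = (\<Sum>k\<in>S. cinner a (ketbra (col W k) (col W k) *\<^sub>v col W i))"
      unfolding M by (rule cinner_mat_sum) (use a colW in auto)
    also have "\<dots> = 0"
    proof (rule sum.neutral, rule ballI)
      fix k assume k: "k \<in> S"
      then have "cinner (col W k) (col W i) = 0" using unitary_mat_cols[OF W, of k i] i S by auto
      then show "cinner a (ketbra (col W k) (col W k) *\<^sub>v col W i) = 0"
        using ketbra_mult_vec[OF colW colW] a colW by (simp add: cinner_smult[where d = d2])
    qed
    finally show "cinner a (?M *\<^sub>v col W i) = cinner a (0\<^sub>v d2)" using a by (simp add: cinner_def)
  qed (use colW mult_mat_vec_carrier[OF mat_sum_carrier colW] in auto)
  moreover have "col W i \<noteq> 0\<^sub>v d2"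
    using unitary_mat_cols[OF W i(1) i(1)] cinner_self_eq_0_iff[OF colW] by force
  ultimately have "det ?M = 0"
    using det_0_iff_vec_prod_zero_field[OF mat_sum_carrier] colW by blast
  then show ?thesis using invertible_mat_iff_det[OF mat_sum_carrier] by blast
qed

end

text \<open>Choose a basis \<open>y\<^bsub>b 0\<^esub>, \<dots>, y\<^bsub>b (d - 1)\<^esub>\<close> from a Holevo form, with dual basis
  \<open>z\<^sub>0, \<dots>, z\<^bsub>d - 1\<^esub>\<close>.  If some \<open>y\<^sub>j\<close> not orthogonal to \<open>z\<^sub>k\<close> had an \<open>x\<^sub>j\<close> not
  proportional to \<open>x\<^bsub>b k\<^esub>\<close>, then \<open>|x\<^sub>j\<rangle>\<langle>y\<^sub>j|\<close> would be independent of the \<open>d\<close> independent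
  operators \<open>|x\<^bsub>b l\<^esub>\<rangle>\<langle>y\<^bsub>b l\<^esub>|\<close>, as tested with the pairs \<open>x\<^bsub>b l\<^esub>, z\<^sub>l\<close> and the pair
  \<open>w, z\<^sub>k\<close>, where \<open>w\<close> is the part of \<open>x\<^sub>j\<close> orthogonal to \<open>x\<^bsub>b k\<^esub>\<close>.  So the Choi rank would
  exceed \<open>d\<close>.  Otherwise the \<open>z\<^sub>k\<close> are joint eigenvectors.\<close>

lemma Ad_sum_dimension_diagonalized:
  assumes d1: "d1 \<ge> 1" and \<Phi>: "\<Phi> \<in> UEB d1 d2" and V: "is_Ad_sum d1 d2 \<Phi> d2 V"
  shows "\<exists>u W. diagonalized_by d1 d2 \<Phi> u W"
proof -
  obtain m :: nat and x y where x: "\<And>j. j < m \<Longrightarrow> x j \<in> carrier_vec d1 \<and> cinner (x j) (x j) = 1"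
    and y': "\<And>j. j < m \<Longrightarrow> y j \<in> carrier_vec d2 \<and> y j \<noteq> 0\<^sub>v d2"
    and \<Phi>xy: "\<And>X. X \<in> carrier_mat d1 d1 \<Longrightarrow> \<Phi> X = holevo d2 {..<m} x y X"
    and res: "mat_sum d2 d2 (\<lambda>j. ketbra (y j) (y j)) {..<m} = 1\<^sub>m d2"
    by (rule UEB_holevo[OF d1 \<Phi>]) blast
  have y: "y j \<in> carrier_vec d2" if "j < m" for j using y' that by simp
  obtain b where "\<And>k. k < d2 \<Longrightarrow> b k \<in> {..<m}"
    and detY: "det (mat d2 d2 (\<lambda>(r, k). y (b k) $ r)) \<noteq> 0"
    by (rule resolution_contains_basis[OF _ _ res]) (use y in auto)
  then have b: "\<And>k. k < d2 \<Longrightarrow> b k < m" by simp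
  define Y where "Y = mat d2 d2 (\<lambda>(r, k). y (b k) $ r)"
  have Y: "Y \<in> carrier_mat d2 d2" by (simp add: Y_def)
  have colY: "col Y k = y (b k)" if "k < d2" for k
    using that y[OF b[OF that]] by (intro eq_vecI) (auto simp: Y_def)
  obtain B where B: "B \<in> carrier_mat d2 d2" "B * Y = 1\<^sub>m d2"
    using det_nonzero_inverse[OF Y] detY unfolding Y_def by metis
  define Z where "Z = mat_adjoint B"
  have Z: "Z \<in> carrier_mat d2 d2" using B(1) by (simp add: Z_def)
  have zc: "col Z k \<in> carrier_vec d2" for k using Z by (metis carrier_matD(1) col_dim)
  have "det B \<noteq> 0" using det_mult[OF B(1) Y] B(2) by auto
  then have detZ: "det Z \<noteq> 0" using det_mat_adjoint_nonzero[OF B(1)] by (simp add: Z_def)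
  have YZ: "mat_adjoint Y * Z = 1\<^sub>m d2"
    using mat_adjoint_mult[OF B(1) Y] B(2) by (simp add: Z_def)
  have dual: "cinner (y (b k)) (col Z l) = (if k = l then 1 else 0)" if "k < d2" "l < d2" for k l
  proof -
    have "(mat_adjoint Y * Z) $$ (k, l) = (\<Sum>r<d2. cnj (Y $$ (r, k)) * Z $$ (r, l))"
      using Y Z that by (simp add: scalar_prod_def lessThan_atLeast0)
    also have "\<dots> = cinner (y (b k)) (col Z l)"
      unfolding cinner_eq_sum[OF y[OF b[OF that(1)]] zc] using Z that by (simp add: Y_def)
    finally show ?thesis using that by (simp add: YZ)
  qed
  have eq: "vec_state (x j) X = vec_state (x (b k)) X"
    if j: "j < m" and k: "k < d2" and nz: "cinner (y j) (col Z k) \<noteq> 0" and X: "X \<in>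
        carrier_mat d1 d1"
    for j k X
  proof (rule ccontr)
    assume neq: "vec_state (x j) X \<noteq> vec_state (x (b k)) X"
    define w where "w = x j - cinner (x (b k)) (x j) \<cdot>\<^sub>v x (b k)"
    have w: "w \<in> carrier_vec d1" "cinner (x (b k)) w = 0"
      unfolding w_def using orthogonal_part[of "x (b k)" d1 "x j"] x[OF b[OF k]] x[OF j] by auto
    have wx: "cinner (x j) w \<noteq> 0"
      using vec_state_eqI[of "x (b k)" d1 "x j" X] x[OF b[OF k]] x[OF j] neq X unfolding
          w_def by blast
    have wxj: "cinner w (x j) \<noteq> 0" and wxb: "cinner w (x (b k)) = 0"
      using cinner_commute[of "x j" d1 w] cinner_commute[of "x (b k)" d1 w] x j b[OF k] w wx by auto
    define a where "a i = (if i < d2 then x (b i) else w)" for i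
    define z where "z i = (if i < d2 then col Z i else col Z k)" for i
    have N: "cinner (a i) (ketbra (x j) (y j) *\<^sub>v z i) = cinner (y j) (z i) * cinner (a i) (x j)"
      if "j < m" for i j
    proof -
      have zi: "z i \<in> carrier_vec d2" and ai: "a i \<in> carrier_vec d1"
        using zc x b w(1) by (auto simp: z_def a_def)
      show ?thesis
        unfolding ketbra_mult_vec[OF y[OF that] zi] using ai x[OF that]
        by (simp add: cinner_smult[where d = d1])
    qed
    have "Suc d2 \<le> d2"
    proof (rule Ad_sum_length_ge[where J = "{..<m}" and V = "\<lambda>j. ketbra (x j) (y j)" and a =
        a and z = z,
          OF _ _ V])
      fix X :: "complex mat" assume X: "X \<in> carrier_mat d1 d1"
      show "\<Phi> X = mat_sum d2 d2 (\<lambda>j. Ad (ketbra (x j) (y j)) X) {..<m}"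
        unfolding \<Phi>xy[OF X] by (rule holevo_eq_Ad_sum[OF _ X]) (use x y in auto)
    next
      fix c :: "nat \<Rightarrow> complex"
      assume 0: "\<And>j. j \<in> {..<m} \<Longrightarrow> (\<Sum>i<Suc d2. c i * cinner (a i) (ketbra (x j) (y j) *\<^sub>v z i)) = 0"
      have zero: "(\<Sum>i<d2. c i * (cinner (y j) (col Z i) * cinner (x (b i)) (x j))) +
          c d2 * (cinner (y j) (col Z k) * cinner w (x j)) = 0" if "j < m" for j
      proof -
        have "(\<Sum>i<Suc d2. c i * (cinner (y j) (z i) * cinner (a i) (x j))) = 0"
          using 0[of j] that by (simp only: N lessThan_iff)
        then show ?thesis by (simp add: a_def z_def)
      qed
      have cl: "c l = 0" if l: "l < d2" for l
      proof -
        have "(\<Sum>i<d2. c i * (cinner (y (b l)) (col Z i) * cinner (x (b i)) (x (b l)))) =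
            (\<Sum>i<d2. if i = l then c i else 0)"
          by (intro sum.cong refl) (use dual l x b in auto)
        moreover have "cinner (y (b l)) (col Z k) * cinner w (x (b l)) = 0"
          using dual[OF l k] wxb by auto
        ultimately show ?thesis using zero[OF b[OF l]] l by auto
      qed
      moreover have "c d2 = 0" using zero[OF j] cl nz wxj by simp
      ultimately show "\<forall>i<Suc d2. c i = 0" by (auto simp: less_Suc_eq)
    qed (use x y b w(1) zc in \<open>auto simp: a_def z_def\<close>)
    then show False by simp
  qed
  have "\<exists>W. diagonalized_by d1 d2 \<Phi> (\<lambda>k. x (b k)) W"
    by (rule holevo_diagonalized[where J = "{..<m}" and Z = Z, OF _ res \<Phi>xy])
      (use x y b Z detZ eq in auto)
  then show ?thesis by blast
qed

lemma UEB_rank_one_Ad_sum: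
  assumes d1: "d1 \<ge> 1" and \<Phi>: "\<Phi> \<in> UEB d1 d2"
  shows "\<exists>n V. is_Ad_sum d1 d2 \<Phi> n V \<and> (\<forall>i<n. vec_space.rank d1 (V i) = 1)"
proof -
  obtain m :: nat and x y where x: "\<And>j. j < m \<Longrightarrow> x j \<in> carrier_vec d1 \<and> cinner (x j) (x j) = 1"
    and y: "\<And>j. j < m \<Longrightarrow> y j \<in> carrier_vec d2 \<and> y j \<noteq> 0\<^sub>v d2"
    and \<Phi>xy: "\<And>X. X \<in> carrier_mat d1 d1 \<Longrightarrow> \<Phi> X = holevo d2 {..<m} x y X"
    by (rule UEB_holevo[OF d1 \<Phi>]) blast
  let ?V = "\<lambda>j. ketbra (x j) (y j)"
  have "\<Phi> X = mat_sum d2 d2 (\<lambda>j. Ad (?V j) X) {..<m}" if X: "X \<in> carrier_mat d1 d1" for X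
    unfolding \<Phi>xy[OF X] by (rule holevo_eq_Ad_sum[OF _ X]) (use x y in auto)
  then have "is_Ad_sum d1 d2 \<Phi> m ?V" using x y by (simp add: is_Ad_sum_def)
  moreover have "vec_space.rank d1 (?V j) = 1" if j: "j < m" for j
  proof (rule rank_ketbra)
    show "x j \<noteq> 0\<^sub>v d1" using x[OF j] cinner_self_eq_0_iff[of "x j" d1] by force
  qed (use x[OF j] y[OF j] in auto)
  ultimately show ?thesis by blast
qed

lemma choi_rank_diagonalized:
  assumes "d1 \<ge> 1" "\<Phi> \<in> UEB d1 d2" "choi_rank d1 d2 \<Phi> = d2"
  shows "\<exists>u W. diagonalized_by d1 d2 \<Phi> u W"
proof -
  have "\<exists>V. is_Ad_sum d1 d2 \<Phi> (choi_rank d1 d2 \<Phi>) V"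
    unfolding choi_rank_def by (rule LeastI_ex) (use UEB_rank_one_Ad_sum[OF assms(1,2)] in blast)
  then show ?thesis using Ad_sum_dimension_diagonalized[OF assms(1,2)] assms(3) by auto
qed

lemma eb_rank_diagonalized:
  assumes "d1 \<ge> 1" "\<Phi> \<in> UEB d1 d2" "eb_rank d1 d2 \<Phi> = d2"
  shows "\<exists>u W. diagonalized_by d1 d2 \<Phi> u W"
proof -
  have "\<exists>V. is_Ad_sum d1 d2 \<Phi> (eb_rank d1 d2 \<Phi>) V \<and>
      (\<forall>i<eb_rank d1 d2 \<Phi>. vec_space.rank d1 (V i) = 1)"
    unfolding eb_rank_def by (rule LeastI_ex) (rule UEB_rank_one_Ad_sum[OF assms(1,2)])
  then show ?thesis using rank_one_Ad_sum_diagonalized[OF assms(2)] assms(3) by auto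
qed

section \<open>Characterizations of C*-extreme points\<close>

theorem theorem5p3:
  fixes d1 d2 :: nat and \<Phi> :: "complex mat \<Rightarrow> complex mat"
  assumes "d1 \<ge> 1" and "d2 \<ge> 1" and "\<Phi> \<in> UEB d1 d2"
  shows
    "(cstar_extreme_UEB d1 d2 \<Phi> \<longleftrightarrow>
       (\<exists>V. is_Ad_sum d1 d2 \<Phi> d2 V \<and> (\<forall>i<d2. vec_space.rank d1 (V i) = 1) \<and>
         (\<forall>k<d2. \<forall>S\<subseteq>{..<d2}. card S = k \<longrightarrow>
            \<not> invertible_mat (mat_sum d2 d2 (\<lambda>i. mat_adjoint (V i) * V i) S))))
     \<and>
     (cstar_extreme_UEB d1 d2 \<Phi> \<longleftrightarrow> eb_rank d1 d2 \<Phi> = d2)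
     \<and>
     (cstar_extreme_UEB d1 d2 \<Phi> \<longleftrightarrow> choi_rank d1 d2 \<Phi> = d2)
     \<and>
     (cstar_extreme_UEB d1 d2 \<Phi> \<longleftrightarrow>
       (\<exists>n\<le>d2. \<exists>\<phi> P.
         (\<forall>i<n. pure_state d1 (\<phi> i)) \<and>
         (\<forall>i<n. \<forall>j<n. i \<noteq> j \<longrightarrow> (\<exists>X\<in>carrier_mat d1 d1. \<phi> i X \<noteq> \<phi> j X)) \<and>
         (\<forall>i<n. projection_mat d2 (P i)) \<and>
         (\<forall>i<n. \<forall>j<n. i \<noteq> j \<longrightarrow> P i * P j = 0\<^sub>m d2 d2) \<and>
         mat_sum d2 d2 P {..<n} = 1\<^sub>m d2 \<and>
         (\<forall>X\<in>carrier_mat d1 d1. \<Phi> X = mat_sum d2 d2 (\<lambda>i. \<phi> i X \<cdot>\<^sub>m P i) {..<n})))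
     \<and>
     (cstar_extreme_UEB d1 d2 \<Phi> \<longleftrightarrow>
       (\<exists>u v.
         (\<forall>i<d2. u i \<in> carrier_vec d1 \<and> cinner (u i) (u i) = 1) \<and>
         orthonormal_basis d2 v \<and>
         (\<forall>X\<in>carrier_mat d1 d1. \<Phi> X =
            mat_sum d2 d2 (\<lambda>i. cinner (u i) (X *\<^sub>v u i) \<cdot>\<^sub>m ketbra (v i) (v i)) {..<d2})))
     \<and>
     (cstar_extreme_UEB d1 d2 \<Phi> \<longleftrightarrow>
       (\<exists>\<phi>. (\<forall>i<d2. pure_state d1 (\<phi> i)) \<and>
         unitarily_equivalent d1 d2 \<Phi> (direct_sum_functionals d2 \<phi>)))"
proof -
  let ?D = "\<exists>u W. diagonalized_by d1 d2 \<Phi> u W"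
  have i: "cstar_extreme_UEB d1 d2 \<Phi> \<longleftrightarrow> ?D"
    using cstar_extreme_imp_diagonalized[OF assms(1)]
      diagonalized_imp_cstar_extreme[OF assms(1,3)] by blast
  have ii: "?D \<longleftrightarrow> (\<exists>V. is_Ad_sum d1 d2 \<Phi> d2 V \<and> (\<forall>i<d2. vec_space.rank d1 (V i) = 1) \<and>
         (\<forall>k<d2. \<forall>S\<subseteq>{..<d2}. card S = k \<longrightarrow>
            \<not> invertible_mat (mat_sum d2 d2 (\<lambda>i. mat_adjoint (V i) * V i) S)))" (is "_ \<longleftrightarrow> ?II")
  proof
    assume ?D
    then obtain u W where D: "diagonalized_by d1 d2 \<Phi> u W" by blast
    let ?V = "\<lambda>k. ketbra (u k) (col W k)"
    show ?II
      by (rule exI[of _ ?V])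
        (use diagonalized_Ad_sum[OF assms(3) D] diagonalized_rank_one[OF assms(3) D]
          diagonalized_minimal[OF assms(3) D] in auto)
  next
    assume ?II
    then show ?D using rank_one_Ad_sum_diagonalized[OF assms(3)] by blast
  qed
  have iii: "?D \<longleftrightarrow> eb_rank d1 d2 \<Phi> = d2"
    using diagonalized_eb_rank[OF assms(3)] eb_rank_diagonalized[OF assms(1,3)] by blast
  have iv: "?D \<longleftrightarrow> choi_rank d1 d2 \<Phi> = d2"
    using diagonalized_choi_rank[OF assms(3)] choi_rank_diagonalized[OF assms(1,3)] by blast
  show ?thesis
    unfolding i
    by (intro conjI ii iii iv diagonalized_iff_state_projections[OF assms(1)]
        diagonalized_iff_orthonormal_basis[unfolded holevo_def]
        diagonalized_iff_direct_sum[OF assms(1)] UEB_carrier[OF assms(3)])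
qed

end
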